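(* Let $p\ge3$ be odd, let $\Omega\subset\mathbb{R}^2$ be a bounded polygonal domain, and let $\mathcal{T}$ be a regular triangulation of $\Omega$ such that every $K\in\mathcal{T}$ has an inner vertex. Let $\mathbf{z}\in\mathcal{V}_\Omega$. Then $$\left(\operatorname{span}\{1_{\mathbf{z}}\}+\operatorname{span}\{q_{p-1,\mathbf{z}'}:\mathbf{z}'\in\mathcal{C}_{\mathbf{z}}\}\right)\cap N^{\mathrm{CR}}_{p,\mathbf{z}}=\operatorname{span}\{1_{\mathbf{z}}\}.$$ If the dimension formula $\dim N_{p,\mathbf{z}}=1+\sigma_{\mathbf{z}}$ holds, where $\sigma_{\mathbf{z}}=|\mathcal{C}_{\mathbf{z}}|$, then $\dim N^{\mathrm{CR}}_{p,\mathbf{z}}=1$.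
   Context: A regular triangulation $\mathcal{T}$ of $\Omega$ is a finite set of closed (nondegenerate) triangles such that the intersection of two different triangles is either empty, a common edge, or a common point (vertex), and $\Omega$ is the interior of $\bigcup_{K\in\mathcal{T}}K$. $\mathcal{E}$ is the set of edges and $\mathcal{V}$ the set of triangle vertices; $\mathcal{V}_\Omega$ is the set of inner vertices, i.e. vertices not on $\partial\Omega$. For $\mathbf{z}\in\mathcal{V}_\Omega$: $\mathcal{T}_{\mathbf{z}}=\{K\in\mathcal{T}:\mathbf{z}\in K\}$, $\omega_{\mathbf{z}}=\bigcup_{K\in\mathcal{T}_{\mathbf{z}}}K$, $\mathcal{E}_{\mathbf{z}}=\{E\in\mathcal{E}:E\subset\omega_{\mathbf{z}}\}$, $\mathcal{V}_{\mathbf{z}}=\{\mathbf{z}'\in\mathcal{V}:\mathbf{z}'\in\omega_{\mathbf{z}}\}$. Critical points: $\mathbf{z}'\in\mathcal{V}_{\mathbf{z}}$ is a critical point for $\mathcal{T}_{\mathbf{z}}$ if there exist two straight infinite lines $L_1,L_2$ in $\mathbb{R}^2$ such that all edges $E\in\mathcal{E}_{\mathbf{z}}$ having $\mathbf{z}'$ as an endpoint satisfy $E\subset L_1\cup L_2$. $\mathcal{C}_{\mathbf{z}}$ is the set of all critical points for $\mathcal{T}_{\mathbf{z}}$. Spaces: $\mathbb{P}_{k}(\mathcal{T}_{\mathbf{z}})$ is the space of functions in $L^2(\omega_{\mathbf{z}})$ which are polynomials of total degree $\le k$ on each $K\in\mathcal{T}_{\mathbf{z}}$. $S_{p,0}(\mathcal{T}_{\mathbf{z}})$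 is the space of continuous functions on $\omega_{\mathbf{z}}$ which vanish on $\partial\omega_{\mathbf{z}}$ and are polynomials of total degree $\le p$ on each $K\in\mathcal{T}_{\mathbf{z}}$; $\mathbf{S}_{p,0}(\mathcal{T}_{\mathbf{z}})=S_{p,0}(\mathcal{T}_{\mathbf{z}})^2$. $CR_{p,0}(\mathcal{T}_{\mathbf{z}})$ is the space of all $v\in\mathbb{P}_p(\mathcal{T}_{\mathbf{z}})$ such that $\int_E[v]_E\,q=0$ for every edge $E$ of $\mathcal{T}_{\mathbf{z}}$ not contained in $\partial\omega_{\mathbf{z}}$, and $\int_Ev\,q=0$ for every edge $E\subset\partial\omega_{\mathbf{z}}$ of $\mathcal{T}_{\mathbf{z}}$, in both cases for all polynomials $q$ of degree $\le p-1$ on $E$, where $[v]_E$ denotes the jump across $E$; $\mathbf{CR}_{p,0}(\mathcal{T}_{\mathbf{z}})=CR_{p,0}(\mathcal{T}_{\mathbf{z}})^2$. Define $$N_{p,\mathbf{z}}=\{q\in\mathbb{P}_{p-1}(\mathcal{T}_{\mathbf{z}}):\ (q,\operatorname{div}\mathbf{v})_{L^2(\omega_{\mathbf{z}})}=0\ \ \forall\mathbf{v}\in\mathbf{S}_{p,0}(\mathcal{T}_{\mathbf{z}})\},$$ $$N^{\mathrm{CR}}_{p,\mathbf{z}}=\{q\in\mathbb{P}_{p-1}(\mathcal{T}_{\mathbf{z}}):\ (q,\operatorname{div}\mathbf{v})_{L^2(\omega_{\mathbf{z}})}=0\ \ \forall\mathbf{v}\in\mathbf{CR}_{p,0}(\mathcal{T}_{\mathbf{z}})\},$$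 with the divergence taken piecewise on each triangle. $1_{\mathbf{z}}$ is the constant function $1$ on $\omega_{\mathbf{z}}$. Critical functions: fix a (non-unique) sign function $\sigma:\mathcal{T}_{\mathbf{z}}\to\{-1,1\}$, $K\mapsto\sigma_K$, by the condition that $\sigma_K=-\sigma_{K'}$ whenever two different triangles $K,K'\in\mathcal{T}_{\mathbf{z}}$ share an edge. For $\mathbf{z}'\in\mathcal{C}_{\mathbf{z}}$, $$q_{p-1,\mathbf{z}'}=\begin{cases}\dfrac{\sigma_K}{|K|}\,P_{p-1}^{(0,2)}(1-2\lambda_{K,\mathbf{z}'})&\text{on }K\in\mathcal{T}_{\mathbf{z}}\text{ with }\mathbf{z}'\in K,\\[1ex]0&\text{otherwise,}\end{cases}$$ where $|K|$ is the area of $K$, $\lambda_{K,\mathbf{z}'}$ is the barycentric coordinate of $K$ for the vertex $\mathbf{z}'$ (the affine function equal to $1$ at $\mathbf{z}'$ and $0$ at the other two vertices of $K$), and $P_n^{(\alpha,\beta)}$ ($\alpha,\beta>-1$) is the Jacobi polynomial: the polynomial of degree $n$ with $\int_{-1}^1P_n^{(\alpha,\beta)}(x)q(x)(1-x)^\alpha(1+x)^\beta dx=0$ for all polynomials $q$ of degree less than $n$ and $P_n^{(\alpha,\beta)}(1)=\frac{(\alpha+1)(\alpha+2)\cdots(\alpha+n)}{n!}$. *)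

theory Defs
  imports "HOL-Analysis.Analysis" "HOL-Library.Function_Algebras" "HOL-Library.Set_Algebras"
    "HOL-Computational_Algebra.Polynomial"
begin

section \<open>Triangulations, vertex patches and critical points\<close>

definition polygonal_domain :: "(real^2) set \<Rightarrow> bool" where
  "polygonal_domain \<Omega> \<longleftrightarrow> open \<Omega> \<and> connected \<Omega> \<and> \<Omega> \<noteq> {} \<and>
     (\<exists>S. finite S \<and> (\<forall>E\<in>S. \<exists>a b. E = closed_segment a b) \<and> frontier \<Omega> = \<Union>S)"

definition regular_triangulation :: "(real^2) set set \<Rightarrow> (real^2) set \<Rightarrow> bool" where
  "regular_triangulation T \<Omega> \<longleftrightarrow> finite T \<and> (\<forall>K\<in>T. 2 simplex K) \<and>
     (\<forall>K\<in>T. \<forall>K'\<in>T. K \<noteq> K' \<longrightarrow>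
        K \<inter> K' = {} \<or>
        (K \<inter> K' edge_of K \<and> K \<inter> K' edge_of K') \<or>
        (\<exists>x. x extreme_point_of K \<and> x extreme_point_of K' \<and> K \<inter> K' = {x})) \<and>
     \<Omega> = interior (\<Union>T)"

definition edges :: "(real^2) set set \<Rightarrow> (real^2) set set" where
  "edges T = {E. \<exists>K\<in>T. E edge_of K}"

definition vertices :: "(real^2) set set \<Rightarrow> (real^2) set" where
  "vertices T = {x. \<exists>K\<in>T. x extreme_point_of K}"

definition inner_vertices :: "(real^2) set set \<Rightarrow> (real^2) set \<Rightarrow> (real^2) set" where
  "inner_vertices T \<Omega> = vertices T - frontier \<Omega>"

definition patch :: "(real^2) set set \<Rightarrow> real^2 \<Rightarrow> (real^2) set set" where
  "patch T z = {K\<in>T. z \<in> K}"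

definition patch_edges :: "(real^2) set set \<Rightarrow> real^2 \<Rightarrow> (real^2) set set" where
  "patch_edges T z = {E\<in>edges T. E \<subseteq> \<Union>(patch T z)}"

definition patch_vertices :: "(real^2) set set \<Rightarrow> real^2 \<Rightarrow> (real^2) set" where
  "patch_vertices T z = {y\<in>vertices T. y \<in> \<Union>(patch T z)}"

definition is_line :: "(real^2) set \<Rightarrow> bool" where
  "is_line L \<longleftrightarrow> affine L \<and> aff_dim L = 1"

definition critical_points :: "(real^2) set set \<Rightarrow> real^2 \<Rightarrow> (real^2) set" where
  "critical_points T z = {y\<in>patch_vertices T z.
     \<exists>L1 L2. is_line L1 \<and> is_line L2 \<and>
       (\<forall>E\<in>patch_edges T z. y extreme_point_of E \<longrightarrow> E \<subseteq> L1 \<union> L2)}"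

section \<open>The vector space of real functions on the plane\<close>

definition fun_scale :: "real \<Rightarrow> (real^2 \<Rightarrow> real) \<Rightarrow> (real^2 \<Rightarrow> real)" where
  "fun_scale c f = (\<lambda>x. c * f x)"

global_interpretation fun_space: vector_space fun_scale
  by unfold_locales (auto simp: fun_scale_def fun_eq_iff algebra_simps)

section \<open>Piecewise polynomials\<close>

definition polys :: "nat \<Rightarrow> (real^2 \<Rightarrow> real) set" where
  "polys k = {f. \<exists>c :: nat \<Rightarrow> nat \<Rightarrow> real. \<forall>x. f x = (\<Sum>i\<le>k. \<Sum>j\<le>k - i. c i j * (x$1)^i * (x$2)^j)}"

text \<open>
  A piecewise smooth element of \<open>L\<^sup>2(\<Union>Ts)\<close> is only determined up to the null set formed by
  the triangle boundaries. It is represented by the function that vanishes outside the union of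
  the interiors of the triangles; equality and dimension in \<open>L\<^sup>2\<close> are then equality and
  dimension of these representatives. \<open>piecewise Ts g\<close> is the representative of the function
  given by \<open>g K\<close> on each \<open>K \<in> Ts\<close> (the interiors of the triangles being disjoint).
\<close>

definition piecewise :: "(real^2) set set \<Rightarrow> ((real^2) set \<Rightarrow> real^2 \<Rightarrow> real) \<Rightarrow> (real^2 \<Rightarrow> real)" where
  "piecewise Ts g = (\<lambda>x. \<Sum>K\<in>Ts. if x \<in> interior K then g K x else 0)"

definition PP :: "nat \<Rightarrow> (real^2) set set \<Rightarrow> (real^2 \<Rightarrow> real) set" where
  "PP k Ts = {f. (\<forall>K\<in>Ts. \<exists>g\<in>polys k. \<forall>x\<in>interior K. f x = g x) \<and>
                 (\<forall>x. x \<notin> (\<Union>K\<in>Ts. interior K) \<longrightarrow> f x = 0)}"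

definition one_on :: "(real^2) set set \<Rightarrow> (real^2 \<Rightarrow> real)" where
  "one_on Ts = piecewise Ts (\<lambda>K x. 1)"

section \<open>Conforming and Crouzeix-Raviart spaces\<close>

definition S0 :: "nat \<Rightarrow> (real^2) set set \<Rightarrow> (real^2 \<Rightarrow> real) set" where
  "S0 p Ts = {v. continuous_on (\<Union>Ts) v \<and> (\<forall>x\<in>frontier (\<Union>Ts). v x = 0) \<and>
                 (\<forall>K\<in>Ts. \<exists>g\<in>polys p. \<forall>x\<in>K. v x = g x)}"

definition side_trace :: "(real^2) set \<Rightarrow> (real^2 \<Rightarrow> real) \<Rightarrow> (real^2 \<Rightarrow> real)" where
  "side_trace K v = (\<lambda>x. Lim (at x within interior K) v)"

definition segment_integral :: "real^2 \<Rightarrow> real^2 \<Rightarrow> (real^2 \<Rightarrow> real) \<Rightarrow> real" where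
  "segment_integral a b f = dist a b * integral {0..1} (\<lambda>t. f (linepath a b t))"

text \<open>
  The polynomials of degree at most \<open>p - 1\<close> on an edge are the restrictions of the bivariate
  polynomials of total degree at most \<open>p - 1\<close>. The sign of the jump depends on the order of
  the two triangles, which is irrelevant here.
\<close>

definition CR0 :: "nat \<Rightarrow> (real^2) set set \<Rightarrow> (real^2 \<Rightarrow> real) set" where
  "CR0 p Ts = {v \<in> PP p Ts. \<forall>a b. closed_segment a b \<in> edges Ts \<longrightarrow>
     (\<not> closed_segment a b \<subseteq> frontier (\<Union>Ts) \<longrightarrow>
        (\<forall>K\<in>Ts. \<forall>K'\<in>Ts. K \<noteq> K' \<and> closed_segment a b edge_of K \<and> closed_segment a b edge_of K' \<longrightarrow>
           (\<forall>q\<in>polys (p - 1).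
              segment_integral a b (\<lambda>x. (side_trace K v x - side_trace K' v x) * q x) = 0))) \<and>
     (closed_segment a b \<subseteq> frontier (\<Union>Ts) \<longrightarrow>
        (\<forall>K\<in>Ts. closed_segment a b edge_of K \<longrightarrow>
           (\<forall>q\<in>polys (p - 1). segment_integral a b (\<lambda>x. side_trace K v x * q x) = 0)))}"

definition div_pw :: "(real^2) set set \<Rightarrow> (real^2 \<Rightarrow> real^2) \<Rightarrow> (real^2 \<Rightarrow> real)" where
  "div_pw Ts v = piecewise Ts (\<lambda>K x. trace (jacobian v (at x)))"

definition div_annihilator ::
    "nat \<Rightarrow> (real^2) set set \<Rightarrow> (real^2 \<Rightarrow> real) set \<Rightarrow> (real^2 \<Rightarrow> real) set" where
  "div_annihilator p Ts V = {q \<in> PP (p - 1) Ts.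
     \<forall>v. (\<forall>i. (\<lambda>x. v x $ i) \<in> V) \<longrightarrow> integral (\<Union>Ts) (\<lambda>x. q x * div_pw Ts v x) = 0}"

definition N_conf :: "nat \<Rightarrow> (real^2) set set \<Rightarrow> (real^2 \<Rightarrow> real) set" where
  "N_conf p Ts = div_annihilator p Ts (S0 p Ts)"

definition N_CR :: "nat \<Rightarrow> (real^2) set set \<Rightarrow> (real^2 \<Rightarrow> real) set" where
  "N_CR p Ts = div_annihilator p Ts (CR0 p Ts)"

section \<open>Critical functions\<close>

text \<open>
  The values \<open>(1 - x) powr 0\<close> at \<open>x = 1\<close> and \<open>(1 + x) powr 0\<close> at \<open>x = -1\<close> are
  \<open>0\<close> by convention, which does not affect the integral.
\<close>

definition jacobi_poly :: "real \<Rightarrow> real \<Rightarrow> nat \<Rightarrow> real poly" where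
  "jacobi_poly \<alpha> \<beta> n = (THE P. degree P = n \<and>
     (\<forall>q :: real poly. degree q < n \<longrightarrow>
        integral {-1..1} (\<lambda>x. poly P x * poly q x * (1 - x) powr \<alpha> * (1 + x) powr \<beta>) = 0) \<and>
     poly P 1 = (\<Prod>i=1..n. \<alpha> + real i) / fact n)"

definition barycentric :: "(real^2) set \<Rightarrow> real^2 \<Rightarrow> (real^2 \<Rightarrow> real)" where
  "barycentric K y = (THE l. (\<exists>a b. \<forall>x. l x = a \<bullet> x + b) \<and> l y = 1 \<and>
     (\<forall>w. w extreme_point_of K \<and> w \<noteq> y \<longrightarrow> l w = 0))"

text \<open>
  Around an inner vertex that lies in an odd number of triangles no sign function can alternate
  across all interior edges of the patch. Critical functions only involve the relative sign of
  triangles that have a common critical point, so alternation is required exactly across edges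
  that contain a critical point: such functions exist for every patch, and they include all
  functions that alternate across every interior edge.
\<close>

definition sign_function :: "(real^2) set set \<Rightarrow> real^2 \<Rightarrow> ((real^2) set \<Rightarrow> real) \<Rightarrow> bool" where
  "sign_function T z \<sigma> \<longleftrightarrow> (\<forall>K\<in>patch T z. \<sigma> K \<in> {-1, 1}) \<and>
     (\<forall>K\<in>patch T z. \<forall>K'\<in>patch T z. \<forall>E. K \<noteq> K' \<and> E edge_of K \<and> E edge_of K' \<and>
        E \<inter> critical_points T z \<noteq> {} \<longrightarrow> \<sigma> K = - \<sigma> K')"

definition critical_function ::
    "(real^2) set set \<Rightarrow> real^2 \<Rightarrow> ((real^2) set \<Rightarrow> real) \<Rightarrow> nat \<Rightarrow> real^2 \<Rightarrow> (real^2 \<Rightarrow> real)" where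
  "critical_function T z \<sigma> n y = piecewise (patch T z) (\<lambda>K x.
     if y \<in> K
     then \<sigma> K / measure lebesgue K * poly (jacobi_poly 0 2 n) (1 - 2 * barycentric K y x)
     else 0)"

end

theory Submission
  imports Defs
begin

text \<open>
  Write \<open>K\<close> for the triangles of the patch, \<open>bary\<close> for barycentric coordinates, \<open>J\<close> for the
  Jacobi polynomial of degree \<open>p - 1\<close> in the critical functions, and let \<open>L\<close> be an odd polynomial
  of degree \<open>p\<close> that is orthogonal to all polynomials of lower degree on \<open>[-1, 1]\<close>, i.e. a
  multiple of the Legendre polynomial.

  The computations rest on one property of the critical functions. Integrate
  \<open>J (1 - 2 * bary)\<close> times a polynomial \<open>f\<close> of degree at most \<open>p - 1\<close> over a triangle, slice
  by slice parallel to the edge opposite to the vertex \<open>y\<close>. The length of a slice supplies a weight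
  \<open>1 + x\<close>, and orthogonality of \<open>J\<close> for the weight \<open>(1 + x)\<^sup>2\<close> removes everything but the
  value \<open>f y\<close>. So the integral is a fixed nonzero multiple of the area times \<open>f y\<close>
  (\<open>reproducing_property\<close>), and pairing a critical function with a divergence evaluates the
  divergence at the critical point, with alternating signs (\<open>critical_pairing\<close>).

  For conforming fields this alternating sum cancels: the divergence at \<open>y\<close> splits into derivatives
  along the edges at \<open>y\<close>, these are continuous across inner edges and zero on the boundary, and the
  coefficients agree on both sides of an edge because the edges at \<open>y\<close> lie on two lines
  (\<open>critical_function_in_N_conf\<close>).

  Crouzeix-Raviart fields detect more. For an inner edge take the field that is
  \<open>L (1 - 2 * bary)\<close>, with the coordinate of the vertex opposite to the edge, on the two adjacent
  triangles. Its gradient at a vertex involves \<open>L'\<close> at \<open>1\<close> or at \<open>-1\<close>, and for odd \<open>p\<close> both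
  values agree; so \<open>K\<close> contributes through the sum \<open>weight\<close> of the signed coefficients of its
  critical vertices, whichever vertices these are. Annihilating the divergence of this field means
  that the ratio of weight and area is the same on both triangles (\<open>weight_balance\<close>).

  The rest is combinatorial. Along a straight side of the patch the signs make the weights telescope
  to zero while the areas add up, so all weights vanish (\<open>weight_zero\<close>); if \<open>z\<close> itself is critical, it
  is the only critical point, and two neighbouring triangles lead to the same conclusion. In the main
  case the coefficients then have
  equal modulus at the two outer vertices of every triangle, which is impossible for a critical vertex
  with nonzero coefficient that is farthest from \<open>z\<close>. Hence only the constants survive, and they do
  lie in the annihilator by the divergence theorem (\<open>one_on_in_N_CR\<close>).

  The same argument shows that \<open>1\<close> and the critical functions are linearly independent. If the
  dimension of the conforming annihilator is their number, they span it, and the Crouzeix-Raviart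
  annihilator, being a subspace of it, consists of the constants.
\<close>

section \<open>Polynomials in two variables\<close>

lemma sum_fun_apply: "(\<Sum>i\<in>A. f i) x = (\<Sum>i\<in>A. f i x)"
  by (induction A rule: infinite_finite_induct) auto

text \<open>
  Closure properties then follow by induction over the span instead of manipulating double sums.
\<close>

lemma polys_eq_span:
  "polys k = fun_space.span {f. \<exists>i j. i + j \<le> k \<and> f = (\<lambda>x. (x$1)^i * (x$2)^j)}" (is "_ = fun_space.span ?M")
proof
  have sub: "fun_space.subspace (polys k)"
    unfolding fun_space.subspace_def
  proof (intro conjI ballI allI)
    show "0 \<in> polys k"
      unfolding polys_def by (auto intro!: exI[of _ "\<lambda>i j. 0"])
  next
    fix f g assume "f \<in> polys k" "g \<in> polys k"
    then obtain c d where
      "\<And>x. f x = (\<Sum>i\<le>k. \<Sum>j\<le>k - i. c i j * (x$1)^i * (x$2)^j)"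
      "\<And>x. g x = (\<Sum>i\<le>k. \<Sum>j\<le>k - i. d i j * (x$1)^i * (x$2)^j)"
      unfolding polys_def by blast
    then show "f + g \<in> polys k"
      unfolding polys_def
      by (auto intro!: exI[of _ "\<lambda>i j. c i j + d i j"] simp: sum.distrib algebra_simps)
  next
    fix a f assume "f \<in> polys k"
    then obtain c where
      "\<And>x. f x = (\<Sum>i\<le>k. \<Sum>j\<le>k - i. c i j * (x$1)^i * (x$2)^j)"
      unfolding polys_def by blast
    then show "fun_scale a f \<in> polys k"
      unfolding polys_def fun_scale_def
      by (auto intro!: exI[of _ "\<lambda>i j. a * c i j"] simp: sum_distrib_left algebra_simps)
  qed
  have "f \<in> polys k" if "f \<in> ?M" for f
  proof -
    from that obtain i j where ij: "i + j \<le> k" "f = (\<lambda>x. (x$1)^i * (x$2)^j)" by blast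
    have "f x = (\<Sum>i'\<le>k. \<Sum>j'\<le>k - i'. (if i' = i then if j' = j then 1 else 0 else 0) * (x$1)^i' * (x$2)^j')" for x
    proof -
      have "(\<Sum>j'\<le>k - i'. (if i' = i then if j' = j then 1 else 0 else 0) * (x$1)^i' * (x$2)^j')
          = (\<Sum>j'\<le>k - i'. if j' = j then (if i' = i then (x$1)^i * (x$2)^j else 0) else 0)" for i'
        by (intro sum.cong) auto
      then have "(\<Sum>i'\<le>k. \<Sum>j'\<le>k - i'. (if i' = i then if j' = j then 1 else 0 else 0) * (x$1)^i' * (x$2)^j')
        = (\<Sum>i'\<le>k. if i' = i then (x$1)^i * (x$2)^j else 0)"
        using ij by (intro sum.cong) (auto simp: sum.delta)
      also have "\<dots> = f x" using ij by (simp add: sum.delta)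
      finally show ?thesis by (rule sym)
    qed
    then show ?thesis unfolding polys_def
      by (auto intro!: exI[of _ "\<lambda>i' j'. if i' = i then if j' = j then 1 else 0 else 0"])
  qed
  then show "fun_space.span ?M \<subseteq> polys k"
    by (intro fun_space.span_minimal sub) blast
  show "polys k \<subseteq> fun_space.span ?M"
  proof
    fix f assume "f \<in> polys k"
    then obtain c where c:
      "\<And>x. f x = (\<Sum>i\<le>k. \<Sum>j\<le>k - i. c i j * (x$1)^i * (x$2)^j)"
      unfolding polys_def by blast
    have "f = (\<Sum>i\<le>k. \<Sum>j\<le>k - i. fun_scale (c i j) (\<lambda>x. (x$1)^i * (x$2)^j))"
      by (rule ext) (simp add: c fun_scale_def sum_fun_apply mult.assoc)
    also have "\<dots> \<in> fun_space.span ?M"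
    proof (intro fun_space.span_sum fun_space.span_scale fun_space.span_base)
      fix i j assume "i \<in> {..k}" "j \<in> {..k - i}"
      then have "i + j \<le> k" by auto
      then show "(\<lambda>x. (x$1)^i * (x$2)^j) \<in> ?M" by blast
    qed
    finally show "f \<in> fun_space.span ?M" .
  qed
qed

lemma subspace_polys: "fun_space.subspace (polys k)"
  unfolding polys_eq_span by (rule fun_space.subspace_span)

lemma polys_induct [consumes 1, case_names zero add scale monom]:
  assumes "f \<in> polys k"
    and "Q (\<lambda>x. 0)"
    and "\<And>f g. f \<in> polys k \<Longrightarrow> g \<in> polys k \<Longrightarrow> Q f \<Longrightarrow> Q g \<Longrightarrow> Q (\<lambda>x. f x + g x)"
    and "\<And>c f. f \<in> polys k \<Longrightarrow> Q f \<Longrightarrow> Q (\<lambda>x. c * f x)"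
    and "\<And>i j. i + j \<le> k \<Longrightarrow> Q (\<lambda>x. (x$1)^i * (x$2)^j)"
  shows "Q f"
proof -
  let ?M = "{f. \<exists>i j. i + j \<le> k \<and> f = (\<lambda>x::real^2. (x$1)^i * (x$2)^j)}"
  have "f \<in> fun_space.span ?M" using assms(1) by (simp add: polys_eq_span)
  then have "f \<in> polys k \<and> Q f"
  proof (induction rule: fun_space.span_induct_alt)
    case base
    then show ?case using assms(2) fun_space.subspace_0[OF subspace_polys] by (simp add: zero_fun_def)
  next
    case (step c f g)
    have f: "f \<in> polys k" "Q f"
      using step(1) assms(5) by (auto simp: polys_eq_span intro!: fun_space.span_base)
    then have cf: "fun_scale c f \<in> polys k" "Q (fun_scale c f)"
      using assms(4) by (auto simp: fun_scale_def[abs_def] intro: fun_space.subspace_scale[OF subspace_polys, unfolded fun_scale_def])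
    with step assms(3)[of "fun_scale c f" g] show ?case
      by (auto simp: plus_fun_def intro: fun_space.subspace_add[OF subspace_polys, unfolded plus_fun_def])
  qed
  then show ?thesis by simp
qed

lemma polys_add: "f \<in> polys k \<Longrightarrow> g \<in> polys k \<Longrightarrow> (\<lambda>x. f x + g x) \<in> polys k"
  using fun_space.subspace_add[OF subspace_polys] by (simp add: plus_fun_def)

lemma polys_cmult: "f \<in> polys k \<Longrightarrow> (\<lambda>x. c * f x) \<in> polys k"
  using fun_space.subspace_scale[OF subspace_polys] by (simp add: fun_scale_def)

lemma polys_monom: "i + j \<le> k \<Longrightarrow> (\<lambda>x. (x$1)^i * (x$2)^j) \<in> polys k"
  unfolding polys_eq_span by (intro fun_space.span_base) blast

lemma polys_const: "(\<lambda>x. c) \<in> polys k"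
  using polys_cmult[OF polys_monom[of 0 0 k], of c] by simp

lemma polys_sum: "(\<And>i. i \<in> A \<Longrightarrow> f i \<in> polys k) \<Longrightarrow> (\<lambda>x. \<Sum>i\<in>A. f i x) \<in> polys k"
  by (induction A rule: infinite_finite_induct) (auto intro: polys_const polys_add)

lemma polys_mono: "f \<in> polys k \<Longrightarrow> k \<le> l \<Longrightarrow> f \<in> polys l"
  by (induction rule: polys_induct) (auto intro: polys_const polys_add polys_cmult polys_monom)

lemma polys_mult:
  assumes "f \<in> polys k" and "g \<in> polys l"
  shows "(\<lambda>x. f x * g x) \<in> polys (k + l)"
  using assms(1)
proof (induction rule: polys_induct)
  case (monom i j)
  from assms(2) show ?case
  proof (induction rule: polys_induct)
    case (monom i' j')
    have "(\<lambda>x::real^2. x$1^i * x$2^j * (x$1^i' * x$2^j')) = (\<lambda>x. x$1^(i+i') * x$2^(j+j'))"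
      by (auto simp: power_add)
    with monom \<open>i + j \<le> k\<close> show ?case by (auto intro: polys_monom)
  next
    case (scale c f)
    then show ?case using polys_cmult[of _ _ c] by (simp add: mult.left_commute)
  qed (auto simp: distrib_left intro: polys_const polys_add)
next
  case (scale c f)
  then show ?case using polys_cmult[of _ _ c] by (simp add: mult.assoc)
qed (auto simp: distrib_right intro: polys_const polys_add)

lemma polys_power: "f \<in> polys k \<Longrightarrow> (\<lambda>x. f x ^ n) \<in> polys (n * k)"
  by (induction n) (auto intro: polys_const polys_mult)

lemma polys_affine: "(\<lambda>x. a * x$1 + b * x$2 + c) \<in> polys 1"
  using polys_monom[of 1 0 1] polys_monom[of 0 1 1]
  by (auto intro!: polys_add polys_cmult polys_const)

text \<open>
  Total degree survives an affine change of coordinates, so that every triangle can be studied in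
  coordinates adapted to it.
\<close>

lemma polys_compose_affine:
  assumes "f \<in> polys k"
  shows "(\<lambda>x. f (a + (x$1) *\<^sub>R b + (x$2) *\<^sub>R c)) \<in> polys k"
  using assms
proof (induction rule: polys_induct)
  case (monom i j)
  have "(\<lambda>x. (b$1 * x$1 + c$1 * x$2 + a$1)^i * (b$2 * x$1 + c$2 * x$2 + a$2)^j) \<in> polys (i * 1 + j * 1)"
    by (intro polys_mult polys_power polys_affine)
  then show ?case using monom by (auto simp: algebra_simps elim: polys_mono)
qed (auto intro: polys_const polys_add polys_cmult)

lemma polys_poly_compose:
  assumes "l \<in> polys 1" and "degree P \<le> k"
  shows "(\<lambda>x. poly P (l x)) \<in> polys k"
  unfolding poly_altdef
proof (intro polys_sum polys_cmult)
  fix i assume "i \<in> {..degree P}"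
  then show "(\<lambda>x. l x ^ i) \<in> polys k"
    using polys_power[OF assms(1), of i] assms(2) by (auto elim: polys_mono)
qed

lemma polys_deriv:
  assumes "f \<in> polys k"
  shows "\<exists>g1\<in>polys (k - 1). \<exists>g2\<in>polys (k - 1).
           \<forall>x. (f has_derivative (\<lambda>d. g1 x * d$1 + g2 x * d$2)) (at x)"
  using assms
proof (induction rule: polys_induct)
  case zero
  show ?case by (rule bexI[OF _ polys_const[of 0]])+ (auto intro!: derivative_eq_intros)
next
  case (add f g)
  then obtain f1 f2 g1 g2 where *: "f1 \<in> polys (k - 1)" "f2 \<in> polys (k - 1)"
    "g1 \<in> polys (k - 1)" "g2 \<in> polys (k - 1)"
    "\<And>x. (f has_derivative (\<lambda>d. f1 x * d$1 + f2 x * d$2)) (at x)"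
    "\<And>x. (g has_derivative (\<lambda>d. g1 x * d$1 + g2 x * d$2)) (at x)"
    by blast
  show ?case
    by (rule bexI[OF _ polys_add[OF *(1,3)]], rule bexI[OF _ polys_add[OF *(2,4)]])
       (auto intro!: derivative_eq_intros * simp: algebra_simps)
next
  case (scale c f)
  then obtain f1 f2 where *: "f1 \<in> polys (k - 1)" "f2 \<in> polys (k - 1)"
    "\<And>x. (f has_derivative (\<lambda>d. f1 x * d$1 + f2 x * d$2)) (at x)"
    by blast
  show ?case
    by (rule bexI[OF _ polys_cmult[OF *(1), of c]], rule bexI[OF _ polys_cmult[OF *(2), of c]])
       (auto intro!: derivative_eq_intros * simp: algebra_simps)
next
  case (monom i j)
  have 1: "(\<lambda>x. real i * ((x$1)^(i-1) * (x$2)^j)) \<in> polys (k - 1)"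
    using monom polys_cmult[OF polys_monom[of "i - 1" j "k - 1"]] polys_const[of 0] by (cases "i = 0") auto
  have 2: "(\<lambda>x. real j * ((x$1)^i * (x$2)^(j-1))) \<in> polys (k - 1)"
    using monom polys_cmult[OF polys_monom[of i "j - 1" "k - 1"]] polys_const[of 0] by (cases "j = 0") auto
  have "((\<lambda>x::real^2. (x$1)^i * (x$2)^j) has_derivative
      (\<lambda>d. (real i * ((x$1)^(i-1) * (x$2)^j)) * d$1 + (real j * ((x$1)^i * (x$2)^(j-1))) * d$2)) (at x)" for x
    by (auto intro!: derivative_eq_intros bounded_linear.has_derivative[OF bounded_linear_vec_nth] simp: algebra_simps)
  then show ?case by (intro bexI[OF _ 1] bexI[OF _ 2]) blast
qed

lemma continuous_on_polys: "f \<in> polys k \<Longrightarrow> continuous_on S f"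
  by (induction rule: polys_induct) (auto intro!: continuous_intros)

section \<open>Orthogonal polynomials in one variable\<close>

definition poly_int :: "real poly \<Rightarrow> real" where
  "poly_int P = integral {-1..1} (\<lambda>x. poly P x)"

lemma poly_integrable: "poly P integrable_on {a..b}" for P :: "real poly"
  by (intro integrable_continuous_real continuous_intros)

lemma poly_int_add: "poly_int (P + Q) = poly_int P + poly_int Q"
  unfolding poly_int_def poly_add by (intro integral_add poly_integrable)

lemma poly_int_smult: "poly_int (smult c P) = c * poly_int P"
  unfolding poly_int_def poly_smult by (rule integral_mult_right)

lemma poly_int_diff: "poly_int (P - Q) = poly_int P - poly_int Q"
  using poly_int_add[of P "smult (-1) Q"] poly_int_smult[of "-1" Q] by simp

lemma poly_int_0: "poly_int 0 = 0"
  using poly_int_smult[of 0 0] by simp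

lemma poly_int_sum: "poly_int (\<Sum>i\<in>A. f i) = (\<Sum>i\<in>A. poly_int (f i))"
  by (induction A rule: infinite_finite_induct) (auto simp: poly_int_0 poly_int_add)

text \<open>
  A vanishing integral would force infinitely many roots upon \<open>W * (P * P)\<close>.
\<close>

lemma poly_int_square_pos:
  assumes W: "W \<noteq> 0" "\<And>x. -1 \<le> x \<Longrightarrow> x \<le> 1 \<Longrightarrow> 0 \<le> poly W x" and P: "P \<noteq> 0"
  shows "0 < poly_int (W * (P * P))"
proof -
  have nonneg: "0 \<le> poly (W * (P * P)) x" if "x \<in> {-1..1}" for x
    using W(2) that by auto
  have "poly_int (W * (P * P)) \<noteq> 0"
  proof
    assume "poly_int (W * (P * P)) = 0"
    then have "\<forall>x\<in>{-1..1}. poly (W * (P * P)) x = 0"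
      unfolding poly_int_def
      by (subst (asm) integral_eq_0_iff) (use nonneg in \<open>auto intro!: continuous_intros simp del: poly_mult\<close>)
    then have "{-1..1} \<subseteq> {x. poly (W * (P * P)) x = 0}" by auto
    then have "finite {-1..1::real}"
      by (rule finite_subset) (use W(1) P in \<open>auto intro!: poly_roots_finite\<close>)
    then show False using infinite_Icc[of "-1" "1::real"] by simp
  qed
  moreover have "0 \<le> poly_int (W * (P * P))"
    unfolding poly_int_def by (intro integral_nonneg poly_integrable nonneg)
  ultimately show ?thesis by simp
qed

text \<open>
  Gram-Schmidt, started from the monomial of degree \<open>n\<close>; the \<open>e i\<close> are the orthogonal polynomials
  of lower degree.
\<close>

lemma orthogonal_poly_exists:
  assumes W: "W \<noteq> 0" "\<And>x. -1 \<le> x \<Longrightarrow> x \<le> 1 \<Longrightarrow> 0 \<le> poly W x"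
  shows "\<exists>R. R \<noteq> 0 \<and> degree R = n \<and> (\<forall>Q. degree Q < n \<longrightarrow> poly_int (W * (R * Q)) = 0)"
proof (induction n rule: less_induct)
  case (less n)
  then obtain e where e: "\<And>i. i < n \<Longrightarrow> e i \<noteq> 0 \<and> degree (e i) = i \<and>
      (\<forall>Q. degree Q < i \<longrightarrow> poly_int (W * (e i * Q)) = 0)"
    by metis
  have orth: "poly_int (W * (e i * e j)) = 0" if "i < n" "j < n" "i \<noteq> j" for i j
    using that e[of i] e[of j] by (metis linorder_neqE_nat mult.commute)
  define c where "c i = poly_int (W * (monom 1 n * e i)) / poly_int (W * (e i * e i))" for i
  define S where "S = (\<Sum>i<n. smult (c i) (e i))"
  define R where "R = monom 1 n - S"
  have degS: "degree S < n" if "n > 0"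
  proof -
    have "degree S \<le> n - 1" unfolding S_def
      using e by (intro degree_sum_le) (auto intro!: order.trans[OF degree_smult_le])
    with that show ?thesis by simp
  qed
  have S0: "S = 0" if "n = 0" using that by (simp add: S_def)
  have degR: "degree R = n"
  proof (cases "n = 0")
    case True then show ?thesis using S0 by (simp add: R_def)
  next
    case False
    then have "degree S < degree (monom 1 n :: real poly)" using degS by (simp add: degree_monom_eq)
    then have "degree R = degree (monom 1 n :: real poly)"
      unfolding R_def using degree_add_eq_left[of "-S" "monom 1 n"] by simp
    then show ?thesis by (simp add: degree_monom_eq)
  qed
  have R0: "R \<noteq> 0"
  proof (cases "n = 0")
    case True then show ?thesis using S0 by (simp add: R_def)
  next
    case False then show ?thesis using degR by auto
  qed
  have Re: "poly_int (W * (R * e j)) = 0" if j: "j < n" for j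
  proof -
    have "W * (R * e j) = W * (monom 1 n * e j) - (\<Sum>i<n. smult (c i) (W * (e i * e j)))"
      unfolding R_def S_def by (simp add: algebra_simps sum_distrib_left sum_distrib_right)
    then have "poly_int (W * (R * e j)) = poly_int (W * (monom 1 n * e j))
        - (\<Sum>i<n. c i * poly_int (W * (e i * e j)))"
      by (simp only: poly_int_diff poly_int_sum poly_int_smult)
    also have "(\<Sum>i<n. c i * poly_int (W * (e i * e j)))
        = (\<Sum>i<n. if i = j then c j * poly_int (W * (e j * e j)) else 0)"
      using orth j by (intro sum.cong) auto
    also have "\<dots> = c j * poly_int (W * (e j * e j))" using j by (simp add: sum.delta)
    also have "\<dots> = poly_int (W * (monom 1 n * e j))"
      using poly_int_square_pos[OF W, of "e j"] e[OF j] by (simp add: c_def)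
    finally show ?thesis by simp
  qed
  have "poly_int (W * (R * Q)) = 0" if "degree Q < n" for Q
    using that
  proof (induction "degree Q" arbitrary: Q rule: less_induct)
    case less
    define d where "d = degree Q"
    define a where "a = lead_coeff Q / lead_coeff (e d)"
    define Q' where "Q' = Q - smult a (e d)"
    have d: "d < n" using less d_def by simp
    then have ed: "e d \<noteq> 0" "degree (e d) = d" using e by auto
    have Q: "Q = Q' + smult a (e d)" by (simp add: Q'_def)
    have "poly_int (W * (R * Q')) = 0"
    proof (cases "Q' = 0")
      case True then show ?thesis by (simp add: poly_int_0)
    next
      case False
      have le: "degree Q' \<le> d" unfolding Q'_def
        using ed by (intro degree_diff_le) (auto simp: d_def intro: order.trans[OF degree_smult_le])
      have "coeff Q' d = 0" using ed leading_coeff_0_iff[of "e d"]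
        by (simp add: Q'_def a_def d_def[symmetric] del: leading_coeff_0_iff)
      with False le have "degree Q' < d"
        by (metis le_neq_implies_less leading_coeff_0_iff)
      then show ?thesis using less d d_def by auto
    qed
    moreover have "W * (R * Q) = W * (R * Q') + smult a (W * (R * e d))"
      by (subst Q) (simp add: algebra_simps)
    ultimately show ?case using Re[OF d] by (simp add: poly_int_add poly_int_smult)
  qed
  with R0 degR show ?case by blast
qed

text \<open>
  The normalisation at \<open>1\<close> is possible: if \<open>R\<close> vanished there, a factor \<open>x - 1\<close> could be split
  off, and pairing \<open>R\<close> with the cofactor would give an integrand of constant sign.
\<close>

lemma jacobi_02_exists:
  "\<exists>R. degree R = n \<and> (\<forall>Q. degree Q < n \<longrightarrow> poly_int ([:1,1:]^2 * (R * Q)) = 0) \<and> poly R 1 = 1"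
proof -
  let ?W = "[:1,1:]^2 :: real poly"
  have W: "?W \<noteq> 0" "\<And>x. -1 \<le> x \<Longrightarrow> x \<le> 1 \<Longrightarrow> 0 \<le> poly ?W x" by auto
  obtain R where R: "R \<noteq> 0" "degree R = n" "\<And>Q. degree Q < n \<Longrightarrow> poly_int (?W * (R * Q)) = 0"
    using orthogonal_poly_exists[OF W] by blast
  have "poly R 1 \<noteq> 0"
  proof
    assume "poly R 1 = 0"
    then obtain S where S: "R = [:-1,1:] * S" using poly_eq_0_iff_dvd by (metis dvdE)
    then have S0: "S \<noteq> 0" using R by auto
    then have "degree S < n" using S R(2) by (simp add: degree_mult_eq del: mult_pCons_left)
    then have "poly_int (?W * (R * S)) = 0" by (rule R)
    moreover have "?W * (R * S) = smult (-1) ((?W * [:1,-1:]) * (S * S))"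
      unfolding S by (simp add: algebra_simps)
    ultimately have "poly_int ((?W * [:1,-1:]) * (S * S)) = 0"
      by (simp only: poly_int_smult)
    moreover have "0 < poly_int ((?W * [:1,-1:]) * (S * S))"
    proof (rule poly_int_square_pos[OF _ _ S0])
      have "poly (?W * [:1,-1:]) 0 \<noteq> poly 0 0" by simp
      then show "?W * [:1,-1:] \<noteq> 0" by metis
      fix x :: real assume "-1 \<le> x" "x \<le> 1"
      then have "0 \<le> (1 + x)^2 * (1 - x)" by simp
      then show "0 \<le> poly (?W * [:1,-1:]) x" by (simp add: algebra_simps)
    qed
    ultimately show False by simp
  qed
  then have "degree (smult (1 / poly R 1) R) = n \<and>
     (\<forall>Q. degree Q < n \<longrightarrow> poly_int (?W * (smult (1 / poly R 1) R * Q)) = 0) \<and>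
     poly (smult (1 / poly R 1) R) 1 = 1"
    using R by (auto simp: poly_int_smult)
  then show ?thesis by blast
qed

text \<open>
  With the leading coefficients matched, the difference has lower degree and is orthogonal to itself.
\<close>

lemma jacobi_02_unique:
  assumes P: "degree P = n" "\<And>S. degree S < n \<Longrightarrow> poly_int ([:1,1:]^2 * (P * S)) = 0" "poly P 1 = 1"
    and Q: "degree Q = n" "\<And>S. degree S < n \<Longrightarrow> poly_int ([:1,1:]^2 * (Q * S)) = 0" "poly Q 1 = 1"
  shows "P = Q"
proof -
  let ?W = "[:1,1:]^2 :: real poly"
  have Q0: "Q \<noteq> 0" using Q(3) by auto
  define c where "c = lead_coeff P / lead_coeff Q"
  define D where "D = P - smult c Q"
  have "D = 0"
  proof (rule ccontr)
    assume D0: "D \<noteq> 0"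
    have le: "degree D \<le> n" unfolding D_def
      using P Q by (intro degree_diff_le) (auto intro: order.trans[OF degree_smult_le])
    have "coeff D n = 0" using Q0 P(1) Q(1) leading_coeff_0_iff[of Q] by (simp add: D_def c_def del: leading_coeff_0_iff)
    with D0 le have "degree D < n" by (metis le_neq_implies_less leading_coeff_0_iff)
    then have "poly_int (?W * (P * D)) = 0" "poly_int (?W * (Q * D)) = 0" using P Q by auto
    moreover have "?W * (D * D) = ?W * (P * D) - smult c (?W * (Q * D))"
    proof -
      have "?W * (D * D) = ?W * ((P - smult c Q) * D)" by (simp only: D_def)
      then show ?thesis by (simp add: left_diff_distrib right_diff_distrib)
    qed
    ultimately have "poly_int (?W * (D * D)) = 0"
      by (simp only: poly_int_diff poly_int_smult)
    moreover have "0 < poly_int (?W * (D * D))"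
      by (rule poly_int_square_pos) (use D0 in auto)
    ultimately show False by simp
  qed
  then have PQ: "P = smult c Q" by (simp add: D_def)
  then have "c = 1" using P(3) Q(3) by simp
  with PQ show ?thesis by simp
qed

lemma jacobi_poly_02:
  "degree (jacobi_poly 0 2 n) = n"
  "degree S < n \<Longrightarrow> poly_int ([:1,1:]^2 * (jacobi_poly 0 2 n * S)) = 0"
  "poly (jacobi_poly 0 2 n) 1 = 1"
proof -
  \<comment> \<open>The integrands differ at \<open>x = 1\<close> only, where the weight \<open>0 powr 0\<close> is \<open>0\<close>.\<close>
  have int: "integral {-1..1} (\<lambda>x. poly P x * poly q x * (1 - x) powr 0 * (1 + x) powr 2)
      = poly_int ([:1,1:]^2 * (P * q))" for P q :: "real poly"
    unfolding poly_int_def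
  proof (rule integral_spike[of "{1}"])
    fix x :: real assume "x \<in> {-1..1} - {1}"
    then show "poly ([:1,1:]^2 * (P * q)) x = poly P x * poly q x * (1 - x) powr 0 * (1 + x) powr 2"
      by (cases "x = -1") (auto simp: powr_numeral algebra_simps power2_eq_square)
  qed auto
  have val: "(\<Prod>i=1..n. 0 + real i) / fact n = 1"
    by (simp add: fact_prod)
  let ?J = "\<lambda>P. degree P = n \<and> (\<forall>q. degree q < n \<longrightarrow> poly_int ([:1,1:]^2 * (P * q)) = 0) \<and> poly P 1 = 1"
  have eq: "jacobi_poly 0 2 n = (THE P. ?J P)"
    unfolding jacobi_poly_def int val ..
  obtain R where R: "?J R" using jacobi_02_exists by blast
  have "?J (THE P. ?J P)"
    by (rule theI[of ?J, OF R]) (use R jacobi_02_unique in blast)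
  then show "degree (jacobi_poly 0 2 n) = n"
    "degree S < n \<Longrightarrow> poly_int ([:1,1:]^2 * (jacobi_poly 0 2 n * S)) = 0"
    "poly (jacobi_poly 0 2 n) 1 = 1"
    unfolding eq by auto
qed

text \<open>
  The odd part of an orthogonal polynomial is again orthogonal, since reflection preserves the
  interval; for odd \<open>p\<close> it keeps the leading term.
\<close>

lemma odd_legendre_exists:
  assumes "odd p"
  obtains L :: "real poly" where "degree L = p" "\<And>x. poly L (-x) = - poly L x"
    "\<And>Q. degree Q < p \<Longrightarrow> poly_int (L * Q) = 0"
proof -
  obtain R :: "real poly" where R: "R \<noteq> 0" "degree R = p" "\<And>Q. degree Q < p \<Longrightarrow> poly_int (R * Q) = 0"
    using orthogonal_poly_exists[of 1 p] by auto
  define m where "m = [:0,-1:: real:]"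
  define L where "L = R - R \<circ>\<^sub>p m"
  have m: "degree m = 1" "poly m x = - x" for x by (simp_all add: m_def)
  have refl: "poly_int (P \<circ>\<^sub>p m) = poly_int P" for P
  proof -
    have "poly (P \<circ>\<^sub>p m) = (\<lambda>x. poly P (-x))" by (auto simp: poly_pcompose m)
    then show ?thesis unfolding poly_int_def
      using Henstock_Kurzweil_Integration.integral_reflect_real[of 1 "-1" "poly P"] by simp
  qed
  have deg: "degree (P \<circ>\<^sub>p m) = degree P" for P
    by (simp add: degree_pcompose m)
  have "poly_int ((R \<circ>\<^sub>p m) * Q) = 0" if "degree Q < p" for Q
  proof -
    have "m \<circ>\<^sub>p m = [:0,1:]" by (simp add: m_def pcompose_pCons)
    then have "(R \<circ>\<^sub>p m) * Q = (R * (Q \<circ>\<^sub>p m)) \<circ>\<^sub>p m"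
      by (simp add: pcompose_mult pcompose_assoc[symmetric] pcompose_idR)
    then show ?thesis using R(3)[of "Q \<circ>\<^sub>p m"] that by (simp add: refl deg)
  qed
  then have "poly_int (L * Q) = 0" if "degree Q < p" for Q
    using that R(3) by (simp add: L_def poly_int_diff left_diff_distrib)
  moreover have "poly L (-x) = - poly L x" for x
    by (simp add: L_def poly_pcompose m)
  moreover have "degree L = p"
  proof -
    have "coeff (R \<circ>\<^sub>p m) p = lead_coeff (R \<circ>\<^sub>p m)" using R deg by simp
    also have "\<dots> = lead_coeff R * lead_coeff m ^ degree R"
      by (rule lead_coeff_comp) (simp add: m)
    also have "\<dots> = - lead_coeff R" using assms R by (simp add: m_def)
    finally have "coeff L p \<noteq> 0" using R by (auto simp: L_def)
    moreover have "degree L \<le> p" unfolding L_def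
      using R deg by (intro degree_diff_le) auto
    ultimately show ?thesis using le_antisym le_degree by blast
  qed
  ultimately show ?thesis using that by blast
qed

text \<open>
  Integration by parts of \<open>L' * L'\<close> leaves only the boundary terms, because \<open>L''\<close> is orthogonal
  to \<open>L\<close>.
\<close>

lemma odd_legendre_deriv:
  assumes p: "odd p" and L: "degree L = p" "\<And>x. poly L (-x) = - poly L x"
    "\<And>Q. degree Q < p \<Longrightarrow> poly_int (L * Q) = 0"
  shows "poly (pderiv L) (-1) = poly (pderiv L) 1" "poly (pderiv L) 1 \<noteq> 0"
proof -
  have "pderiv (L \<circ>\<^sub>p [:0,-1:]) = pderiv (- L)"
  proof -
    have "poly (L \<circ>\<^sub>p [:0,-1:]) = poly (- L)" using L(2) by (auto simp: poly_pcompose)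
    then show ?thesis using poly_eq_poly_eq_iff by metis
  qed
  then have "poly (pderiv L) (-x) = poly (pderiv L) x" for x
    by (auto simp: pderiv_pcompose pderiv_minus pderiv_pCons poly_pcompose dest: arg_cong[of _ _ "\<lambda>P. poly P x"])
  then show even: "poly (pderiv L) (-1) = poly (pderiv L) 1" by simp
  let ?D = "pderiv L"
  have D0: "?D \<noteq> 0" using L(1) odd_pos[OF p] by (auto simp: pderiv_eq_0_iff)
  have "((\<lambda>x. poly (pderiv (L * ?D)) x) has_integral poly (L * ?D) 1 - poly (L * ?D) (-1)) {-1..1}"
    by (rule fundamental_theorem_of_calculus, simp,
        simp only: has_real_derivative_iff_has_vector_derivative[symmetric],
        rule has_field_derivative_at_within[OF poly_DERIV])
  then have "poly_int (pderiv (L * ?D)) = 2 * poly L 1 * poly ?D 1"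
    using even L(2)[of 1] by (auto simp: poly_int_def dest!: integral_unique)
  moreover have "pderiv (L * ?D) = L * pderiv ?D + 1 * (?D * ?D)"
    by (simp add: pderiv_mult)
  moreover have "poly_int (L * pderiv ?D) = 0"
  proof (intro L(3))
    have "0 < p" using p by (rule odd_pos)
    moreover have "degree (pderiv ?D) \<le> p - 1 - 1" by (simp add: degree_pderiv L(1))
    ultimately show "degree (pderiv ?D) < p" by linarith
  qed
  moreover have "0 < poly_int (1 * (?D * ?D))"
    by (rule poly_int_square_pos) (use D0 in auto)
  ultimately show "poly ?D 1 \<noteq> 0" by (auto simp: poly_int_add)
qed

section \<open>Integration over triangles\<close>

text \<open>
  The determinant of the matrix with columns \<open>u\<close> and \<open>v\<close>.
\<close>

definition wedge :: "real^2 \<Rightarrow> real^2 \<Rightarrow> real" where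
  "wedge u v = u$1 * v$2 - u$2 * v$1"

definition tri_param :: "real^2 \<Rightarrow> real^2 \<Rightarrow> real^2 \<Rightarrow> real^2 \<Rightarrow> real^2" where
  "tri_param a b c x = a + (x$1) *\<^sub>R (b - a) + (x$2) *\<^sub>R (c - a)"

definition std_triangle :: "(real^2) set" where
  "std_triangle = {x. 0 \<le> x$1 \<and> 0 \<le> x$2 \<and> x$1 + x$2 \<le> 1}"

definition vec2 :: "real \<times> real \<Rightarrow> real^2" where
  "vec2 p = (\<chi> i. if i = 1 then fst p else snd p)"

lemma vec2_nth [simp]: "vec2 p $ 1 = fst p" "vec2 p $ 2 = snd p"
  by (simp_all add: vec2_def)

lemma continuous_on_vec2 [continuous_intros]: "continuous_on S f \<Longrightarrow> continuous_on S (\<lambda>x. vec2 (f x))"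
  unfolding vec2_def
proof (intro continuous_on_vec_lambda)
  fix i :: 2 assume "continuous_on S f"
  then show "continuous_on S (\<lambda>x. if i = 1 then fst (f x) else snd (f x))"
    by (cases "i = 1") (auto intro!: continuous_intros)
qed

lemma measurable_vec2 [measurable]: "vec2 \<in> borel_measurable borel"
  by (intro borel_measurable_continuous_onI continuous_on_vec2 continuous_on_id)

text \<open>
  Transports Fubini's theorem from the type of pairs to \<open>real^2\<close>.
\<close>

lemma lborel_vec2: "lborel = distr lborel borel vec2"
proof (rule lborel_eqI)
  fix l u :: "real^2"
  assume le: "\<And>b. b \<in> Basis \<Longrightarrow> l \<bullet> b \<le> u \<bullet> b"
  have B: "(Basis :: (real^2) set) = {axis 1 1, axis 2 1}"
    by (auto simp: Basis_vec_def UNIV_2)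
  have le': "l$1 \<le> u$1" "l$2 \<le> u$2"
    using le[of "axis 1 1"] le[of "axis 2 1"] by (auto simp: B cart_eq_inner_axis)
  have "vec2 -` box l u = box (l$1, l$2) (u$1, u$2)"
    by (auto simp: mem_box_cart forall_2 mem_box Basis_prod_def)
  then have "emeasure (distr lborel borel vec2) (box l u) = emeasure lborel (box (l$1, l$2) (u$1, u$2))"
    by (subst emeasure_distr) auto
  also have "\<dots> = ennreal ((u$1 - l$1) * (u$2 - l$2))"
    using le' by (subst emeasure_lborel_box) (auto simp: Basis_prod_def)
  also have "(u$1 - l$1) * (u$2 - l$2) = (\<Prod>b\<in>Basis. (u - l) \<bullet> b)"
    by (simp add: B axis_eq_axis cart_eq_inner_axis[symmetric] inner_axis)
  finally show "emeasure (distr lborel borel vec2) (box l u) = (\<Prod>b\<in>Basis. (u - l) \<bullet> b)" .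
qed simp

lemma compact_std_triangle: "compact std_triangle"
proof (rule compact_eq_bounded_closed[THEN iffD2, OF conjI])
  have "std_triangle \<subseteq> cbox 0 1"
    by (auto simp: std_triangle_def mem_box_cart forall_2)
  then show "bounded std_triangle" using bounded_cbox bounded_subset by blast
  show "closed std_triangle"
    unfolding std_triangle_def
    by (intro closed_Collect_conj closed_Collect_le continuous_intros)
qed

lemma set_integrable_compact_continuous:
  fixes f :: "'a::euclidean_space \<Rightarrow> 'b::{banach, second_countable_topology}"
  assumes "compact S" "continuous_on S f"
  shows "set_integrable lborel S f"
  using borel_integrable_compact[OF assms] by (simp add: set_integrable_def)

lemma integral_std_triangle:
  fixes f :: "real^2 \<Rightarrow> real"
  assumes f: "continuous_on UNIV f"
  shows "integral std_triangle f = integral {0..1} (\<lambda>u. integral {0..1 - u} (\<lambda>v. f (vec2 (u, v))))"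
proof -
  let ?F = "\<lambda>x. indicator std_triangle x * f x"
  let ?I = "\<lambda>u. integral {0..1 - u} (\<lambda>v. f (vec2 (u, v)))"
  have int: "set_integrable lborel std_triangle f"
    by (intro set_integrable_compact_continuous compact_std_triangle continuous_on_subset[OF f]) auto
  then have F: "integrable lborel ?F" by (simp add: set_integrable_def)
  have [measurable]: "?F \<in> borel_measurable borel"
    using borel_measurable_integrable[OF F] by simp
  have F2: "integrable (lborel \<Otimes>\<^sub>M lborel) (\<lambda>p. ?F (vec2 p))"
  proof -
    have "integrable (distr lborel borel vec2) ?F" using F lborel_vec2 by simp
    then have "integrable lborel (\<lambda>p. ?F (vec2 p))" by (subst (asm) integrable_distr_eq) auto
    then show ?thesis by (simp add: lborel_prod)
  qed
  have inner: "(\<integral>v. ?F (vec2 (u, v)) \<partial>lborel) = indicator {0..1} u * ?I u" for u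
  proof -
    have "(\<lambda>v. ?F (vec2 (u, v))) = (\<lambda>v. indicator {0..1} u * (indicator {0..1 - u} v * f (vec2 (u, v))))"
      unfolding fun_eq_iff by (auto simp: indicator_def std_triangle_def)
    then have "(\<integral>v. ?F (vec2 (u, v)) \<partial>lborel) = indicator {0..1} u * (LINT v:{0..1 - u}|lborel. f (vec2 (u, v)))"
      by (simp add: set_lebesgue_integral_def)
    also have "(LINT v:{0..1 - u}|lborel. f (vec2 (u, v))) = ?I u"
      by (intro set_borel_integral_eq_integral set_integrable_compact_continuous)
         (auto intro!: continuous_intros continuous_on_compose2[OF f])
    finally show ?thesis by simp
  qed
  have outer: "set_integrable lborel {0..1} ?I"
    using lborel_pair.integrable_fst'[OF F2] by (simp add: inner set_integrable_def)
  have "integral std_triangle f = (LINT x|lborel. ?F x)"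
    using set_borel_integral_eq_integral(2)[OF int] by (simp add: set_lebesgue_integral_def)
  also have "\<dots> = (LINT x|distr lborel borel vec2. ?F x)"
    by (simp only: lborel_vec2[symmetric])
  also have "\<dots> = (LINT p|lborel. ?F (vec2 p))"
    by (subst integral_distr) auto
  also have "\<dots> = (LINT p|(lborel \<Otimes>\<^sub>M lborel). ?F (vec2 p))"
    by (simp add: lborel_prod)
  also have "\<dots> = (LINT u|lborel. LINT v|lborel. ?F (vec2 (u, v)))"
    using lborel_pair.integral_fst'[OF F2] by simp
  also have "\<dots> = (LINT u:{0..1}|lborel. ?I u)"
    by (simp add: inner set_lebesgue_integral_def)
  also have "\<dots> = integral {0..1} ?I"
    by (rule set_borel_integral_eq_integral[OF outer])
  finally show ?thesis .
qed

lemma tri_param_image: "tri_param a b c ` std_triangle = convex hull {a, b, c}"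
proof -
  have "\<exists>x\<in>std_triangle. y = tri_param a b c x"
    if "y = a + u *\<^sub>R (b - a) + v *\<^sub>R (c - a)" "0 \<le> u" "0 \<le> v" "u + v \<le> 1" for y u v
    using that by (intro bexI[of _ "vec2 (u, v)"]) (auto simp: tri_param_def std_triangle_def)
  then show ?thesis
    unfolding convex_hull_3_alt
    by (auto simp: image_iff) (auto simp: tri_param_def std_triangle_def)
qed

lemma det_matrix_tri:
  "det (matrix (\<lambda>d::real^2. (d$1) *\<^sub>R u + (d$2) *\<^sub>R v)) = wedge u v"
  by (simp add: det_2 matrix_def wedge_def axis_def algebra_simps)

lemma integral_triangle:
  fixes f :: "real^2 \<Rightarrow> real"
  assumes f: "continuous_on UNIV f" and abc: "wedge (b - a) (c - a) \<noteq> 0"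
  shows "integral (convex hull {a, b, c}) f = \<bar>wedge (b - a) (c - a)\<bar> *
    integral {0..1} (\<lambda>u. integral {0..1 - u} (\<lambda>v. f (a + u *\<^sub>R (b - a) + v *\<^sub>R (c - a))))"
proof -
  let ?g = "tri_param a b c"
  let ?g' = "\<lambda>d::real^2. (d$1) *\<^sub>R (b - a) + (d$2) *\<^sub>R (c - a)"
  let ?w = "wedge (b - a) (c - a)"
  \<comment> \<open>The substitution rule applies to functions with values in \<open>real^1\<close>.\<close>
  define F where "F x = (vec (f x) :: real^1)" for x
  have cg: "continuous_on UNIV ?g" unfolding tri_param_def by (intro continuous_intros)
  have cF: "continuous_on S F" for S unfolding F_def vec_def
    by (intro continuous_on_vec_lambda continuous_on_subset[OF f]) auto
  have "(?g has_derivative ?g') (at x within S)" for x S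
    unfolding tri_param_def
    by (auto intro!: derivative_eq_intros bounded_linear.has_derivative[OF bounded_linear_vec_nth])
  moreover have "inj_on ?g std_triangle"
  proof (rule inj_onI)
    fix x y assume "?g x = ?g y"
    then have e: "(x$1 - y$1) * (b - a)$i + (x$2 - y$2) * (c - a)$i = 0" for i
      by (auto simp: tri_param_def vec_eq_iff algebra_simps)
    have "(x$1 - y$1) * ?w = 0" "(x$2 - y$2) * ?w = 0"
      using e[of 1] e[of 2] unfolding wedge_def by algebra+
    then show "x = y" using abc by (simp add: vec_eq_iff forall_2)
  qed
  moreover have "std_triangle \<in> sets lebesgue"
    using compact_std_triangle by (intro lmeasurable_compact[THEN fmeasurableD])
  moreover have FK: "F absolutely_integrable_on (?g ` std_triangle)"
  proof -
    have "compact (?g ` std_triangle)"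
      by (intro compact_continuous_image compact_std_triangle continuous_on_subset[OF cg]) auto
    then have "set_integrable lborel (?g ` std_triangle) F"
      by (rule set_integrable_compact_continuous) (rule cF)
    then show ?thesis unfolding set_integrable_def by (intro integrable_completion[THEN iffD2]) auto
  qed
  ultimately have "integral (?g ` std_triangle) F = integral std_triangle (\<lambda>x. \<bar>det (matrix ?g')\<bar> *\<^sub>R F (?g x))"
    by (intro integral_change_of_variables) auto
  also have "\<dots> = \<bar>?w\<bar> *\<^sub>R integral std_triangle (\<lambda>x. F (?g x))"
    by (simp add: det_matrix_tri)
  finally have eq: "integral (?g ` std_triangle) F = \<bar>?w\<bar> *\<^sub>R integral std_triangle (\<lambda>x. F (?g x))" .
  have comp: "integral S (\<lambda>x. F (h x)) $ 1 = integral S (\<lambda>x. f (h x))" if "(\<lambda>x. F (h x)) integrable_on S" for S and h :: "real^2 \<Rightarrow> real^2"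
    using that by (subst integral_component_eq_cart[symmetric]) (auto simp: F_def)
  have "F integrable_on (?g ` std_triangle)"
    using FK absolutely_integrable_on_def by blast
  moreover have "(\<lambda>x. F (?g x)) integrable_on std_triangle"
    by (intro set_borel_integral_eq_integral set_integrable_compact_continuous compact_std_triangle
        continuous_on_compose2[OF cF continuous_on_subset[OF cg]]) auto
  ultimately have "integral (?g ` std_triangle) f = \<bar>?w\<bar> * integral std_triangle (\<lambda>x. f (?g x))"
    using arg_cong[OF eq, of "\<lambda>v. v $ 1"] comp[of "\<lambda>x. x"] comp[of ?g] by simp
  also have "integral std_triangle (\<lambda>x. f (?g x)) = 
      integral {0..1} (\<lambda>u. integral {0..1 - u} (\<lambda>v. f (?g (vec2 (u, v)))))"
    by (rule integral_std_triangle) (rule continuous_on_compose2[OF f cg], simp)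
  finally show ?thesis unfolding tri_param_image by (simp add: tri_param_def)
qed

lemma measure_triangle:
  "measure lebesgue (convex hull {a, b, c}) = \<bar>wedge (b - a) (c - a)\<bar> / 2"
proof -
  have "measure lebesgue (convex hull {a, b, c}) = measure lborel (convex hull {a, b, c})"
    by (rule measure_completion)
       (simp add: borel_closed compact_imp_closed finite_imp_compact_convex_hull)
  then show ?thesis
    unfolding content_triangle wedge_def by (simp add: abs_minus_commute algebra_simps)
qed

subsection \<open>The reproducing property\<close>

lemma integral_poly_01: "integral {0..1} (\<lambda>t. poly P (1 - 2 * t)) = poly_int P / 2"
proof -
  have "(poly P has_integral poly_int P) (cbox (-1) 1)"
    unfolding poly_int_def using poly_integrable[of P "-1" 1] by (simp add: has_integral_integral)
  from has_integral_affinity[OF this, of "-2" 1]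
  have "((\<lambda>t. poly P (1 - 2 * t)) has_integral poly_int P / 2) ((\<lambda>x. (1 - x) / 2) ` {-1..1})"
    by (simp add: algebra_simps diff_divide_distrib)
  also have "(\<lambda>x. (1 - x) / 2) ` {-1..1} = {0..1::real}"
    using image_affinity_atLeastAtMost[of "-1/2" "1/2" "-1" "1::real"]
    by (simp add: diff_divide_distrib)
  finally show ?thesis by (rule integral_unique)
qed

text \<open>
  \<open>H\<close> differs from its value at \<open>-1\<close> by a multiple of \<open>1 + x\<close>, and this additional factor completes
  the weight for which the Jacobi polynomial is orthogonal.
\<close>

lemma poly_int_jacobi_02:
  assumes H: "degree H \<le> n"
  shows "poly_int ([:1,1:] * (jacobi_poly 0 2 n * H)) = poly_int ([:1,1:] * jacobi_poly 0 2 n) * poly H (-1)"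
proof -
  let ?J = "jacobi_poly 0 2 n"
  have "poly (H - [:poly H (-1):]) (-1) = 0" by simp
  then obtain S where "H - [:poly H (-1):] = [:1,1:] * S"
    unfolding poly_eq_0_iff_dvd by (auto elim: dvdE)
  then have HS: "H = [:1,1:] * S + [:poly H (-1):]" by (metis diff_eq_eq)
  have "poly_int ([:1,1:]^2 * (?J * S)) = 0"
  proof (cases "S = 0")
    case False
    have "degree ([:1,1:] * S) = Suc (degree S)" using False by (subst degree_mult_eq) auto
    moreover have "degree ([:1,1:] * S) \<le> n"
      using H \<open>H - _ = _\<close> by (metis degree_diff_le degree_pCons_0 zero_le)
    ultimately show ?thesis by (intro jacobi_poly_02) simp
  qed (simp add: poly_int_0)
  moreover have "[:1,1:] * (?J * H) = [:1,1:]^2 * (?J * S) + smult (poly H (-1)) ([:1,1:] * ?J)"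
  proof -
    have "[:1,1:] * (?J * H) = [:1,1:] * (?J * ([:1,1:] * S + [:poly H (-1):]))" using HS by simp
    also have "\<dots> = [:1,1:]^2 * (?J * S) + [:poly H (-1):] * ([:1,1:] * ?J)"
      by (simp only: power2_eq_square algebra_simps)
    finally show ?thesis by simp
  qed
  ultimately show ?thesis by (simp only: poly_int_add poly_int_smult mult.commute add_0_left)
qed

text \<open>
  Otherwise the Jacobi polynomial could be inserted for \<open>H\<close> in \<open>poly_int_jacobi_02\<close> and its weighted square
  would integrate to zero.
\<close>

lemma poly_int_jacobi_02_nonzero: "poly_int ([:1,1:] * jacobi_poly 0 2 n) \<noteq> 0"
proof
  let ?J = "jacobi_poly 0 2 n"
  assume 0: "poly_int ([:1,1:] * ?J) = 0"
  have "?J \<noteq> 0" using jacobi_poly_02(3)[of n] by auto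
  then have "0 < poly_int ([:1,1:] * (?J * ?J))"
    by (intro poly_int_square_pos) auto
  then show False using poly_int_jacobi_02[of ?J n] jacobi_poly_02(1)[of n] 0 by simp
qed

text \<open>
  Slices parallel to the edge \<open>[a, c]\<close>. Integrating \<open>u ^ i * v ^ j\<close> over the slice at \<open>u\<close> gives
  \<open>u ^ i * (1 - u) ^ (j + 1) / (j + 1)\<close>; the common factor \<open>1 - u\<close> is the length of the slice.
\<close>

lemma polys_slice_integral:
  assumes "f \<in> polys k"
  obtains H where "degree H \<le> k" "poly H 1 = f b"
    "\<And>u. 0 \<le> u \<Longrightarrow> u \<le> 1 \<Longrightarrow>
       integral {0..1 - u} (\<lambda>v. f (a + u *\<^sub>R (b - a) + v *\<^sub>R (c - a))) = (1 - u) * poly H u"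
proof -
  obtain C where "\<And>x::real^2. f (a + x$1 *\<^sub>R (b - a) + x$2 *\<^sub>R (c - a)) = (\<Sum>i\<le>k. \<Sum>j\<le>k - i. C i j * (x$1)^i * (x$2)^j)"
    using polys_compose_affine[OF assms, of a "b - a" "c - a"] unfolding polys_def by blast
  from this[of "vec2 (u, v)" for u v]
  have C: "f (a + u *\<^sub>R (b - a) + v *\<^sub>R (c - a)) = (\<Sum>i\<le>k. \<Sum>j\<le>k - i. C i j * u^i * v^j)" for u v by simp
  define H where "H = (\<Sum>i\<le>k. \<Sum>j\<le>k - i. smult (C i j / real (Suc j)) ([:0,1:]^i * [:1,-1:]^j))"
  have "degree H \<le> k"
    unfolding H_def
  proof (intro degree_sum_le finite_atMost)
    fix i j assume "i \<in> {..k}" "j \<in> {..k - i}"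
    have "degree ([:0,1:]^i * [:1,-1:]^j :: real poly) \<le> degree ([:0,1:]^i :: real poly) + degree ([:1,-1:]^j :: real poly)"
      by (rule degree_mult_le)
    also have "\<dots> \<le> 1 * i + 1 * j"
      using degree_power_le[of "[:0,1:] :: real poly" i] degree_power_le[of "[:1,-1:] :: real poly" j] by simp
    also have "\<dots> \<le> k" using \<open>i \<in> {..k}\<close> \<open>j \<in> {..k - i}\<close> by auto
    finally show "degree (smult (C i j / real (Suc j)) ([:0,1:]^i * [:1,-1:]^j)) \<le> k"
      by (intro order.trans[OF degree_smult_le])
  qed
  moreover have "poly H 1 = f b"
  proof -
    have "poly H 1 = (\<Sum>i\<le>k. \<Sum>j\<le>k - i. C i j / real (Suc j) * 0^j)"
      by (simp add: H_def poly_sum)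
    also have "\<dots> = (\<Sum>i\<le>k. \<Sum>j\<le>k - i. C i j * 1^i * 0^j)"
      by (intro sum.cong refl) (auto simp: power_0_left)
    also have "\<dots> = f b" using C[of 1 0] by simp
    finally show ?thesis .
  qed
  moreover have "integral {0..1 - u} (\<lambda>v. f (a + u *\<^sub>R (b - a) + v *\<^sub>R (c - a))) = (1 - u) * poly H u"
    if "0 \<le> u" "u \<le> 1" for u
  proof -
    have pow: "((\<lambda>v. v^j) has_integral (1 - u)^Suc j / real (Suc j)) {0..1 - u}" for j
    proof -
      have "((\<lambda>v. v^j) has_integral (1 - u)^Suc j / real (Suc j) - 0^Suc j / real (Suc j)) {0..1 - u}"
      proof (rule fundamental_theorem_of_calculus)
        show "((\<lambda>v. v^Suc j / real (Suc j)) has_vector_derivative v^j) (at v within {0..1 - u})" for v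
          unfolding has_real_derivative_iff_has_vector_derivative[symmetric]
          by (rule DERIV_cong[OF DERIV_cdivide[OF DERIV_pow]]) (simp del: of_nat_Suc)
      qed (use that in simp)
      then show ?thesis by simp
    qed
    have "((\<lambda>v. \<Sum>i\<le>k. \<Sum>j\<le>k - i. C i j * u^i * v^j) has_integral
        (\<Sum>i\<le>k. \<Sum>j\<le>k - i. C i j * u^i * ((1 - u)^Suc j / real (Suc j)))) {0..1 - u}"
      by (intro has_integral_sum has_integral_mult_right pow) auto
    moreover have "(\<Sum>i\<le>k. \<Sum>j\<le>k - i. C i j * u^i * ((1 - u)^Suc j / real (Suc j))) = (1 - u) * poly H u"
      by (simp add: H_def poly_sum sum_distrib_left mult_ac)
    ultimately show ?thesis by (simp add: C integral_unique)
  qed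
  ultimately show ?thesis using that by blast
qed

lemma polys_on_line:
  assumes "f \<in> polys k"
  obtains H where "degree H \<le> k" "\<And>t. f (linepath a b t) = poly H t"
proof -
  obtain C where "\<And>x::real^2. f (a + x$1 *\<^sub>R (b - a) + x$2 *\<^sub>R 0) = (\<Sum>i\<le>k. \<Sum>j\<le>k - i. C i j * (x$1)^i * (x$2)^j)"
    using polys_compose_affine[OF assms, of a "b - a" 0] unfolding polys_def by blast
  from this[of "vec2 (t, 0)" for t]
  have C: "f (a + t *\<^sub>R (b - a)) = (\<Sum>i\<le>k. \<Sum>j\<le>k - i. C i j * t^i * 0^j)" for t by simp
  define H where "H = (\<Sum>i\<le>k. \<Sum>j\<le>k - i. smult (C i j * 0^j) ([:0,1:]^i))"
  have "degree H \<le> k"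
    unfolding H_def
  proof (intro degree_sum_le finite_atMost)
    fix i j assume "i \<in> {..k}"
    then have "degree ([:0,1:]^i :: real poly) \<le> k"
      using degree_power_le[of "[:0,1:] :: real poly" i] by simp
    then show "degree (smult (C i j * 0^j) ([:0,1:]^i)) \<le> k"
      by (intro order.trans[OF degree_smult_le])
  qed
  moreover have "linepath a b t = a + t *\<^sub>R (b - a)" for t
    by (simp add: linepath_def algebra_simps)
  then have "f (linepath a b t) = poly H t" for t
    by (simp add: C H_def poly_sum mult_ac)
  ultimately show ?thesis using that by blast
qed

text \<open>
  The barycentric coordinate for \<open>a\<close> in the triangle \<open>abc\<close>, as a quotient of signed areas.
\<close>

definition bary :: "real^2 \<Rightarrow> real^2 \<Rightarrow> real^2 \<Rightarrow> real^2 \<Rightarrow> real" where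
  "bary a b c x = wedge (x - b) (c - b) / wedge (a - b) (c - b)"

lemma bary_polys: "bary a b c \<in> polys 1"
proof -
  have "bary a b c = (\<lambda>x. (c - b)$2 / wedge (a - b) (c - b) * x$1 + (- (c - b)$1 / wedge (a - b) (c - b)) * x$2
      + (b$2 * (c - b)$1 - b$1 * (c - b)$2) / wedge (a - b) (c - b))"
    unfolding bary_def wedge_def by (rule ext) (simp add: divide_simps, simp add: algebra_simps)
  then show ?thesis by (simp only: polys_affine)
qed

text \<open>
  The slices shrink to the point \<open>b\<close>, so the one-dimensional polynomial that remains after slicing has
  the value \<open>f b\<close> at that end, where the weight \<open>1 + x\<close> vanishes.
\<close>

lemma reproducing_property:
  assumes abc: "wedge (b - a) (c - a) \<noteq> 0" and f: "f \<in> polys n"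
  shows "integral (convex hull {a, b, c}) (\<lambda>x. poly (jacobi_poly 0 2 n) (1 - 2 * bary b a c x) * f x)
    = poly_int ([:1,1:] * jacobi_poly 0 2 n) / 4 * \<bar>wedge (b - a) (c - a)\<bar> * f b"
proof -
  let ?J = "jacobi_poly 0 2 n"
  obtain H where H: "degree H \<le> n" "poly H 1 = f b"
    "\<And>u. 0 \<le> u \<Longrightarrow> u \<le> 1 \<Longrightarrow>
       integral {0..1 - u} (\<lambda>v. f (a + u *\<^sub>R (b - a) + v *\<^sub>R (c - a))) = (1 - u) * poly H u"
    using polys_slice_integral[OF f] by blast
  define H' where "H' = H \<circ>\<^sub>p [:1/2,-1/2:]"
  have H': "degree H' \<le> n" "poly H' (1 - 2 * u) = poly H u" for u
    using H(1) by (simp_all add: H'_def degree_pcompose poly_pcompose diff_divide_distrib)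
  have bary: "bary b a c (a + u *\<^sub>R (b - a) + v *\<^sub>R (c - a)) = u" for u v
    using abc by (simp add: bary_def wedge_def field_simps)
  have "continuous_on UNIV (\<lambda>x. poly ?J (1 - 2 * bary b a c x) * f x)"
    by (intro continuous_intros continuous_on_polys[OF f] continuous_on_polys[OF bary_polys])
  then have "integral (convex hull {a, b, c}) (\<lambda>x. poly ?J (1 - 2 * bary b a c x) * f x)
    = \<bar>wedge (b - a) (c - a)\<bar> * integral {0..1} (\<lambda>u. integral {0..1 - u}
        (\<lambda>v. poly ?J (1 - 2 * u) * f (a + u *\<^sub>R (b - a) + v *\<^sub>R (c - a))))"
    by (subst integral_triangle[OF _ abc]) (simp_all only: bary)
  also have "integral {0..1} (\<lambda>u. integral {0..1 - u}
        (\<lambda>v. poly ?J (1 - 2 * u) * f (a + u *\<^sub>R (b - a) + v *\<^sub>R (c - a))))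
     = integral {0..1} (\<lambda>u. poly ([:1/2,1/2:] * (?J * H')) (1 - 2 * u))"
  proof (intro Henstock_Kurzweil_Integration.integral_cong)
    fix u :: real assume "u \<in> {0..1}"
    have "poly [:1/2,1/2:] (1 - 2 * u) = 1 - u" by (simp add: field_simps)
    then show "integral {0..1 - u} (\<lambda>v. poly ?J (1 - 2 * u) * f (a + u *\<^sub>R (b - a) + v *\<^sub>R (c - a)))
      = poly ([:1/2,1/2:] * (?J * H')) (1 - 2 * u)"
      using \<open>u \<in> {0..1}\<close> by (simp only: integral_mult_right H(3) H'(2) poly_mult) (simp add: H(3))
  qed
  also have "\<dots> = poly_int ([:1/2,1/2:] * (?J * H')) / 2"
    by (rule integral_poly_01)
  also have "[:1/2,1/2:] * (?J * H') = smult (1/2) ([:1,1:] * (?J * H'))"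
    by (simp add: smult_add_right)
  also have "poly_int \<dots> = 1/2 * (poly_int ([:1,1:] * ?J) * poly H' (-1))"
    by (simp only: poly_int_smult poly_int_jacobi_02[OF H'(1)])
  also have "poly H' (-1) = f b" using H'(2)[of 1] H(2) by simp
  finally show ?thesis by simp
qed

subsection \<open>The divergence theorem on a triangle\<close>

definition edge_mean :: "real^2 \<Rightarrow> real^2 \<Rightarrow> (real^2 \<Rightarrow> real) \<Rightarrow> real" where
  "edge_mean a b f = integral {0..1} (\<lambda>t. f (linepath a b t))"

lemma edge_mean_commute:
  assumes "continuous_on UNIV f"
  shows "edge_mean a b f = edge_mean b a f"
proof -
  have "((\<lambda>t. f (linepath a b t)) has_integral edge_mean a b f) (cbox 0 1)"
    unfolding edge_mean_def box_real
    by (intro integrable_integral integrable_continuous_real continuous_on_compose2[OF assms]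
        continuous_on_linepath) auto
  from has_integral_affinity[OF this, of "-1" 1]
  have "((\<lambda>t. f (linepath a b (1 - t))) has_integral edge_mean a b f) ((\<lambda>x. 1 - x) ` {0..1})"
    by simp
  moreover have "(\<lambda>x. 1 - x) ` {0..1} = {0..1::real}"
    by simp
  ultimately have "((\<lambda>t. f (linepath b a t)) has_integral edge_mean a b f) {0..1}"
    by (simp add: linepath_def add.commute)
  then show ?thesis
    by (simp add: edge_mean_def integral_unique)
qed

text \<open>
  The derivative in the direction of the edge \<open>[a, c]\<close> integrates along each slice to a difference of
  values on the other two edges.
\<close>

lemma integral_deriv_edge:
  assumes abc: "wedge (b - a) (c - a) \<noteq> 0"
    and f: "\<And>x. (f has_derivative (\<lambda>d. g1 x * d$1 + g2 x * d$2)) (at x)"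
    and g: "continuous_on UNIV g1" "continuous_on UNIV g2"
  shows "integral (convex hull {a, b, c}) (\<lambda>x. g1 x * (c - a)$1 + g2 x * (c - a)$2)
    = \<bar>wedge (b - a) (c - a)\<bar> * (edge_mean b c f - edge_mean a b f)"
proof -
  let ?d = "c - a"
  have cf: "continuous_on S f" for S
    using f by (meson continuous_at_imp_continuous_on has_derivative_continuous)
  have "integral (convex hull {a, b, c}) (\<lambda>x. g1 x * ?d$1 + g2 x * ?d$2) = \<bar>wedge (b - a) ?d\<bar> *
    integral {0..1} (\<lambda>u. integral {0..1 - u} (\<lambda>v.
      g1 (a + u *\<^sub>R (b - a) + v *\<^sub>R ?d) * ?d$1 + g2 (a + u *\<^sub>R (b - a) + v *\<^sub>R ?d) * ?d$2))"
    by (intro integral_triangle abc continuous_intros g)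
  also have "integral {0..1} (\<lambda>u. integral {0..1 - u} (\<lambda>v.
      g1 (a + u *\<^sub>R (b - a) + v *\<^sub>R ?d) * ?d$1 + g2 (a + u *\<^sub>R (b - a) + v *\<^sub>R ?d) * ?d$2))
    = integral {0..1} (\<lambda>u. f (linepath c b u) - f (linepath a b u))"
  proof (intro Henstock_Kurzweil_Integration.integral_cong)
    fix u :: real assume "u \<in> {0..1}"
    have "((\<lambda>v. f (a + u *\<^sub>R (b - a) + v *\<^sub>R ?d)) has_vector_derivative
        g1 (a + u *\<^sub>R (b - a) + v *\<^sub>R ?d) * ?d$1 + g2 (a + u *\<^sub>R (b - a) + v *\<^sub>R ?d) * ?d$2) (at v within S)" for v S
      unfolding has_vector_derivative_def
      by (rule has_derivative_eq_rhs[OF has_derivative_compose[OF _ f]])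
         (auto intro!: derivative_eq_intros simp: algebra_simps)
    then have "((\<lambda>v. g1 (a + u *\<^sub>R (b - a) + v *\<^sub>R ?d) * ?d$1 + g2 (a + u *\<^sub>R (b - a) + v *\<^sub>R ?d) * ?d$2)
      has_integral f (a + u *\<^sub>R (b - a) + (1 - u) *\<^sub>R ?d) - f (a + u *\<^sub>R (b - a) + 0 *\<^sub>R ?d)) {0..1 - u}"
      using \<open>u \<in> {0..1}\<close> by (intro fundamental_theorem_of_calculus) auto
    then show "integral {0..1 - u} (\<lambda>v. g1 (a + u *\<^sub>R (b - a) + v *\<^sub>R ?d) * ?d$1 + g2 (a + u *\<^sub>R (b - a) + v *\<^sub>R ?d) * ?d$2)
      = f (linepath c b u) - f (linepath a b u)"
      by (auto dest!: integral_unique simp: linepath_def algebra_simps)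
  qed
  also have "\<dots> = edge_mean c b f - edge_mean a b f"
    unfolding edge_mean_def
    by (intro Henstock_Kurzweil_Integration.integral_diff integrable_continuous_real continuous_on_compose2[OF cf]
        continuous_on_linepath) auto
  finally show ?thesis by (simp add: edge_mean_commute[OF cf, of c b])
qed

text \<open>
  The divergence theorem, in the case where the edge opposite to \<open>a\<close> does not contribute. The direction
  \<open>d\<close> is decomposed along the two edges at \<open>a\<close>; the factors \<open>sgn (wedge \<dots>) * wedge \<dots> d\<close> are the
  components of \<open>d\<close> along the inner normals, multiplied with the edge lengths.
\<close>

lemma integral_deriv:
  assumes abc: "wedge (b - a) (c - a) \<noteq> 0"
    and f: "\<And>x. (f has_derivative (\<lambda>d. g1 x * d$1 + g2 x * d$2)) (at x)"
    and g: "continuous_on UNIV g1" "continuous_on UNIV g2"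
    and bc: "edge_mean b c f = 0"
  shows "integral (convex hull {a, b, c}) (\<lambda>x. g1 x * d$1 + g2 x * d$2)
    = - sgn (wedge (b - a) (c - a)) * wedge (b - a) d * edge_mean a b f
      - sgn (wedge (c - a) (b - a)) * wedge (c - a) d * edge_mean a c f"
proof -
  let ?w = "wedge (b - a) (c - a)" and ?K = "convex hull {a, b, c}"
  let ?D = "\<lambda>e x. g1 x * e$1 + g2 x * e$2"
  have int: "?D e integrable_on ?K" for e
    by (intro set_borel_integral_eq_integral set_integrable_compact_continuous continuous_intros
        continuous_on_subset[OF g(1)] continuous_on_subset[OF g(2)] finite_imp_compact_convex_hull) auto
  have w': "wedge (c - a) (b - a) = - ?w" by (simp add: wedge_def)
  have d: "?D d x = wedge d (c - a) / ?w * ?D (b - a) x + wedge (b - a) d / ?w * ?D (c - a) x" for x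
  proof -
    have "?w * ?D d x = wedge d (c - a) * ?D (b - a) x + wedge (b - a) d * ?D (c - a) x"
      unfolding wedge_def by algebra
    then have "?w * ?D d x / ?w = (wedge d (c - a) * ?D (b - a) x + wedge (b - a) d * ?D (c - a) x) / ?w"
      by simp
    then show ?thesis using abc by (simp add: add_divide_distrib)
  qed
  have cf: "continuous_on UNIV f"
    using f by (meson continuous_at_imp_continuous_on has_derivative_continuous)
  have "integral ?K (?D d) = integral ?K (\<lambda>x. wedge d (c - a) / ?w * ?D (b - a) x) + integral ?K (\<lambda>x. wedge (b - a) d / ?w * ?D (c - a) x)"
    unfolding d by (intro Henstock_Kurzweil_Integration.integral_add integrable_on_mult_right int)
  also have "\<dots> = wedge d (c - a) / ?w * integral ?K (?D (b - a)) + wedge (b - a) d / ?w * integral ?K (?D (c - a))"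
    by (simp only: integral_mult_right)
  also have "integral ?K (?D (c - a)) = - \<bar>?w\<bar> * edge_mean a b f"
    using integral_deriv_edge[OF abc f g] bc by simp
  also have "integral ?K (?D (b - a)) = - \<bar>?w\<bar> * edge_mean a c f"
  proof -
    have "wedge (c - a) (b - a) \<noteq> 0" using abc w' by simp
    from integral_deriv_edge[OF this f g] show ?thesis
      using bc w' edge_mean_commute[OF cf, of c b] by (simp add: insert_commute)
  qed
  finally have eq: "integral ?K (?D d) = wedge d (c - a) / ?w * (- \<bar>?w\<bar> * edge_mean a c f)
      + wedge (b - a) d / ?w * (- \<bar>?w\<bar> * edge_mean a b f)" .
  have sgn: "X / ?w * (- \<bar>?w\<bar> * M) = - sgn ?w * X * M" for X M
    using abc by (simp add: sgn_real_def abs_real_def)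
  have "wedge d (c - a) = - wedge (c - a) d" by (simp add: wedge_def)
  then show ?thesis unfolding eq sgn w' by simp
qed

section \<open>Triangles\<close>

definition tri :: "(real^2) set \<Rightarrow> real^2 \<Rightarrow> real^2 \<Rightarrow> real^2 \<Rightarrow> bool" where
  "tri K a b c \<longleftrightarrow> K = convex hull {a, b, c} \<and> wedge (b - a) (c - a) \<noteq> 0"

lemma wedge_base_change: "wedge (a - b) (c - b) = - wedge (b - a) (c - a)"
  by (simp add: wedge_def algebra_simps)

lemma wedge_swap: "wedge v u = - wedge u v"
  by (simp add: wedge_def)

lemma wedge_self [simp]: "wedge u u = 0"
  by (simp add: wedge_def)

lemma wedge_eq_0_iff: "wedge u v = 0 \<longleftrightarrow> u = 0 \<or> v = 0 \<or> (\<exists>c. v = c *\<^sub>R u)"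
proof
  assume w: "wedge u v = 0"
  show "u = 0 \<or> v = 0 \<or> (\<exists>c. v = c *\<^sub>R u)"
  proof (cases "u = 0")
    case False
    then consider "u$1 \<noteq> 0" | "u$2 \<noteq> 0" by (auto simp: vec_eq_iff forall_2)
    then have "\<exists>c. v = c *\<^sub>R u"
    proof cases
      case 1
      with w show ?thesis
        by (intro exI[of _ "v$1 / u$1"]) (auto simp: vec_eq_iff forall_2 wedge_def field_simps)
    next
      case 2
      with w show ?thesis
        by (intro exI[of _ "v$2 / u$2"]) (auto simp: vec_eq_iff forall_2 wedge_def field_simps)
    qed
    then show ?thesis by blast
  qed simp
qed (auto simp: wedge_def)

lemma tri_swap: "tri K a b c \<Longrightarrow> tri K a c b"
  using wedge_swap[of "b - a" "c - a"] by (auto simp: tri_def insert_commute)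

lemma tri_exchange: "tri K a b c \<Longrightarrow> tri K b a c"
  using wedge_base_change[of a b c] by (auto simp: tri_def insert_commute)

lemma tri_distinct:
  assumes "tri K a b c"
  shows "a \<noteq> b" "a \<noteq> c" "b \<noteq> c"
  using assms by (auto simp: tri_def wedge_def)

lemma tri_affine_independent:
  assumes "tri K a b c"
  shows "\<not> affine_dependent {a, b, c}"
proof
  assume "affine_dependent {a, b, c}"
  then have "collinear {b, a, c}"
    using collinear_3_eq_affine_dependent[of b a c] by (simp add: insert_commute)
  then have "collinear {0, b - a, c - a}" by (subst (asm) collinear_3) auto
  then have "wedge (b - a) (c - a) = 0"
    unfolding collinear_lemma wedge_eq_0_iff .
  with assms show False by (simp add: tri_def)
qed

lemma simplex_tri:
  assumes "2 simplex K"
  obtains a b c where "tri K a b c"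
proof -
  from assms obtain C where C: "\<not> affine_dependent C" "card C = 3" "K = convex hull C"
    unfolding simplex_def by auto
  then obtain a b c where abc: "C = {a, b, c}" "a \<noteq> b" "b \<noteq> c" "a \<noteq> c"
    by (auto simp: card_3_iff)
  have "wedge (b - a) (c - a) \<noteq> 0"
  proof
    assume "wedge (b - a) (c - a) = 0"
    then have "collinear {0, b - a, c - a}"
      unfolding collinear_lemma wedge_eq_0_iff .
    then have "collinear {b, a, c}" by (subst collinear_3) auto
    then show False
      using collinear_3_eq_affine_dependent[of b a c] abc C by (simp add: insert_commute)
  qed
  then show ?thesis using that C abc by (auto simp: tri_def)
qed

lemma tri_extreme:
  assumes "tri K a b c"
  shows "x extreme_point_of K \<longleftrightarrow> x = a \<or> x = b \<or> x = c"
  using extreme_point_of_convex_hull_affine_independent[OF tri_affine_independent[OF assms]] assms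
  by (auto simp: tri_def)

lemma simplex_tri_at:
  assumes "2 simplex K" "a extreme_point_of K"
  obtains b c where "tri K a b c"
proof -
  obtain x y w where t: "tri K x y w" using assms simplex_tri by blast
  then consider "a = x" | "a = y" | "a = w" using assms tri_extreme by blast
  then show ?thesis
  proof cases
    case 1 then show ?thesis using that t by blast
  next
    case 2 then show ?thesis using that tri_exchange[OF t] by blast
  next
    case 3 then show ?thesis using that tri_exchange[OF tri_swap[OF t]] by blast
  qed
qed

lemma simplex_tri_at2:
  assumes "2 simplex K" "a extreme_point_of K" "b extreme_point_of K" "a \<noteq> b"
  obtains c where "tri K a b c"
proof -
  obtain x y where t: "tri K a x y" using assms simplex_tri_at by blast
  then consider "b = x" | "b = y" using tri_extreme[OF t, of b] assms(3,4) by blast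
  then show ?thesis
  proof cases
    case 1 then show ?thesis using that t by blast
  next
    case 2 then show ?thesis using that tri_swap[OF t] by blast
  qed
qed

lemma tri_third_unique:
  assumes "tri K a b c" "tri K a b d"
  shows "c = d"
  using tri_extreme[OF assms(1), of d] tri_extreme[OF assms(2), of d] tri_distinct[OF assms(2)] by auto

lemma tri_edge_iff:
  assumes t: "tri K a b c"
  shows "E edge_of K \<longleftrightarrow> E = closed_segment a b \<or> E = closed_segment a c \<or> E = closed_segment b c"
proof
  note d = tri_distinct[OF t]
  assume E: "E edge_of K"
  then obtain C where C: "C \<subseteq> {a, b, c}" "E = convex hull C"
    using face_of_convex_hull_affine_independent[OF tri_affine_independent[OF t]] t
    by (auto simp: edge_of_def tri_def)
  have "\<not> affine_dependent C"
    using C tri_affine_independent[OF t] affine_independent_subset by blast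
  then have "card C = 2"
    using aff_dim_affine_independent[of C] E C by (simp add: edge_of_def aff_dim_convex_hull)
  then obtain x y where "C = {x, y}" "x \<noteq> y" by (auto simp: card_2_iff)
  with C have "E = closed_segment x y" "x \<in> {a, b, c}" "y \<in> {a, b, c}" "x \<noteq> y"
    by (auto simp: segment_convex_hull)
  then show "E = closed_segment a b \<or> E = closed_segment a c \<or> E = closed_segment b c"
    by (auto simp: closed_segment_commute)
next
  note d = tri_distinct[OF t]
  assume "E = closed_segment a b \<or> E = closed_segment a c \<or> E = closed_segment b c"
  then obtain x y where xy: "E = convex hull {x, y}" "{x, y} \<subseteq> {a, b, c}" "x \<noteq> y"
    using d by (auto simp: segment_convex_hull)
  have "K = convex hull {a, b, c}" using t by (simp add: tri_def)
  moreover have "\<exists>C\<subseteq>{a, b, c}. E = convex hull C" using xy(1,2) by (intro exI[of _ "{x, y}"] conjI)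
  ultimately have "E face_of K"
    using face_of_convex_hull_affine_independent[OF tri_affine_independent[OF t], of E] by simp
  then show "E edge_of K"
    using xy by (simp add: edge_of_def aff_dim_convex_hull aff_dim_2)
qed

subsection \<open>Barycentric coordinates\<close>

lemma bary_vertex:
  assumes "tri K a b c"
  shows "bary a b c a = 1" "bary a b c b = 0" "bary a b c c = 0"
  using tri_exchange[OF assms] by (auto simp: bary_def tri_def wedge_def)

lemma bary_affine: "bary a b c ((1 - t) *\<^sub>R x + t *\<^sub>R y) = (1 - t) * bary a b c x + t * bary a b c y"
proof -
  have "wedge ((1 - t) *\<^sub>R x + t *\<^sub>R y - b) (c - b) = (1 - t) * wedge (x - b) (c - b) + t * wedge (y - b) (c - b)"
    by (simp add: wedge_def algebra_simps)
  then show ?thesis by (simp add: bary_def add_divide_distrib)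
qed

lemma bary_diff: "bary a b c (x + t *\<^sub>R d) = bary a b c x + t * wedge d (c - b) / wedge (a - b) (c - b)"
proof -
  have "wedge (x + t *\<^sub>R d - b) (c - b) = wedge (x - b) (c - b) + t * wedge d (c - b)"
    by (simp add: wedge_def algebra_simps)
  then show ?thesis by (simp add: bary_def add_divide_distrib)
qed

lemma bary_coordinates:
  assumes "tri K a b c"
  shows "x = a + bary b a c x *\<^sub>R (b - a) + bary c a b x *\<^sub>R (c - a)"
proof -
  define w where "w = wedge (b - a) (c - a)"
  have w: "w \<noteq> 0" "wedge (c - a) (b - a) = - w"
    using assms by (auto simp: tri_def w_def wedge_def)
  have "w * (x - a) $ i = wedge (x - a) (c - a) * (b - a)$i - wedge (x - a) (b - a) * (c - a) $ i" for i
    using exhaust_2[of i] by (auto simp: w_def wedge_def algebra_simps)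
  then have "(x - a) $ i = (wedge (x - a) (c - a) * (b - a)$i - wedge (x - a) (b - a) * (c - a) $ i) / w" for i
    using w by (metis nonzero_mult_div_cancel_left)
  then have "x $ i - a $ i = bary b a c x * (b - a)$i + bary c a b x * (c - a)$i" for i
    using w by (simp add: bary_def w_def[symmetric] diff_divide_distrib)
  then show ?thesis by (simp add: vec_eq_iff diff_eq_eq add_ac)
qed

lemma bary_sum:
  assumes "tri K a b c"
  shows "bary a b c x + bary b a c x + bary c a b x = 1"
proof -
  define w where "w = wedge (b - a) (c - a)"
  have w: "w \<noteq> 0" "wedge (c - a) (b - a) = - w" "wedge (a - b) (c - b) = - w"
    using assms by (auto simp: tri_def w_def wedge_def algebra_simps)
  have "- wedge (x - b) (c - b) + wedge (x - a) (c - a) - wedge (x - a) (b - a) = w"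
    by (simp add: w_def wedge_def algebra_simps)
  then show ?thesis
    using w by (simp add: bary_def w_def[symmetric] field_simps)
qed

lemma tri_mem_iff:
  assumes "tri K a b c"
  shows "x \<in> K \<longleftrightarrow> 0 \<le> bary a b c x \<and> 0 \<le> bary b a c x \<and> 0 \<le> bary c a b x"
proof
  assume "x \<in> K"
  then obtain u v where x: "x = a + u *\<^sub>R (b - a) + v *\<^sub>R (c - a)" "0 \<le> u" "0 \<le> v" "u + v \<le> 1"
    using assms by (auto simp: tri_def convex_hull_3_alt)
  have "bary b a c x = u" "bary c a b x = v"
    using assms by (simp_all add: x bary_def tri_def wedge_def field_simps)
  then show "0 \<le> bary a b c x \<and> 0 \<le> bary b a c x \<and> 0 \<le> bary c a b x"
    using x bary_sum[OF assms, of x] by linarith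
next
  assume "0 \<le> bary a b c x \<and> 0 \<le> bary b a c x \<and> 0 \<le> bary c a b x"
  moreover then have "bary b a c x + bary c a b x \<le> 1" using bary_sum[OF assms, of x] by linarith
  ultimately show "x \<in> K"
    using bary_coordinates[OF assms, of x] assms unfolding tri_def convex_hull_3_alt by blast
qed

lemma bary_opposite:
  assumes "x \<in> closed_segment b c"
  shows "bary a b c x = 0"
proof -
  obtain t where "x = (1 - t) *\<^sub>R b + t *\<^sub>R c" using assms by (auto simp: in_segment)
  moreover have "bary a b c b = 0" "bary a b c c = 0" by (auto simp: bary_def wedge_def)
  ultimately show ?thesis by (simp add: bary_affine)
qed

lemma affine_vanishing_on_two_vertices:
  assumes t: "tri K a b c" and l: "\<And>x. l x = \<alpha> \<bullet> x + \<beta>" "l b = 0" "l c = 0"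
  shows "l x = l a * bary a b c x"
proof -
  have "l x = l a + bary b a c x * (l b - l a) + bary c a b x * (l c - l a)"
  proof -
    have "l x = l (a + bary b a c x *\<^sub>R (b - a) + bary c a b x *\<^sub>R (c - a))"
      using bary_coordinates[OF t, of x] by (rule arg_cong)
    also have "\<dots> = l a + bary b a c x * (l b - l a) + bary c a b x * (l c - l a)"
      unfolding l(1) by (simp add: inner_add_right inner_diff_right)
    finally show ?thesis .
  qed
  also have "\<dots> = l a * (1 - bary b a c x - bary c a b x)" using l(2,3) by (simp add: algebra_simps)
  also have "1 - bary b a c x - bary c a b x = bary a b c x" using bary_sum[OF t, of x] by simp
  finally show ?thesis .
qed

lemma barycentric_eq_bary:
  assumes t: "tri K a b c"
  shows "barycentric K a = bary a b c"
  unfolding barycentric_def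
proof (rule the_equality)
  let ?w = "wedge (a - b) (c - b)"
  have "bary a b c x = vec2 ((c - b)$2 / ?w, - (c - b)$1 / ?w) \<bullet> x + (b$2 * (c - b)$1 - b$1 * (c - b)$2) / ?w" for x
  proof -
    have "wedge (x - b) (c - b) = (c - b)$2 * x$1 + (- (c - b)$1) * x$2 + (b$2 * (c - b)$1 - b$1 * (c - b)$2)"
      by (simp add: wedge_def algebra_simps)
    then have "bary a b c x = ((c - b)$2 * x$1 + (- (c - b)$1) * x$2 + (b$2 * (c - b)$1 - b$1 * (c - b)$2)) / ?w"
      unfolding bary_def by simp
    also have "\<dots> = (c - b)$2 / ?w * x$1 + (- (c - b)$1 / ?w) * x$2 + (b$2 * (c - b)$1 - b$1 * (c - b)$2) / ?w"
      by (simp only: add_divide_distrib times_divide_eq_left)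
    finally show ?thesis by (simp add: inner_vec_def sum_2)
  qed
  then show "(\<exists>\<alpha> \<beta>. \<forall>x. bary a b c x = \<alpha> \<bullet> x + \<beta>) \<and> bary a b c a = 1 \<and>
     (\<forall>w. w extreme_point_of K \<and> w \<noteq> a \<longrightarrow> bary a b c w = 0)"
    using bary_vertex[OF t] tri_extreme[OF t] by blast
next
  fix l assume l: "(\<exists>\<alpha> \<beta>. \<forall>x. l x = \<alpha> \<bullet> x + \<beta>) \<and> l a = 1 \<and>
     (\<forall>w. w extreme_point_of K \<and> w \<noteq> a \<longrightarrow> l w = 0)"
  then obtain \<alpha> \<beta> where ab: "\<And>x. l x = \<alpha> \<bullet> x + \<beta>" by blast
  have "b extreme_point_of K" "c extreme_point_of K" using tri_extreme[OF t] by blast+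
  then have "l b = 0" "l c = 0" using l tri_distinct[OF t] by metis+
  note affine_vanishing_on_two_vertices[OF t ab this]
  moreover have "l a = 1" using l by blast
  ultimately show "l = bary a b c" by (simp only: mult_1 fun_eq_iff) simp
qed

lemma tri_closed_segments:
  assumes "tri K a b c"
  shows "closed_segment a b \<subseteq> K" "closed_segment a c \<subseteq> K" "closed_segment b c \<subseteq> K"
  using tri_edge_iff[OF assms] edge_of_imp_subset by blast+

lemma tri_vertices:
  assumes "tri K a b c"
  shows "a \<in> K" "b \<in> K" "c \<in> K"
  using assms by (auto simp: tri_def hull_inc)

lemma tri_topology:
  assumes "tri K a b c"
  shows "compact K" "convex K" "closed K" "interior K \<noteq> {}" "closure (interior K) = K"
proof -
  show K: "compact K" "convex K"
    using assms by (auto simp: tri_def finite_imp_compact_convex_hull)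
  then show cl: "closed K" by (simp add: compact_imp_closed)
  have "aff_dim K = 2"
    using aff_dim_affine_independent[OF tri_affine_independent[OF assms]] tri_distinct[OF assms] assms
    by (simp add: tri_def aff_dim_convex_hull)
  then have "rel_interior K = interior K"
    by (intro interior_rel_interior) simp
  then show ne: "interior K \<noteq> {}"
    using rel_interior_eq_empty[OF K(2)] tri_vertices(1)[OF assms] by auto
  show "closure (interior K) = K"
    using convex_closure_interior[OF K(2) ne] cl by simp
qed

lemma at_within_interior_tri:
  assumes "tri K a b c" "x \<in> K"
  shows "at x within interior K \<noteq> bot"
proof -
  have "x \<in> closure (interior K)" using tri_topology[OF assms(1)] assms(2) by simp
  moreover have "x islimpt interior K" if "x \<in> interior K"
    using that interior_limit_point interior_subset open_interior by (metis interior_interior)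
  ultimately show ?thesis
    by (auto simp: closure_def trivial_limit_within)
qed

section \<open>The patch of an inner vertex\<close>

lemma bary_ray_tendsto: "((\<lambda>e. bary a b c (x + e *\<^sub>R d)) \<longlongrightarrow> bary a b c x) (at_right 0)"
proof -
  have "((\<lambda>e. l + e * k) \<longlongrightarrow> l + 0 * k) (at_right 0)" for l k :: real
    by (intro tendsto_intros)
  from this[of "bary a b c x" "wedge d (c - b) / wedge (a - b) (c - b)"]
  show ?thesis by (simp add: bary_diff)
qed

lemma eventually_at_right_0_obtain:
  assumes "\<forall>\<^sub>F e in at_right (0::real). Q e"
  obtains e where "0 < e" "Q e"
proof -
  have "\<forall>\<^sub>F e in at_right (0::real). 0 < e \<and> Q e"
    by (intro eventually_conj eventually_at_right_less assms)
  then have "\<exists>e. 0 < e \<and> Q e"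
    by (rule eventually_happens'[rotated]) simp
  then show ?thesis using that by blast
qed

text \<open>
  \<open>T\<close> is the whole triangulation, and lying in the interior of its union is what makes the patch
  surround \<open>z\<close>.
\<close>

locale vertex_star =
  fixes T :: "(real^2) set set" and z :: "real^2"
  assumes finite_T: "finite T"
    and simplices: "K \<in> T \<Longrightarrow> 2 simplex K"
    and conforming: "K \<in> T \<Longrightarrow> K' \<in> T \<Longrightarrow> K \<noteq> K' \<Longrightarrow>
        K \<inter> K' = {} \<or> (K \<inter> K' edge_of K \<and> K \<inter> K' edge_of K') \<or>
        (\<exists>x. x extreme_point_of K \<and> x extreme_point_of K' \<and> K \<inter> K' = {x})"
    and z_vertex: "z \<in> vertices T"
    and z_interior: "z \<in> interior (\<Union>T)"
begin

abbreviation "P \<equiv> patch T z"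

lemma finite_patch: "finite P"
  using finite_T by (simp add: patch_def)

lemma patchD: "K \<in> P \<Longrightarrow> K \<in> T" "K \<in> P \<Longrightarrow> z \<in> K"
  by (auto simp: patch_def)

text \<open>
  The intersection of the two triangles is a face of both, and a vertex of one that lies in a face is
  extreme in that face.
\<close>

lemma vertex_mem_extreme:
  assumes "K \<in> T" "K' \<in> T" "y extreme_point_of K" "y \<in> K'"
  shows "y extreme_point_of K'"
proof (cases "K = K'")
  case False
  have y: "y \<in> K \<inter> K'" using assms by (auto simp: extreme_point_of_def)
  from conforming[OF assms(1,2) False] y consider
    "K \<inter> K' edge_of K" "K \<inter> K' edge_of K'" | x where "x extreme_point_of K'" "K \<inter> K' = {x}"
    by auto
  then show ?thesis
  proof cases
    case 1
    then have "K \<inter> K' face_of K" "K \<inter> K' face_of K'" by (auto simp: edge_of_def)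
    then show ?thesis using extreme_point_of_face y assms(3) by blast
  next
    case 2 then show ?thesis using y by auto
  qed
qed (use assms in simp)

lemma vertices_extreme: "y \<in> vertices T \<Longrightarrow> K \<in> T \<Longrightarrow> y \<in> K \<Longrightarrow> y extreme_point_of K"
  unfolding vertices_def using vertex_mem_extreme by blast

lemma patch_tri:
  assumes "K \<in> P"
  obtains b c where "tri K z b c"
  using simplex_tri_at[OF simplices] vertices_extreme[OF z_vertex] patchD[OF assms] by metis

lemma tri_vertices_in_T:
  assumes "tri K a b c" "K \<in> T"
  shows "a \<in> vertices T" "b \<in> vertices T" "c \<in> vertices T"
  using assms tri_extreme[OF assms(1)] by (auto simp: vertices_def)

lemma patch_tri_at:
  assumes "K \<in> P" "y \<in> K" "y \<in> vertices T" "y \<noteq> z"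
  obtains c where "tri K z y c"
proof -
  have "z extreme_point_of K" "y extreme_point_of K"
    using vertices_extreme z_vertex assms patchD[OF assms(1)] by blast+
  then show ?thesis using simplex_tri_at2[OF simplices] that patchD[OF assms(1)] assms(4) by metis
qed

text \<open>
  Among the possible intersections of two triangles only an edge contains points that are not vertices,
  and \<open>[a, b]\<close> is the only edge of \<open>K\<close> through \<open>x\<close>.
\<close>

lemma shared_edge_of_inner_point:
  assumes K: "K \<in> T" "tri K a b c" and K': "K' \<in> T" "K' \<noteq> K"
    and x: "x \<in> K'" "x \<in> closed_segment a b" "x \<noteq> a" "x \<noteq> b"
  shows "K \<inter> K' = closed_segment a b" "\<exists>c'. tri K' a b c'"
proof -
  have xK: "x \<in> K" using x(2) tri_closed_segments[OF K(2)] by blast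
  have "\<not> x extreme_point_of K"
    using tri_extreme[OF K(2)] x(2-4) bary_opposite[OF x(2), of c] bary_vertex[OF tri_exchange[OF tri_swap[OF K(2)]]]
    by auto
  then have "K \<inter> K' \<noteq> {y}" if "y extreme_point_of K" for y
    using that x(1) xK by auto
  moreover have "K \<inter> K' \<noteq> {}" using x(1) xK by auto
  ultimately have e: "K \<inter> K' edge_of K" "K \<inter> K' edge_of K'"
    using conforming[OF K(1) K'(1) K'(2)[symmetric]] by meson+
  obtain t where t: "x = (1 - t) *\<^sub>R a + t *\<^sub>R b" using x(2) by (auto simp: in_segment)
  have "bary a b c x = 1 - t" "bary b a c x = t"
    using bary_vertex[OF K(2)] bary_vertex[OF tri_exchange[OF K(2)]] by (auto simp: t bary_affine)
  moreover have "t \<noteq> 0" "t \<noteq> 1" using x(3,4) t by auto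
  ultimately have "x \<notin> closed_segment b c" "x \<notin> closed_segment a c"
    using bary_opposite[of x b c a] bary_opposite[of x a c b] by auto
  with x(1) xK have "K \<inter> K' \<noteq> closed_segment b c" "K \<inter> K' \<noteq> closed_segment a c" by auto
  with e(1) show eq: "K \<inter> K' = closed_segment a b"
    unfolding tri_edge_iff[OF K(2)] by simp
  have "a \<in> K \<inter> K'" "b \<in> K \<inter> K'" unfolding eq by simp_all
  then have "a \<in> K'" "b \<in> K'" by simp_all
  then have "a extreme_point_of K'" "b extreme_point_of K'"
    using vertices_extreme[OF _ K'(1)] tri_vertices_in_T[OF K(2,1)] by simp_all
  from simplex_tri_at2[OF simplices[OF K'(1)] this tri_distinct(1)[OF K(2)]]
  show "\<exists>c'. tri K' a b c'" by blast
qed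

lemma shared_edge:
  assumes K: "K \<in> T" "tri K a b c" and K': "K' \<in> T" "tri K' a b c'" and ne: "K \<noteq> K'"
  shows "K \<inter> K' = closed_segment a b"
proof (rule shared_edge_of_inner_point(1)[OF K K'(1) ne[symmetric]])
  show "midpoint a b \<in> K'" using tri_closed_segments[OF K'(2)] midpoint_in_closed_segment by blast
qed (use tri_distinct(1)[OF K(2)] in auto)

text \<open>
  Two triangles on the same side of a common edge overlap: a point slightly above the midpoint of
  the edge lies in both.
\<close>

lemma opposite_sides:
  assumes K: "K \<in> T" "tri K a b c" and K': "K' \<in> T" "tri K' a b c'" and ne: "K \<noteq> K'"
  shows "wedge (b - a) (c - a) * wedge (b - a) (c' - a) < 0"
proof (rule ccontr)
  let ?m = "midpoint a b"
  assume "\<not> ?thesis"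
  moreover have w: "wedge (b - a) (c - a) \<noteq> 0" "wedge (b - a) (c' - a) \<noteq> 0"
    using K K' by (auto simp: tri_def)
  ultimately have pos: "0 < wedge (b - a) (c - a) * wedge (b - a) (c' - a)"
    by (simp add: not_less less_le)
  have ratio: "0 < wedge (b - a) (c - a) / wedge (b - a) (c' - a)"
    using pos by (auto simp: zero_less_mult_iff zero_less_divide_iff)
  define x where "x e = ?m + e *\<^sub>R (c - a)" for e
  have m: "?m = (1 - 1/2) *\<^sub>R a + (1/2) *\<^sub>R b"
    by (simp add: midpoint_def scaleR_add_right)
  have "((\<lambda>e. bary a b c' (x e)) \<longlongrightarrow> bary a b c' (x 0)) (at_right 0)"
    "((\<lambda>e. bary b a c' (x e)) \<longlongrightarrow> bary b a c' (x 0)) (at_right 0)"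
    "((\<lambda>e. bary a b c (x e)) \<longlongrightarrow> bary a b c (x 0)) (at_right 0)"
    "((\<lambda>e. bary b a c (x e)) \<longlongrightarrow> bary b a c (x 0)) (at_right 0)"
    using bary_ray_tendsto by (simp_all add: x_def)
  moreover have "bary a b c' (x 0) = 1/2" "bary b a c' (x 0) = 1/2" "bary a b c (x 0) = 1/2" "bary b a c (x 0) = 1/2"
    unfolding x_def m scaleR_zero_left add_0_right bary_affine
    using bary_vertex[OF K(2)] bary_vertex[OF K'(2)]
      bary_vertex[OF tri_exchange[OF K(2)]] bary_vertex[OF tri_exchange[OF K'(2)]] by auto
  ultimately have "\<forall>\<^sub>F e in at_right 0. 0 < bary a b c' (x e) \<and> 0 < bary b a c' (x e)
      \<and> 0 < bary a b c (x e) \<and> 0 < bary b a c (x e)"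
    by (intro eventually_conj order_tendstoD(1)) auto
  then obtain e where "0 < e" "0 < bary a b c' (x e) \<and> 0 < bary b a c' (x e)
      \<and> 0 < bary a b c (x e) \<and> 0 < bary b a c (x e)"
    by (rule eventually_at_right_0_obtain)
  then have e: "0 < e" "0 < bary a b c' (x e)" "0 < bary b a c' (x e)"
      "0 < bary a b c (x e)" "0 < bary b a c (x e)"
    by simp_all
  have swap: "wedge u v / wedge u' v' = wedge v u / wedge v' u'" for u v u' v'
    by (simp add: wedge_swap[of u v] wedge_swap[of u' v'])
  have lm: "bary c a b ?m = 0" "bary c' a b ?m = 0" by (simp_all add: bary_opposite)
  have "bary c' a b (x e) = e * (wedge (c - a) (b - a) / wedge (c' - a) (b - a))"
    unfolding x_def bary_diff lm by simp
  also have "\<dots> > 0"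
    unfolding swap[of "c - a" "b - a" "c' - a" "b - a"] by (rule mult_pos_pos[OF e(1) ratio])
  finally have 1: "bary c' a b (x e) > 0" .
  have "bary c a b (x e) = e * (wedge (c - a) (b - a) / wedge (c - a) (b - a))"
    unfolding x_def bary_diff lm by simp
  also have "\<dots> = e" using w wedge_swap[of "c - a" "b - a"] by simp
  finally have 2: "bary c a b (x e) > 0" using e by simp
  have "x e \<in> K \<inter> K'"
    using e 1 2 by (simp add: tri_mem_iff[OF K(2)] tri_mem_iff[OF K'(2)])
  then have "x e \<in> closed_segment a b" using shared_edge[OF K K' ne] by simp
  then show False using bary_opposite[of "x e" a b c] 2 by simp
qed

text \<open>
  Of three triangles at an edge, two would lie on the same side.
\<close>

lemma shared_edge_two:
  assumes "K \<in> T" "tri K a b c" "K' \<in> T" "tri K' a b c'" "K'' \<in> T" "tri K'' a b c''"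
    and "K \<noteq> K'" "K \<noteq> K''"
  shows "K' = K''"
proof (rule ccontr)
  assume "K' \<noteq> K''"
  then have "wedge (b - a) (c' - a) * wedge (b - a) (c'' - a) < 0"
    "wedge (b - a) (c - a) * wedge (b - a) (c' - a) < 0"
    "wedge (b - a) (c - a) * wedge (b - a) (c'' - a) < 0"
    using opposite_sides assms by blast+
  then show False by (auto simp: mult_less_0_iff)
qed

lemma z_interior_patch: "z \<in> interior (\<Union>P)"
proof -
  have "finite (T - P)" using finite_T by simp
  moreover have "closed K" if "K \<in> T - P" for K
    using that simplex_tri[OF simplices] tri_topology(3) by (metis DiffD1)
  ultimately have "closed (\<Union>(T - P))" by blast
  then have "open (interior (\<Union>T) - \<Union>(T - P))" by (intro open_Diff) auto
  moreover have "z \<in> interior (\<Union>T) - \<Union>(T - P)"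
    using z_interior by (auto simp: patch_def)
  moreover have "interior (\<Union>T) - \<Union>(T - P) \<subseteq> \<Union>P"
    using interior_subset[of "\<Union>T"] by auto
  ultimately show ?thesis by (meson interiorI)
qed

lemma patch_closed: "K \<in> P \<Longrightarrow> closed K" "closed (\<Union>P)"
proof -
  show *: "closed K" if "K \<in> P" for K
    using that patch_tri tri_topology(3) by metis
  show "closed (\<Union>P)" using * finite_patch by blast
qed

lemma patch_finite_avoid: "\<exists>U. open U \<and> x \<in> U \<and> (\<forall>K\<in>P. x \<notin> K \<longrightarrow> K \<inter> U = {})"
proof (intro exI conjI ballI impI)
  have "closed (\<Union>{K\<in>P. x \<notin> K})" using patch_closed finite_patch by (intro closed_Union) auto
  then show "open (- \<Union>{K\<in>P. x \<notin> K})" by (rule open_Compl)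
qed auto

text \<open>
  Walking from a point of the edge \<open>[z, b]\<close> close to \<open>z\<close> out of \<open>K\<close>, one stays inside the
  patch and so enters another triangle, which must share the edge.
\<close>

lemma neighbour_exists:
  assumes K: "K \<in> P" "tri K z b c"
  obtains K' c' where "K' \<in> P" "K' \<noteq> K" "tri K' z b c'"
proof -
  have "((\<lambda>t. z + t *\<^sub>R (b - z)) \<longlongrightarrow> z + 0 *\<^sub>R (b - z)) (at_right (0::real))"
    by (intro tendsto_intros)
  then have "\<forall>\<^sub>F t in at_right 0. z + t *\<^sub>R (b - z) \<in> interior (\<Union>P)"
    by (rule topological_tendstoD) (use z_interior_patch in simp_all)
  moreover have "\<forall>\<^sub>F t in at_right (0::real). t < 1" by (rule eventually_mono[OF eventually_at_right_real[of 0 1]]) auto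
  ultimately have "\<forall>\<^sub>F t in at_right 0. z + t *\<^sub>R (b - z) \<in> interior (\<Union>P) \<and> t < 1"
    by (rule eventually_conj)
  then obtain t where "0 < t" "z + t *\<^sub>R (b - z) \<in> interior (\<Union>P) \<and> t < 1"
    by (rule eventually_at_right_0_obtain)
  then have t: "0 < t" "t < 1" "z + t *\<^sub>R (b - z) \<in> interior (\<Union>P)"
    by simp_all
  define m where "m = z + t *\<^sub>R (b - z)"
  obtain U where U: "open U" "m \<in> U" "\<And>K. K \<in> P \<Longrightarrow> m \<notin> K \<Longrightarrow> K \<inter> U = {}"
    using patch_finite_avoid[of m] by auto
  have "((\<lambda>e. m - e *\<^sub>R (c - z)) \<longlongrightarrow> m - 0 *\<^sub>R (c - z)) (at_right (0::real))"
    by (intro tendsto_intros)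
  then have "\<forall>\<^sub>F e in at_right 0. m - e *\<^sub>R (c - z) \<in> interior (\<Union>P) \<inter> U"
    by (rule topological_tendstoD) (use t U in \<open>simp_all add: m_def open_Int\<close>)
  then obtain e where "0 < e" "m - e *\<^sub>R (c - z) \<in> interior (\<Union>P) \<inter> U"
    by (rule eventually_at_right_0_obtain)
  then have e: "0 < e" "m - e *\<^sub>R (c - z) \<in> interior (\<Union>P)" "m - e *\<^sub>R (c - z) \<in> U"
    by simp_all
  then obtain K' where K': "K' \<in> P" "m - e *\<^sub>R (c - z) \<in> K'"
    using subsetD[OF interior_subset e(2)] by auto
  have mK': "m \<in> K'"
  proof (rule ccontr)
    assume "m \<notin> K'"
    from U(3)[OF K'(1) this] show False using e(3) K'(2) by (simp add: disjoint_iff)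
  qed
  have seg: "m \<in> closed_segment z b"
    unfolding in_segment using t by (intro exI[of _ t]) (auto simp: m_def algebra_simps)
  have "bary c z b (m + (- e) *\<^sub>R (c - z)) = - e"
  proof -
    have "wedge (c - z) (b - z) \<noteq> 0" using K wedge_swap[of "c - z"] by (simp add: tri_def)
    then show ?thesis unfolding bary_diff bary_opposite[OF seg] by simp
  qed
  then have "K' \<noteq> K" using e K'(2) tri_mem_iff[OF K(2)] by auto
  moreover have "m - z = t *\<^sub>R (b - z)" "m - b = (t - 1) *\<^sub>R (b - z)"
    by (simp_all add: m_def algebra_simps)
  then have "m \<noteq> z" "m \<noteq> b" using t tri_distinct(1)[OF K(2)] by auto
  ultimately have "\<exists>c'. tri K' z b c'"
    using shared_edge_of_inner_point(2)[OF patchD(1)[OF K(1)] K(2) patchD(1)[OF K'(1)] _ mK' seg] by simp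
  with that K' \<open>K' \<noteq> K\<close> show ?thesis by blast
qed

text \<open>
  Another triangle of the patch would share the edge \<open>[b, c]\<close>; as it also contains \<open>z\<close>, the point
  \<open>z\<close> would lie on that edge.
\<close>

lemma outer_edge_private:
  assumes K: "K \<in> P" "tri K z b c" and K': "K' \<in> P" "x \<in> K'" and x: "x \<in> open_segment b c"
  shows "K' = K"
proof (rule ccontr)
  assume ne: "K' \<noteq> K"
  have t: "tri K b c z" by (rule tri_swap[OF tri_exchange[OF K(2)]])
  have "K \<inter> K' = closed_segment b c"
    by (rule shared_edge_of_inner_point(1)[OF patchD(1)[OF K(1)] t patchD(1)[OF K'(1)] ne K'(2)])
       (use x in \<open>auto simp: open_segment_def\<close>)
  moreover have "z \<in> K \<inter> K'" using patchD(2)[OF K(1)] patchD(2)[OF K'(1)] by simp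
  ultimately have "z \<in> closed_segment b c" by simp
  then show False using bary_opposite[of z b c z] bary_vertex[OF K(2)] by simp
qed

text \<open>
  Near an inner point of \<open>[b, c]\<close> the patch coincides with \<open>K\<close>, so that it is left when walking away
  from \<open>z\<close>.
\<close>

lemma outer_edge_frontier:
  assumes K: "K \<in> P" "tri K z b c"
  shows "closed_segment b c \<subseteq> frontier (\<Union>P)"
proof -
  have "open_segment b c \<subseteq> frontier (\<Union>P)"
  proof
    fix x assume x: "x \<in> open_segment b c"
    then have xK: "x \<in> K" using subsetD[OF tri_closed_segments(3)[OF K(2)]] by (simp add: open_segment_def)
    have "x \<notin> interior (\<Union>P)"
    proof
      assume int: "x \<in> interior (\<Union>P)"
      obtain U where U: "open U" "x \<in> U" "\<And>K. K \<in> P \<Longrightarrow> x \<notin> K \<Longrightarrow> K \<inter> U = {}"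
        using patch_finite_avoid[of x] by auto
      have "((\<lambda>e. x - e *\<^sub>R (z - b)) \<longlongrightarrow> x - 0 *\<^sub>R (z - b)) (at_right (0::real))"
        by (intro tendsto_intros)
      then have "\<forall>\<^sub>F e in at_right 0. x - e *\<^sub>R (z - b) \<in> interior (\<Union>P) \<inter> U"
        by (rule topological_tendstoD) (use int U in \<open>simp_all add: open_Int\<close>)
      then obtain e where "0 < e" "x - e *\<^sub>R (z - b) \<in> interior (\<Union>P) \<inter> U"
        by (rule eventually_at_right_0_obtain)
      then have e: "0 < e" "x - e *\<^sub>R (z - b) \<in> interior (\<Union>P)" "x - e *\<^sub>R (z - b) \<in> U"
        by simp_all
      then obtain K' where K': "K' \<in> P" "x - e *\<^sub>R (z - b) \<in> K'"
        using subsetD[OF interior_subset e(2)] by auto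
      have "x \<in> K'"
      proof (rule ccontr)
        assume "x \<notin> K'"
        from U(3)[OF K'(1) this] show False using e(3) K'(2) by (simp add: disjoint_iff)
      qed
      then have "K' = K" by (rule outer_edge_private[OF K K'(1) _ x])
      moreover have "bary z b c (x + (- e) *\<^sub>R (z - b)) = - e"
      proof -
        have "wedge (z - b) (c - b) \<noteq> 0" using tri_exchange[OF K(2)] by (simp add: tri_def)
        moreover have "x \<in> closed_segment b c" using x by (simp add: open_segment_def)
        ultimately show ?thesis unfolding bary_diff bary_opposite[OF \<open>x \<in> closed_segment b c\<close>] by simp
      qed
      ultimately show False using e K'(2) tri_mem_iff[OF K(2)] by auto
    qed
    moreover have "x \<in> closure (\<Union>P)"
      by (rule subsetD[OF closure_subset]) (use xK K(1) in auto)
    ultimately show "x \<in> frontier (\<Union>P)" by (simp add: frontier_def)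
  qed
  then have "closure (open_segment b c) \<subseteq> frontier (\<Union>P)"
    by (rule closure_minimal) (rule frontier_closed)
  then show ?thesis using tri_distinct(3)[OF K(2)] by simp
qed

lemma inner_edge_not_frontier: "\<not> closed_segment z b \<subseteq> frontier (\<Union>P)"
  using z_interior_patch by (auto simp: frontier_def)

lemma interiors_disjoint:
  assumes "K \<in> P" "K' \<in> P" "K \<noteq> K'"
  shows "interior K \<inter> interior K' = {}"
proof -
  have "aff_dim (K \<inter> K') \<le> 1"
    using conforming[OF patchD(1)[OF assms(1)] patchD(1)[OF assms(2)] assms(3)]
    by (auto simp: edge_of_def)
  then have "interior (K \<inter> K') = {}"
    using aff_dim_open[of "interior (K \<inter> K')"] aff_dim_subset[OF interior_subset, of "K \<inter> K'"] by fastforce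
  then show ?thesis by simp
qed

end

section \<open>Piecewise polynomial functions on the patch\<close>

lemma polys_gradient:
  assumes "f \<in> polys k"
  obtains g where "\<And>j. (\<lambda>x. g x $ j) \<in> polys (k - 1)"
    "\<And>x. (f has_derivative (\<lambda>d. g x \<bullet> d)) (at x)"
proof -
  obtain g1 g2 where g: "g1 \<in> polys (k - 1)" "g2 \<in> polys (k - 1)"
    "\<And>x. (f has_derivative (\<lambda>d. g1 x * d$1 + g2 x * d$2)) (at x)"
    using polys_deriv[OF assms] by auto
  have "(\<lambda>x. vec2 (g1 x, g2 x) $ j) \<in> polys (k - 1)" for j
    using g(1,2) exhaust_2[of j] by auto
  moreover have "(f has_derivative (\<lambda>d. vec2 (g1 x, g2 x) \<bullet> d)) (at x)" for x
    using g(3) by (simp add: inner_vec_def sum_2)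
  ultimately show ?thesis by (rule that)
qed

lemma tri_integral_deriv:
  assumes t: "tri K z b c" and f: "f \<in> polys k"
    and g: "\<And>j. (\<lambda>x. g x $ j) \<in> polys l" "\<And>x. (f has_derivative (\<lambda>d. g x \<bullet> d)) (at x)"
    and bc: "edge_mean b c f = 0"
  shows "integral K (\<lambda>x. g x \<bullet> d)
    = - sgn (wedge (b - z) (c - z)) * wedge (b - z) d * edge_mean z b f
      - sgn (wedge (c - z) (b - z)) * wedge (c - z) d * edge_mean z c f"
proof -
  have "integral (convex hull {z, b, c}) (\<lambda>x. g x $ 1 * d$1 + g x $ 2 * d$2)
    = - sgn (wedge (b - z) (c - z)) * wedge (b - z) d * edge_mean z b f
      - sgn (wedge (c - z) (b - z)) * wedge (c - z) d * edge_mean z c f"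
    by (rule integral_deriv[OF _ _ continuous_on_polys[OF g(1)] continuous_on_polys[OF g(1)] bc])
       (use t g(2) in \<open>auto simp: tri_def inner_vec_def sum_2\<close>)
  then show ?thesis using t by (simp add: tri_def inner_vec_def sum_2)
qed

lemma side_trace_eq:
  assumes t: "tri K a b c" and x: "x \<in> K" and u: "\<And>y. y \<in> interior K \<Longrightarrow> u y = h y"
    and h: "continuous_on UNIV h"
  shows "side_trace K u x = h x"
  unfolding side_trace_def
proof (rule tendsto_Lim)
  show "at x within interior K \<noteq> bot" by (rule at_within_interior_tri[OF t x])
  have "(h \<longlongrightarrow> h x) (at x within interior K)"
    using h by (meson UNIV_I continuous_on_def tendsto_within_subset subset_UNIV)
  moreover have "\<forall>\<^sub>F y in at x within interior K. h y = u y"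
    using u by (auto simp: eventually_at_filter)
  ultimately show "(u \<longlongrightarrow> h x) (at x within interior K)"
    by (rule Lim_transform_eventually)
qed

context vertex_star
begin

lemma piecewise_interior:
  assumes "K \<in> P" "x \<in> interior K"
  shows "piecewise P g x = g K x"
proof -
  have "piecewise P g x = (\<Sum>K'\<in>P. if K' = K then g K x else 0)"
    unfolding piecewise_def
    using interiors_disjoint[OF assms(1)] assms(2) by (intro sum.cong) auto
  then show ?thesis using assms finite_patch by simp
qed

lemma piecewise_outside: "x \<notin> (\<Union>K\<in>P. interior K) \<Longrightarrow> piecewise P g x = 0"
  unfolding piecewise_def by (intro sum.neutral) auto

lemma piecewise_in_PP: "(\<And>K. K \<in> P \<Longrightarrow> g K \<in> polys k) \<Longrightarrow> piecewise P g \<in> PP k P"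
  unfolding PP_def using piecewise_interior piecewise_outside by blast

lemma patch_integral:
  fixes F :: "real^2 \<Rightarrow> real"
  assumes h: "\<And>K. K \<in> P \<Longrightarrow> continuous_on UNIV (h K)"
    and F: "\<And>K x. K \<in> P \<Longrightarrow> x \<in> interior K \<Longrightarrow> F x = h K x"
    and F0: "\<And>x. x \<notin> (\<Union>K\<in>P. interior K) \<Longrightarrow> F x = 0"
  shows "F integrable_on \<Union>P" "integral (\<Union>P) F = (\<Sum>K\<in>P. integral K (h K))"
proof -
  have "((\<lambda>x. if x \<in> interior K then h K x else 0) has_integral integral K (h K)) UNIV" if K: "K \<in> P" for K
  proof -
    obtain b c where t: "tri K z b c" using patch_tri[OF K] .
    have "h K integrable_on K"
      by (rule set_borel_integral_eq_integral(1)[OF set_integrable_compact_continuous[OF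
            tri_topology(1)[OF t] continuous_on_subset[OF h[OF K]]]]) simp
    then have "(h K has_integral integral K (h K)) K" by (rule integrable_integral)
    then have "(h K has_integral integral K (h K)) (interior K)"
      by (simp only: has_integral_interior[OF negligible_convex_frontier[OF tri_topology(2)[OF t]]])
    then show ?thesis by (simp add: has_integral_restrict_UNIV)
  qed
  then have "((\<lambda>x. \<Sum>K\<in>P. if x \<in> interior K then h K x else 0) has_integral (\<Sum>K\<in>P. integral K (h K))) UNIV"
    by (intro has_integral_sum finite_patch)
  moreover have "(\<Sum>K\<in>P. if x \<in> interior K then h K x else 0) = (if x \<in> \<Union>P then F x else 0)" for x
  proof (cases "x \<in> (\<Union>K\<in>P. interior K)")
    case True
    then obtain K where K: "K \<in> P" "x \<in> interior K" by blast
    then have "x \<in> \<Union>P" using interior_subset by blast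
    then show ?thesis
      using piecewise_interior[OF K, of h] F[OF K] by (simp add: piecewise_def)
  next
    case False
    then show ?thesis using piecewise_outside[OF False, of h] F0[OF False] by (simp add: piecewise_def)
  qed
  ultimately have "(F has_integral (\<Sum>K\<in>P. integral K (h K))) (\<Union>P)"
    by (simp only: has_integral_restrict_UNIV)
  then show "F integrable_on \<Union>P" "integral (\<Union>P) F = (\<Sum>K\<in>P. integral K (h K))"
    by (rule has_integral_integrable, rule integral_unique)
qed

subsection \<open>Piecewise polynomial vector fields\<close>

text \<open>
  \<open>f K i\<close> is the polynomial that the \<open>i\<close>-th component of \<open>v\<close> equals on \<open>K\<close>, and \<open>g K i\<close> its
  gradient.
\<close>

definition pieces :: "nat \<Rightarrow> (real^2 \<Rightarrow> real^2) \<Rightarrow> ((real^2) set \<Rightarrow> 2 \<Rightarrow> real^2 \<Rightarrow> real) \<Rightarrow>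
    ((real^2) set \<Rightarrow> 2 \<Rightarrow> real^2 \<Rightarrow> real^2) \<Rightarrow> bool" where
  "pieces p v f g \<longleftrightarrow> (\<forall>K\<in>P. \<forall>i. f K i \<in> polys p \<and> (\<forall>x\<in>interior K. v x $ i = f K i x) \<and>
     (\<forall>j. (\<lambda>x. g K i x $ j) \<in> polys (p - 1)) \<and> (\<forall>x. (f K i has_derivative (\<lambda>d. g K i x \<bullet> d)) (at x)))"

lemma piecesD:
  assumes "pieces p v f g" "K \<in> P"
  shows "f K i \<in> polys p" "x \<in> interior K \<Longrightarrow> v x $ i = f K i x"
    "(\<lambda>x. g K i x $ j) \<in> polys (p - 1)" "(f K i has_derivative (\<lambda>d. g K i x \<bullet> d)) (at x)"
  using assms by (auto simp: pieces_def)

lemma pieces_exist: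
  assumes "\<And>i K. K \<in> P \<Longrightarrow> \<exists>h\<in>polys p. \<forall>x\<in>interior K. v x $ i = h x"
  obtains f g where "pieces p v f g"
proof -
  define R where "R K i h g \<longleftrightarrow> h \<in> polys p \<and> (\<forall>x\<in>interior K. v x $ i = h x) \<and>
     (\<forall>j. (\<lambda>x. g x $ j) \<in> polys (p - 1)) \<and> (\<forall>x. (h has_derivative (\<lambda>d. g x \<bullet> d)) (at x))"
    for K and i :: 2 and h and g :: "real^2 \<Rightarrow> real^2"
  define H where "H K i = (SOME hg. R K i (fst hg) (snd hg))" for K i
  have "R K i (fst (H K i)) (snd (H K i))" if K: "K \<in> P" for K i
  proof -
    obtain h where h: "h \<in> polys p" "\<forall>x\<in>interior K. v x $ i = h x" using assms[OF K] by blast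
    obtain g where "\<And>j. (\<lambda>x. g x $ j) \<in> polys (p - 1)" "\<And>x. (h has_derivative (\<lambda>d. g x \<bullet> d)) (at x)"
      using polys_gradient[OF h(1)] by metis
    with h have "R K i (fst (h, g)) (snd (h, g))" by (simp add: R_def)
    then show ?thesis unfolding H_def by (rule someI)
  qed
  then have "pieces p v (\<lambda>K i. fst (H K i)) (\<lambda>K i. snd (H K i))"
    unfolding pieces_def R_def by simp
  then show ?thesis by (rule that)
qed

lemma div_pw_pieces:
  assumes v: "pieces p v f g" and K: "K \<in> P" and x: "x \<in> interior K"
  shows "div_pw P v x = (\<Sum>i\<in>UNIV. g K i x $ i)"
proof -
  have "((\<lambda>y. \<chi> i. f K i y) has_derivative (\<lambda>d. \<chi> i. g K i x \<bullet> d)) (at x)"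
    by (subst has_derivative_componentwise_within)
       (auto simp: Basis_vec_def inner_axis intro!: piecesD(4)[OF v K])
  then have "(v has_derivative (\<lambda>d. \<chi> i. g K i x \<bullet> d)) (at x)"
    by (rule has_derivative_transform_within_open[OF _ open_interior x])
       (auto simp: vec_eq_iff piecesD(2)[OF v K])
  then have "frechet_derivative v (at x) = (\<lambda>d. \<chi> i. g K i x \<bullet> d)"
    using frechet_derivative_at by metis
  then have "trace (jacobian v (at x)) = (\<Sum>i\<in>UNIV. g K i x $ i)"
    by (simp add: trace_def jacobian_def matrix_def inner_axis)
  then show ?thesis unfolding div_pw_def using piecewise_interior[OF K x] by simp
qed

lemma pairing_formula:
  assumes v: "pieces p v f g"
    and q: "\<And>K x. K \<in> P \<Longrightarrow> x \<in> interior K \<Longrightarrow> q x = Q K x" "\<And>K. K \<in> P \<Longrightarrow> continuous_on UNIV (Q K)"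
  shows "(\<lambda>x. q x * div_pw P v x) integrable_on \<Union>P"
    "integral (\<Union>P) (\<lambda>x. q x * div_pw P v x) = (\<Sum>K\<in>P. integral K (\<lambda>x. Q K x * (\<Sum>i\<in>UNIV. g K i x $ i)))"
proof -
  have c: "continuous_on UNIV (\<lambda>x. Q K x * (\<Sum>i\<in>UNIV. g K i x $ i))" if "K \<in> P" for K
    by (intro continuous_intros q(2) that continuous_on_polys[OF piecesD(3)[OF v that]])
  have 0: "q x * div_pw P v x = 0" if "x \<notin> (\<Union>K\<in>P. interior K)" for x
    using piecewise_outside[OF that] by (simp add: div_pw_def)
  have 1: "q x * div_pw P v x = Q K x * (\<Sum>i\<in>UNIV. g K i x $ i)" if "K \<in> P" "x \<in> interior K" for K x
    using div_pw_pieces[OF v that] q(1)[OF that] by simp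
  show "(\<lambda>x. q x * div_pw P v x) integrable_on \<Union>P"
    "integral (\<Union>P) (\<lambda>x. q x * div_pw P v x) = (\<Sum>K\<in>P. integral K (\<lambda>x. Q K x * (\<Sum>i\<in>UNIV. g K i x $ i)))"
    by (rule patch_integral[OF c 1 0]; assumption)+
qed

lemma PP_pieces:
  assumes "q \<in> PP k P"
  obtains Q where "\<And>K. K \<in> P \<Longrightarrow> Q K \<in> polys k" "\<And>K x. K \<in> P \<Longrightarrow> x \<in> interior K \<Longrightarrow> q x = Q K x"
proof -
  have "\<forall>K\<in>P. \<exists>g. g \<in> polys k \<and> (\<forall>x\<in>interior K. q x = g x)"
    using assms by (auto simp: PP_def)
  then obtain Q where "\<forall>K\<in>P. Q K \<in> polys k \<and> (\<forall>x\<in>interior K. q x = Q K x)"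
    by (rule bchoice[elim_format]) blast
  then show ?thesis using that by blast
qed

lemma CR0_pieces:
  assumes "\<And>i. (\<lambda>x. v x $ i) \<in> CR0 p P"
  obtains f g where "pieces p v f g"
  by (rule pieces_exist[of p v]) (use assms in \<open>auto simp: CR0_def PP_def\<close>)

text \<open>
  \<open>pieces\<close> only speaks about the open triangles; for a conforming field both sides are continuous up to
  the boundary.
\<close>

lemma S0_pieces_closed:
  assumes "\<And>i. (\<lambda>x. v x $ i) \<in> S0 p P"
  obtains f g where "pieces p v f g" "\<And>K i x. K \<in> P \<Longrightarrow> x \<in> K \<Longrightarrow> v x $ i = f K i x"
proof -
  have ex: "\<exists>h\<in>polys p. \<forall>x\<in>K. v x $ i = h x" if "K \<in> P" for K i
    using assms[of i] that by (auto simp: S0_def)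
  obtain f g where fg: "pieces p v f g"
    by (rule pieces_exist[of p v]) (use ex interior_subset in blast)
  have "v x $ i = f K i x" if K: "K \<in> P" and x: "x \<in> K" for K i x
  proof -
    obtain h where h: "h \<in> polys p" "\<forall>x\<in>K. v x $ i = h x" using ex[OF K] by blast
    obtain b c where t: "tri K z b c" using patch_tri[OF K] .
    have "side_trace K (\<lambda>x. v x $ i) x = h x"
      by (rule side_trace_eq[OF t x _ continuous_on_polys[OF h(1)]]) (use h interior_subset in auto)
    moreover have "side_trace K (\<lambda>x. v x $ i) x = f K i x"
      by (rule side_trace_eq[OF t x _ continuous_on_polys[OF piecesD(1)[OF fg K]]]) (rule piecesD(2)[OF fg K])
    ultimately show ?thesis using h x by simp
  qed
  with fg show ?thesis using that by blast
qed

lemma subspace_annihilator: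
  assumes V: "\<And>v. (\<And>i. (\<lambda>x. v x $ i) \<in> V) \<Longrightarrow> \<exists>f g. pieces p v f g"
  shows "fun_space.subspace (div_annihilator p P V)"
proof -
  have PP0: "0 \<in> PP (p - 1) P"
    by (auto simp: PP_def intro!: bexI[OF _ polys_const])
  have PPadd: "q + r \<in> PP (p - 1) P" if "q \<in> PP (p - 1) P" "r \<in> PP (p - 1) P" for q r
  proof -
    obtain Q where Q: "\<And>K. K \<in> P \<Longrightarrow> Q K \<in> polys (p - 1)" "\<And>K x. K \<in> P \<Longrightarrow> x \<in> interior K \<Longrightarrow> q x = Q K x"
      using PP_pieces[of q] \<open>q \<in> _\<close> by metis
    obtain R where R: "\<And>K. K \<in> P \<Longrightarrow> R K \<in> polys (p - 1)" "\<And>K x. K \<in> P \<Longrightarrow> x \<in> interior K \<Longrightarrow> r x = R K x"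
      using PP_pieces[of r] \<open>r \<in> _\<close> by metis
    have "\<exists>g\<in>polys (p - 1). \<forall>x\<in>interior K. (q + r) x = g x" if "K \<in> P" for K
      using Q(2)[OF that] R(2)[OF that] by (intro bexI[OF _ polys_add[OF Q(1)[OF that] R(1)[OF that]]]) simp
    then show ?thesis using that by (auto simp: PP_def)
  qed
  have PPscale: "fun_scale a q \<in> PP (p - 1) P" if q: "q \<in> PP (p - 1) P" for a q
  proof -
    obtain Q where Q: "\<And>K. K \<in> P \<Longrightarrow> Q K \<in> polys (p - 1)" "\<And>K x. K \<in> P \<Longrightarrow> x \<in> interior K \<Longrightarrow> q x = Q K x"
      using PP_pieces[OF q] by metis
    have "\<exists>g\<in>polys (p - 1). \<forall>x\<in>interior K. fun_scale a q x = g x" if "K \<in> P" for K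
      using Q(2)[OF that] by (intro bexI[OF _ polys_cmult[OF Q(1)[OF that], of a]]) (simp add: fun_scale_def)
    then show ?thesis using q by (auto simp: PP_def fun_scale_def)
  qed
  have int: "(\<lambda>x. q x * div_pw P v x) integrable_on \<Union>P"
    if q: "q \<in> PP (p - 1) P" and v: "\<And>i. (\<lambda>x. v x $ i) \<in> V" for q v
  proof -
    obtain f g where "pieces p v f g" using V[OF v] by blast
    moreover obtain Q where "\<And>K. K \<in> P \<Longrightarrow> Q K \<in> polys (p - 1)" "\<And>K x. K \<in> P \<Longrightarrow> x \<in> interior K \<Longrightarrow> q x = Q K x"
      using PP_pieces[OF q] by metis
    ultimately show ?thesis by (intro pairing_formula(1)[where Q = Q] continuous_on_polys[of _ "p - 1"])
  qed
  show ?thesis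
    unfolding fun_space.subspace_def
  proof (intro conjI ballI allI)
    show "0 \<in> div_annihilator p P V" using PP0 by (simp add: div_annihilator_def)
  next
    fix q r assume qr: "q \<in> div_annihilator p P V" "r \<in> div_annihilator p P V"
    then have PP: "q \<in> PP (p - 1) P" "r \<in> PP (p - 1) P" by (simp_all add: div_annihilator_def)
    have "integral (\<Union>P) (\<lambda>x. (q + r) x * div_pw P v x) = 0" if v: "\<And>i. (\<lambda>x. v x $ i) \<in> V" for v
    proof -
      have "integral (\<Union>P) (\<lambda>x. (q + r) x * div_pw P v x)
        = integral (\<Union>P) (\<lambda>x. q x * div_pw P v x) + integral (\<Union>P) (\<lambda>x. r x * div_pw P v x)"
        using Henstock_Kurzweil_Integration.integral_add[OF int[OF PP(1) v] int[OF PP(2) v]]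
        by (simp add: distrib_right)
      then show ?thesis using qr v by (simp add: div_annihilator_def)
    qed
    then show "q + r \<in> div_annihilator p P V" using PPadd[OF PP] by (simp add: div_annihilator_def)
  next
    fix a q assume q: "q \<in> div_annihilator p P V"
    then have PP: "q \<in> PP (p - 1) P" by (simp add: div_annihilator_def)
    have "integral (\<Union>P) (\<lambda>x. fun_scale a q x * div_pw P v x) = 0" if v: "\<And>i. (\<lambda>x. v x $ i) \<in> V" for v
      using q v by (simp add: div_annihilator_def fun_scale_def mult.assoc)
    then show "fun_scale a q \<in> div_annihilator p P V" using PPscale[OF PP] by (simp add: div_annihilator_def)
  qed
qed

lemma subspace_N_CR: "fun_space.subspace (N_CR p P)"
  unfolding N_CR_def by (rule subspace_annihilator) (metis CR0_pieces)

text \<open>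
  A conforming field has no jumps and vanishes on the boundary, so cutting it off to the open triangles
  gives a Crouzeix-Raviart field with the same divergence.
\<close>

lemma N_CR_subset_N_conf: "N_CR p P \<subseteq> N_conf p P"
proof
  fix q assume q: "q \<in> N_CR p P"
  then have qPP: "q \<in> PP (p - 1) P" by (simp add: N_CR_def div_annihilator_def)
  obtain Q where Q: "\<And>K. K \<in> P \<Longrightarrow> Q K \<in> polys (p - 1)" "\<And>K x. K \<in> P \<Longrightarrow> x \<in> interior K \<Longrightarrow> q x = Q K x"
    using PP_pieces[OF qPP] by metis
  have "integral (\<Union>P) (\<lambda>x. q x * div_pw P v x) = 0" if v: "\<And>i. (\<lambda>x. v x $ i) \<in> S0 p P" for v
  proof -
    obtain f g where fg: "pieces p v f g" "\<And>K i x. K \<in> P \<Longrightarrow> x \<in> K \<Longrightarrow> v x $ i = f K i x"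
      using S0_pieces_closed[OF v] by metis
    define w where "w x = (if x \<in> (\<Union>K\<in>P. interior K) then v x else 0)" for x
    have w: "pieces p w f g" using fg(1) by (auto simp: pieces_def w_def)
    have trace: "side_trace K (\<lambda>x. w x $ i) x = v x $ i" if K: "K \<in> P" and x: "x \<in> K" for K i x
    proof -
      obtain b c where t: "tri K z b c" using patch_tri[OF K] .
      have "side_trace K (\<lambda>x. w x $ i) x = f K i x"
        by (rule side_trace_eq[OF t x _ continuous_on_polys[OF piecesD(1)[OF w K]]]) (rule piecesD(2)[OF w K])
      then show ?thesis using fg(2)[OF K x] by simp
    qed
    have seg0: "segment_integral a b h = 0" if "\<And>x. x \<in> closed_segment a b \<Longrightarrow> h x = 0" for a b h
    proof -
      have "integral {0..1} (\<lambda>t. h (linepath a b t)) = integral {0..1::real} (\<lambda>t. 0 :: real)"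
        by (rule Henstock_Kurzweil_Integration.integral_cong) (simp add: that linepath_in_path)
      then show ?thesis by (simp add: segment_integral_def)
    qed
    have "(\<lambda>x. w x $ i) \<in> CR0 p P" for i
    proof -
      have "(\<lambda>x. w x $ i) \<in> PP p P"
        using w by (auto simp: PP_def pieces_def w_def)
      moreover have "v x $ i = 0" if "x \<in> frontier (\<Union>P)" for x
        using v[of i] that by (auto simp: S0_def)
      moreover have "side_trace K (\<lambda>x. w x $ i) x = v x $ i"
        if "K \<in> P" "closed_segment a b edge_of K" "x \<in> closed_segment a b" for x K a b
        using trace[OF that(1) subsetD[OF edge_of_imp_subset[OF that(2)] that(3)]] .
      ultimately show ?thesis
        unfolding CR0_def mem_Collect_eq by (intro conjI allI impI ballI seg0) (auto simp: subset_iff)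
    qed
    then have "integral (\<Union>P) (\<lambda>x. q x * div_pw P w x) = 0"
      using q by (auto simp: N_CR_def div_annihilator_def)
    then show ?thesis
      using pairing_formula(2)[OF fg(1) Q(2)] pairing_formula(2)[OF w Q(2)] continuous_on_polys[OF Q(1)] by simp
  qed
  then show "q \<in> N_conf p P" using qPP by (simp add: N_conf_def div_annihilator_def)
qed

end

lemma CR0_innerD:
  assumes v: "v \<in> CR0 p Ts" and e: "closed_segment a b \<in> edges Ts" "\<not> closed_segment a b \<subseteq> frontier (\<Union>Ts)"
    and K: "K \<in> Ts" "K' \<in> Ts" "K \<noteq> K'" "closed_segment a b edge_of K" "closed_segment a b edge_of K'"
    and q: "q \<in> polys (p - 1)"
  shows "segment_integral a b (\<lambda>x. (side_trace K v x - side_trace K' v x) * q x) = 0"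
proof -
  note CollectD[OF v[unfolded CR0_def], THEN conjunct2, THEN spec, THEN spec, THEN mp, OF e(1), THEN conjunct1, THEN mp, OF e(2)]
  from this[THEN bspec, OF K(1), THEN bspec, OF K(2), THEN mp, THEN bspec, OF _ q] K(3-5)
  show ?thesis by simp
qed

lemma CR0_outerD:
  assumes v: "v \<in> CR0 p Ts" and e: "closed_segment a b \<in> edges Ts" "closed_segment a b \<subseteq> frontier (\<Union>Ts)"
    and K: "K \<in> Ts" "closed_segment a b edge_of K" and q: "q \<in> polys (p - 1)"
  shows "segment_integral a b (\<lambda>x. side_trace K v x * q x) = 0"
  by (rule CollectD[OF v[unfolded CR0_def], THEN conjunct2, THEN spec, THEN spec, THEN mp, OF e(1), THEN conjunct2,
      THEN mp, OF e(2), THEN bspec, OF K(1), THEN mp, OF K(2), THEN bspec, OF q])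

context vertex_star
begin

subsection \<open>Cancellation across the inner edges\<close>

definition outer :: "(real^2) set \<Rightarrow> (real^2) set" where
  "outer K = {y. y extreme_point_of K} - {z}"

definition third :: "(real^2) set \<Rightarrow> real^2 \<Rightarrow> real^2" where
  "third K b = (THE c. tri K z b c)"

lemma outer_eq: "tri K z b c \<Longrightarrow> outer K = {b, c}"
  using tri_extreme tri_distinct unfolding outer_def by blast

lemma third_eq: "tri K z b c \<Longrightarrow> third K b = c"
  unfolding third_def using tri_third_unique by blast

lemma sum_outer: "tri K z b c \<Longrightarrow> (\<Sum>b\<in>outer K. F b) = F b + F c"
  using tri_distinct[of K z b c] by (simp add: outer_eq)

text \<open>
  A triangle of the patch that contains an outer vertex \<open>y\<close> has the edge \<open>[z, y]\<close>, and an inner edge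
  belongs to two triangles.
\<close>

lemma two_triangles_at:
  assumes y: "y \<in> vertices T" "y \<noteq> z" and K: "K \<in> P" "y \<in> K"
  obtains K' c c' where "K' \<in> P" "K \<noteq> K'" "tri K z y c" "tri K' z y c'" "{J\<in>P. y \<in> J} = {K, K'}"
proof -
  obtain c where c: "tri K z y c" by (rule patch_tri_at[OF K y])
  obtain K' c' where K': "K' \<in> P" "K' \<noteq> K" "tri K' z y c'" by (rule neighbour_exists[OF K(1) c])
  have "J = K \<or> J = K'" if J: "J \<in> P" "y \<in> J" for J
  proof -
    obtain d where d: "tri J z y d" by (rule patch_tri_at[OF J y])
    show ?thesis
      using shared_edge_two[OF patchD(1)[OF K(1)] c patchD(1)[OF K'(1)] K'(3) patchD(1)[OF J(1)] d] K'(2)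
      by metis
  qed
  moreover have "y \<in> K'" by (rule tri_vertices(2)[OF K'(3)])
  ultimately have "{J\<in>P. y \<in> J} = {K, K'}" using K K' by blast
  with that c K' show ?thesis by metis
qed

text \<open>
  Double counting: after exchanging the sums, the terms for a fixed \<open>b\<close> come from the two triangles at
  the edge \<open>[z, b]\<close>.
\<close>

lemma sum_inner_edges:
  fixes F :: "(real^2) set \<Rightarrow> real^2 \<Rightarrow> real"
  assumes F: "\<And>K K' b c c'. K \<in> P \<Longrightarrow> K' \<in> P \<Longrightarrow> K \<noteq> K' \<Longrightarrow> tri K z b c \<Longrightarrow> tri K' z b c' \<Longrightarrow> F K b + F K' b = 0"
  shows "(\<Sum>K\<in>P. \<Sum>b\<in>outer K. F K b) = 0"
proof -
  define W where "W = (\<Union>K\<in>P. outer K)"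
  have fin: "finite (outer K)" if "K \<in> P" for K
    using patch_tri[OF that] outer_eq by (metis finite.emptyI finite.insertI)
  then have finW: "finite W" using finite_patch by (auto simp: W_def)
  have "(\<Sum>K\<in>P. \<Sum>b\<in>outer K. F K b) = (\<Sum>K\<in>P. \<Sum>b | b \<in> W \<and> b \<in> outer K. F K b)"
    by (intro sum.cong refl arg_cong2[where f = sum]) (auto simp: W_def)
  also have "\<dots> = (\<Sum>b\<in>W. \<Sum>K | K \<in> P \<and> b \<in> outer K. F K b)"
    by (rule sum.swap_restrict[OF finite_patch finW])
  also have "\<dots> = 0"
  proof (rule sum.neutral, rule ballI)
    fix b assume "b \<in> W"
    then obtain K where K: "K \<in> P" "b \<in> outer K" by (auto simp: W_def)
    then have b: "b extreme_point_of K" "b \<noteq> z" "b \<in> K" by (auto simp: outer_def extreme_point_of_def)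
    have bV: "b \<in> vertices T" using b(1) patchD(1)[OF K(1)] by (auto simp: vertices_def)
    obtain K' c c' where K': "K' \<in> P" "K \<noteq> K'" "tri K z b c" "tri K' z b c'" "{J\<in>P. b \<in> J} = {K, K'}"
      by (rule two_triangles_at[OF bV b(2) K(1) b(3)])
    have "b \<in> outer J \<longleftrightarrow> b \<in> J" if "J \<in> P" for J
      using vertices_extreme[OF bV patchD(1)[OF that]] b(2) by (auto simp: outer_def extreme_point_of_def)
    then have "{J. J \<in> P \<and> b \<in> outer J} = {K, K'}" using K'(5) by blast
    then show "(\<Sum>K | K \<in> P \<and> b \<in> outer K. F K b) = 0"
      using F[OF K(1) K'(1-4)] K'(2) by simp
  qed
  finally show ?thesis .
qed

lemma segment_integral_eq_mean:
  assumes "\<And>x. x \<in> closed_segment a b \<Longrightarrow> h x = h' x"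
  shows "segment_integral a b h = dist a b * edge_mean a b h'"
proof -
  have "integral {0..1} (\<lambda>t. h (linepath a b t)) = integral {0..1} (\<lambda>t. h' (linepath a b t))"
    by (rule Henstock_Kurzweil_Integration.integral_cong) (simp add: assms linepath_in_path)
  then show ?thesis by (simp add: segment_integral_def edge_mean_def)
qed

lemma edge_mean_diff:
  assumes "f \<in> polys k" "g \<in> polys l"
  shows "edge_mean a b (\<lambda>x. f x - g x) = edge_mean a b f - edge_mean a b g"
  unfolding edge_mean_def
  by (intro Henstock_Kurzweil_Integration.integral_diff integrable_continuous_real
      continuous_on_compose2[OF continuous_on_polys[OF assms(1)]]
      continuous_on_compose2[OF continuous_on_polys[OF assms(2)]] continuous_on_linepath) auto

lemma side_trace_piece:
  assumes v: "pieces p v f g" and K: "K \<in> P" and x: "x \<in> K"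
  shows "side_trace K (\<lambda>x. v x $ i) x = f K i x"
proof -
  obtain b c where t: "tri K z b c" using patch_tri[OF K] .
  show ?thesis
    by (rule side_trace_eq[OF t x _ continuous_on_polys[OF piecesD(1)[OF v K]]]) (rule piecesD(2)[OF v K])
qed

lemma CR0_outer_mean:
  assumes v: "pieces p v f g" "(\<lambda>x. v x $ i) \<in> CR0 p P" and K: "K \<in> P" "tri K z b c"
  shows "edge_mean b c (f K i) = 0"
proof -
  have e: "closed_segment b c edge_of K" using tri_edge_iff[OF K(2)] by blast
  then have "closed_segment b c \<in> edges P" using K(1) by (auto simp: edges_def)
  then have "segment_integral b c (\<lambda>x. side_trace K (\<lambda>x. v x $ i) x * 1) = 0"
    by (rule CR0_outerD[OF v(2) _ outer_edge_frontier[OF K] K(1) e polys_const])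
  moreover have "segment_integral b c (\<lambda>x. side_trace K (\<lambda>x. v x $ i) x * 1) = dist b c * edge_mean b c (f K i)"
    by (rule segment_integral_eq_mean)
       (use side_trace_piece[OF v(1) K(1)] tri_closed_segments(3)[OF K(2)] in auto)
  ultimately show ?thesis using tri_distinct(3)[OF K(2)] by simp
qed

lemma CR0_inner_mean:
  assumes v: "pieces p v f g" "(\<lambda>x. v x $ i) \<in> CR0 p P"
    and K: "K \<in> P" "tri K z b c" "K' \<in> P" "tri K' z b c'" "K \<noteq> K'"
  shows "edge_mean z b (f K i) = edge_mean z b (f K' i)"
proof -
  have e: "closed_segment z b edge_of K" "closed_segment z b edge_of K'"
    using tri_edge_iff[OF K(2)] tri_edge_iff[OF K(4)] by blast+
  then have "closed_segment z b \<in> edges P" using K(1) by (auto simp: edges_def)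
  then have "segment_integral z b (\<lambda>x. (side_trace K (\<lambda>x. v x $ i) x - side_trace K' (\<lambda>x. v x $ i) x) * 1) = 0"
    by (rule CR0_innerD[OF v(2) _ inner_edge_not_frontier K(1,3,5) e polys_const])
  moreover have "segment_integral z b (\<lambda>x. (side_trace K (\<lambda>x. v x $ i) x - side_trace K' (\<lambda>x. v x $ i) x) * 1)
      = dist z b * edge_mean z b (\<lambda>x. f K i x - f K' i x)"
    by (rule segment_integral_eq_mean)
       (simp add: side_trace_piece[OF v(1)] K subsetD[OF tri_closed_segments(1)[OF K(2)]] subsetD[OF tri_closed_segments(1)[OF K(4)]])
  ultimately show ?thesis
    using tri_distinct(1)[OF K(2)] edge_mean_diff[OF piecesD(1)[OF v(1) K(1)] piecesD(1)[OF v(1) K(3)]] by simp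
qed

lemma one_on_in_PP: "one_on P \<in> PP k P"
  unfolding one_on_def by (intro piecewise_in_PP polys_const)

text \<open>
  By the divergence theorem the integral is a sum over edges. Outer edges contribute nothing, because the
  mean value of the field vanishes there; on an inner edge the mean values from both sides agree
  and the normals are opposite.
\<close>

lemma one_on_in_N_CR: "one_on P \<in> N_CR p P"
proof -
  have "integral (\<Union>P) (\<lambda>x. one_on P x * div_pw P v x) = 0" if v: "\<And>i. (\<lambda>x. v x $ i) \<in> CR0 p P" for v
  proof -
    obtain f g where fg: "pieces p v f g" using CR0_pieces[OF v] by metis
    define F where "F K b = (\<Sum>i\<in>UNIV. - sgn (wedge (b - z) (third K b - z)) * wedge (b - z) (axis i 1) * edge_mean z b (f K i))"
      for K b
    have "integral (\<Union>P) (\<lambda>x. one_on P x * div_pw P v x) = (\<Sum>K\<in>P. integral K (\<lambda>x. 1 * (\<Sum>i\<in>UNIV. g K i x $ i)))"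
      by (rule pairing_formula(2)[OF fg]) (auto simp: one_on_def piecewise_interior)
    also have "\<dots> = (\<Sum>K\<in>P. \<Sum>b\<in>outer K. F K b)"
    proof (rule sum.cong[OF refl])
      fix K assume K: "K \<in> P"
      obtain b c where t: "tri K z b c" using patch_tri[OF K] .
      have int: "(\<lambda>x. g K i x $ i) integrable_on K" for i
        by (rule set_borel_integral_eq_integral(1)[OF set_integrable_compact_continuous[OF
            tri_topology(1)[OF t] continuous_on_polys[OF piecesD(3)[OF fg K]]]])
      have "integral K (\<lambda>x. 1 * (\<Sum>i\<in>UNIV. g K i x $ i)) = (\<Sum>i\<in>UNIV. integral K (\<lambda>x. g K i x $ i))"
        unfolding mult_1 by (rule Henstock_Kurzweil_Integration.integral_sum) (use int in auto)
      also have "\<dots> = (\<Sum>i\<in>UNIV. - sgn (wedge (b - z) (c - z)) * wedge (b - z) (axis i 1) * edge_mean z b (f K i)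
          - sgn (wedge (c - z) (b - z)) * wedge (c - z) (axis i 1) * edge_mean z c (f K i))"
      proof (rule sum.cong[OF refl])
        fix i :: 2
        show "integral K (\<lambda>x. g K i x $ i) = - sgn (wedge (b - z) (c - z)) * wedge (b - z) (axis i 1) * edge_mean z b (f K i)
            - sgn (wedge (c - z) (b - z)) * wedge (c - z) (axis i 1) * edge_mean z c (f K i)"
          using tri_integral_deriv[OF t piecesD(1)[OF fg K] piecesD(3)[OF fg K] piecesD(4)[OF fg K]
            CR0_outer_mean[OF fg v K t], where d = "axis i 1"]
          by (simp add: inner_axis)
      qed
      also have "\<dots> = F K b + F K c"
        by (simp add: F_def third_eq[OF t] third_eq[OF tri_swap[OF t]] sum.distrib[symmetric])
      also have "\<dots> = (\<Sum>b\<in>outer K. F K b)" by (simp add: sum_outer[OF t])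
      finally show "integral K (\<lambda>x. 1 * (\<Sum>i\<in>UNIV. g K i x $ i)) = (\<Sum>b\<in>outer K. F K b)" .
    qed
    also have "\<dots> = 0"
    proof (rule sum_inner_edges)
      fix K K' b c c' assume K: "K \<in> P" "K' \<in> P" "K \<noteq> K'" "tri K z b c" "tri K' z b c'"
      have "wedge (b - z) (c - z) * wedge (b - z) (c' - z) < 0"
        by (rule opposite_sides[OF patchD(1)[OF K(1)] K(4) patchD(1)[OF K(2)] K(5,3)])
      then have "sgn (wedge (b - z) (c - z)) = - sgn (wedge (b - z) (c' - z))"
        by (auto simp: sgn_real_def mult_less_0_iff)
      then show "F K b + F K' b = 0"
        using CR0_inner_mean[OF fg v K(1,4,2,5,3)]
        by (simp add: F_def third_eq[OF K(4)] third_eq[OF K(5)] sum_negf[symmetric] sum.distrib[symmetric])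
    qed
    finally show ?thesis .
  qed
  then show ?thesis by (simp add: N_CR_def div_annihilator_def one_on_in_PP)
qed

end

section \<open>Critical points\<close>

lemma collinear_wedge: "collinear {a, b, c} \<longleftrightarrow> wedge (b - a) (c - a) = 0"
proof -
  have "collinear {a, b, c} \<longleftrightarrow> collinear {b, a, c}" by (simp add: insert_commute)
  also have "\<dots> \<longleftrightarrow> collinear {0, b - a, c - a}" by (subst collinear_3) auto
  finally show ?thesis unfolding collinear_lemma wedge_eq_0_iff .
qed

lemma line_wedge:
  assumes "is_line L" "a \<in> L" "b \<in> L" "c \<in> L"
  shows "wedge (b - a) (c - a) = 0"
proof -
  have "collinear L" using assms(1) by (simp add: is_line_def collinear_aff_dim)
  then have "collinear {a, b, c}" by (rule collinear_subset) (use assms in auto)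
  then show ?thesis by (simp add: collinear_wedge)
qed

text \<open>
  Two of the three points \<open>a\<close>, \<open>b\<close> and their midpoint lie on the same line, which then contains
  the whole segment.
\<close>

lemma segment_in_two_lines:
  assumes L: "is_line L1" "is_line L2" and s: "closed_segment a b \<subseteq> L1 \<union> L2"
  shows "(a \<in> L1 \<and> b \<in> L1) \<or> (a \<in> L2 \<and> b \<in> L2)"
proof -
  have b: "b = (-1) *\<^sub>R a + 2 *\<^sub>R midpoint a b" and a: "a = (-1) *\<^sub>R b + 2 *\<^sub>R midpoint a b"
    by (simp_all add: midpoint_def scaleR_add_right)
  have "b \<in> L" if "is_line L" "a \<in> L" "midpoint a b \<in> L" for L
    by (subst b, rule mem_affine) (use that in \<open>auto simp: is_line_def\<close>)
  moreover have "a \<in> L" if "is_line L" "b \<in> L" "midpoint a b \<in> L" for L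
    by (subst a, rule mem_affine) (use that in \<open>auto simp: is_line_def\<close>)
  moreover have "a \<in> L1 \<union> L2" "b \<in> L1 \<union> L2" "midpoint a b \<in> L1 \<union> L2"
    using subsetD[OF s midpoint_in_closed_segment] subsetD[OF s ends_in_segment(1)] subsetD[OF s ends_in_segment(2)] by auto
  ultimately show ?thesis using L by blast
qed

context vertex_star
begin

abbreviation "C \<equiv> critical_points T z"

lemma criticalD: "y \<in> C \<Longrightarrow> y \<in> vertices T" "y \<in> C \<Longrightarrow> \<exists>K\<in>P. y \<in> K"
  by (auto simp: critical_points_def patch_vertices_def)

lemma critical_lines:
  assumes "y \<in> C"
  shows "\<exists>L1 L2. is_line L1 \<and> is_line L2 \<and>
    (\<forall>K b c. K \<in> P \<longrightarrow> tri K y b c \<longrightarrow> (y \<in> L1 \<and> b \<in> L1) \<or> (y \<in> L2 \<and> b \<in> L2))"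
proof -
  obtain L1 L2 where L: "is_line L1" "is_line L2"
    "\<And>E. E \<in> patch_edges T z \<Longrightarrow> y extreme_point_of E \<Longrightarrow> E \<subseteq> L1 \<union> L2"
    using assms by (auto simp: critical_points_def)
  have "(y \<in> L1 \<and> b \<in> L1) \<or> (y \<in> L2 \<and> b \<in> L2)" if K: "K \<in> P" and t: "tri K y b c" for K b c
  proof -
    have "closed_segment y b edge_of K" using tri_edge_iff[OF t] by blast
    then have "closed_segment y b \<in> patch_edges T z"
      using patchD(1)[OF K] tri_closed_segments(1)[OF t] K by (auto simp: patch_edges_def edges_def)
    then have "closed_segment y b \<subseteq> L1 \<union> L2"
      by (rule L(3)) (simp add: extreme_point_of_segment)
    then show ?thesis by (rule segment_in_two_lines[OF L(1,2)])
  qed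
  with L(1,2) show ?thesis by blast
qed

text \<open>
  The edge \<open>[y, b]\<close> lies on one of the two lines, and the edges \<open>[y, c]\<close> and \<open>[y, c']\<close> can then only
  lie on the other one.
\<close>

lemma critical_collinear:
  assumes y: "y \<in> C" and K: "K \<in> P" "tri K y b c" "K' \<in> P" "tri K' y b c'"
  shows "wedge (c - y) (c' - y) = 0"
proof -
  obtain L1 L2 where lines: "is_line L1 \<and> is_line L2 \<and>
    (\<forall>K b c. K \<in> P \<longrightarrow> tri K y b c \<longrightarrow> (y \<in> L1 \<and> b \<in> L1) \<or> (y \<in> L2 \<and> b \<in> L2))"
    using critical_lines[OF y] by (elim exE)
  then have L: "is_line L1" "is_line L2"
    "\<And>K b c. K \<in> P \<Longrightarrow> tri K y b c \<Longrightarrow> (y \<in> L1 \<and> b \<in> L1) \<or> (y \<in> L2 \<and> b \<in> L2)"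
    by blast+
  have w: "wedge (b - y) (c - y) \<noteq> 0" "wedge (b - y) (c' - y) \<noteq> 0" using K by (auto simp: tri_def)
  have not: "\<not> (is_line L \<and> y \<in> L \<and> b \<in> L \<and> c \<in> L)" "\<not> (is_line L \<and> y \<in> L \<and> b \<in> L \<and> c' \<in> L)" for L
    using line_wedge[of L y b c] line_wedge[of L y b c'] w by auto
  have "(y \<in> L1 \<and> b \<in> L1) \<or> (y \<in> L2 \<and> b \<in> L2)" "(y \<in> L1 \<and> c \<in> L1) \<or> (y \<in> L2 \<and> c \<in> L2)"
    "(y \<in> L1 \<and> c' \<in> L1) \<or> (y \<in> L2 \<and> c' \<in> L2)"
    using L(3)[OF K(1,2)] L(3)[OF K(1) tri_swap[OF K(2)]] L(3)[OF K(3) tri_swap[OF K(4)]] by blast+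
  then have "(y \<in> L1 \<and> c \<in> L1 \<and> c' \<in> L1) \<or> (y \<in> L2 \<and> c \<in> L2 \<and> c' \<in> L2)"
    using not[of L1] not[of L2] L(1,2) by argo
  then show ?thesis using line_wedge L(1,2) by blast
qed

lemma critical_ray:
  assumes y: "y \<in> C" and K: "K \<in> P" "tri K y b c" "K' \<in> P" "tri K' y b c'" "K \<noteq> K'"
  obtains r where "r < 0" "c' - y = r *\<^sub>R (c - y)"
proof -
  have "c - y \<noteq> 0" "c' - y \<noteq> 0" using tri_distinct(2)[OF K(2)] tri_distinct(2)[OF K(4)] by auto
  then obtain r where r: "c' - y = r *\<^sub>R (c - y)"
    using critical_collinear[OF y K(1-4)] unfolding wedge_eq_0_iff by blast
  have "wedge (b - y) (c - y) * wedge (b - y) (c' - y) < 0"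
    by (rule opposite_sides[OF patchD(1)[OF K(1)] K(2) patchD(1)[OF K(3)] K(4,5)])
  moreover have "wedge (b - y) (c' - y) = r * wedge (b - y) (c - y)"
    unfolding r by (simp add: wedge_def algebra_simps)
  ultimately have "r * (wedge (b - y) (c - y))\<^sup>2 < 0" by (simp add: power2_eq_square mult_ac)
  then have "r < 0" by (simp add: mult_less_0_iff)
  then show ?thesis using r by (rule that)
qed

end

section \<open>Critical functions\<close>

text \<open>
  The coefficients of the two directional derivatives are the components of the gradients of the
  barycentric coordinates for \<open>b\<close> and \<open>c\<close>.
\<close>

lemma trace_in_directions:
  fixes G :: "2 \<Rightarrow> real^2"
  assumes "tri K y b c"
  shows "(\<Sum>i\<in>UNIV. G i $ i)
    = (\<Sum>i\<in>UNIV. wedge (axis i 1) (c - y) / wedge (b - y) (c - y) * (G i \<bullet> (b - y)))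
    + (\<Sum>i\<in>UNIV. wedge (axis i 1) (b - y) / wedge (c - y) (b - y) * (G i \<bullet> (c - y)))"
proof -
  define w where "w = wedge (b - y) (c - y)"
  have w: "w \<noteq> 0" "wedge (c - y) (b - y) = - w" using assms by (auto simp: tri_def w_def wedge_swap[of "b - y"])
  have "G i $ i * w = wedge (axis i 1) (c - y) * (G i \<bullet> (b - y)) - wedge (axis i 1) (b - y) * (G i \<bullet> (c - y))" for i
    using exhaust_2[of i] by (auto simp: w_def wedge_def inner_vec_def sum_2 axis_def algebra_simps)
  then have "G i $ i = (wedge (axis i 1) (c - y) * (G i \<bullet> (b - y)) - wedge (axis i 1) (b - y) * (G i \<bullet> (c - y))) / w" for i
    using w(1) by (metis nonzero_mult_div_cancel_right)
  then have eq: "G i $ i = wedge (axis i 1) (c - y) / w * (G i \<bullet> (b - y)) + wedge (axis i 1) (b - y) / (- w) * (G i \<bullet> (c - y))" for i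
    by (simp add: diff_divide_distrib)
  show ?thesis unfolding w_def[symmetric] w(2) sum.distrib[symmetric] by (rule sum.cong[OF refl eq])
qed

lemma tangential_derivative_eq:
  fixes f g :: "real^2 \<Rightarrow> real"
  assumes f: "(f has_derivative (\<lambda>d. u \<bullet> d)) (at a)" and g: "(g has_derivative (\<lambda>d. w \<bullet> d)) (at a)"
    and eq: "\<And>x. x \<in> closed_segment a b \<Longrightarrow> f x = g x"
  shows "u \<bullet> (b - a) = w \<bullet> (b - a)"
proof -
  define h where "h t = f (a + t *\<^sub>R (b - a)) - g (a + t *\<^sub>R (b - a))" for t
  have line: "((\<lambda>t. a + t *\<^sub>R (b - a)) has_derivative (\<lambda>t. t *\<^sub>R (b - a))) (at 0)"
    by (auto intro!: derivative_eq_intros)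
  have "((\<lambda>t. f (a + t *\<^sub>R (b - a))) has_derivative (\<lambda>t. u \<bullet> (t *\<^sub>R (b - a)))) (at 0)"
    by (rule has_derivative_compose[OF line]) (use f in simp)
  moreover have "((\<lambda>t. g (a + t *\<^sub>R (b - a))) has_derivative (\<lambda>t. w \<bullet> (t *\<^sub>R (b - a)))) (at 0)"
    by (rule has_derivative_compose[OF line]) (use g in simp)
  ultimately have hd: "(h has_derivative (\<lambda>t. u \<bullet> (t *\<^sub>R (b - a)) - w \<bullet> (t *\<^sub>R (b - a)))) (at 0)"
    unfolding h_def by (rule has_derivative_diff)
  have "(h has_field_derivative (u \<bullet> (b - a) - w \<bullet> (b - a))) (at 0)"
    unfolding has_field_derivative_def by (rule has_derivative_eq_rhs[OF hd]) (auto simp: algebra_simps)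
  then have "((\<lambda>t. (h (0 + t) - h 0) / t) \<longlongrightarrow> u \<bullet> (b - a) - w \<bullet> (b - a)) (at 0)"
    by (simp only: DERIV_def)
  then have lim: "((\<lambda>t. (h (0 + t) - h 0) / t) \<longlongrightarrow> u \<bullet> (b - a) - w \<bullet> (b - a)) (at_right 0)"
    by (rule tendsto_within_subset) simp
  have h0: "h t = 0" if "0 \<le> t" "t \<le> 1" for t
  proof -
    have "a + t *\<^sub>R (b - a) \<in> closed_segment a b"
      unfolding in_segment using that by (intro exI[of _ t]) (simp add: algebra_simps)
    then show ?thesis using eq by (simp add: h_def)
  qed
  have "\<forall>\<^sub>F t in at_right (0::real). (h (0 + t) - h 0) / t = 0"
    by (rule eventually_mono[OF eventually_at_right_real[of 0 1]]) (auto simp: h0)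
  then have "((\<lambda>t. (h (0 + t) - h 0) / t) \<longlongrightarrow> 0) (at_right 0)"
    by (rule tendsto_eventually)
  then have "u \<bullet> (b - a) - w \<bullet> (b - a) = 0"
    using tendsto_unique[OF _ lim] by simp
  then show ?thesis by simp
qed

context vertex_star
begin

text \<open>
  The critical function of \<open>y\<close> only depends on the signs of the triangles at \<open>y\<close>, so each critical
  point can be given its own sign function.
\<close>

definition local_sign :: "real^2 \<Rightarrow> ((real^2) set \<Rightarrow> real) \<Rightarrow> bool" where
  "local_sign y \<tau> \<longleftrightarrow> (\<forall>K\<in>P. y \<in> K \<longrightarrow> \<tau> K \<in> {-1, 1}) \<and>
     (\<forall>K\<in>P. \<forall>K'\<in>P. \<forall>b c c'. K \<noteq> K' \<longrightarrow> tri K y b c \<longrightarrow> tri K' y b c' \<longrightarrow> \<tau> K = - \<tau> K')"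

lemma sign_function_local: "sign_function T z \<sigma> \<Longrightarrow> y \<in> C \<Longrightarrow> local_sign y \<sigma>"
proof -
  assume \<sigma>: "sign_function T z \<sigma>" and y: "y \<in> C"
  have "\<sigma> K = - \<sigma> K'" if K: "K \<in> P" "K' \<in> P" "K \<noteq> K'" "tri K y b c" "tri K' y b c'" for K K' b c c'
  proof -
    have e: "closed_segment y b edge_of K" "closed_segment y b edge_of K'"
      using tri_edge_iff[OF K(4)] tri_edge_iff[OF K(5)] by blast+
    have "y \<in> closed_segment y b \<inter> C" using y by simp
    then have "closed_segment y b \<inter> C \<noteq> {}" by (rule ex_in_conv[THEN iffD1, OF exI])
    with K(3) e have "K \<noteq> K' \<and> closed_segment y b edge_of K \<and> closed_segment y b edge_of K' \<and> closed_segment y b \<inter> C \<noteq> {}"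
      by (intro conjI)
    then show ?thesis
      by (rule \<sigma>[unfolded sign_function_def, THEN conjunct2, THEN bspec, OF K(1), THEN bspec, OF K(2),
        THEN spec, THEN mp])
  qed
  moreover have "\<sigma> K \<in> {-1, 1}" if "K \<in> P" for K
    using \<sigma>[unfolded sign_function_def, THEN conjunct1, THEN bspec, OF that] .
  ultimately show ?thesis unfolding local_sign_def by blast
qed

text \<open>
  With lines \<open>L\<^sub>1\<close>, \<open>L\<^sub>2\<close> through \<open>y\<close>, every triangle at \<open>y\<close> has one edge on each line, and
  orienting it from \<open>L\<^sub>1\<close> to \<open>L\<^sub>2\<close> gives signs that flip across every edge at \<open>y\<close>.
\<close>

lemma local_sign_exists:
  assumes y: "y \<in> C"
  shows "\<exists>\<tau>. local_sign y \<tau>"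
proof -
  obtain L1 L2 where lines: "is_line L1 \<and> is_line L2 \<and>
    (\<forall>K b c. K \<in> P \<longrightarrow> tri K y b c \<longrightarrow> (y \<in> L1 \<and> b \<in> L1) \<or> (y \<in> L2 \<and> b \<in> L2))"
    using critical_lines[OF y] by (elim exE)
  then have L: "is_line L1" "is_line L2"
    "\<And>K b c. K \<in> P \<Longrightarrow> tri K y b c \<Longrightarrow> (y \<in> L1 \<and> b \<in> L1) \<or> (y \<in> L2 \<and> b \<in> L2)"
    by blast+
  have not: "\<not> (b \<in> L \<and> c \<in> L)" if "tri K y b c" "is_line L" "y \<in> L" for K b c L
    using line_wedge[of L y b c] that by (auto simp: tri_def)
  have cross: "y \<in> L1 \<and> y \<in> L2 \<and> (b \<in> L1 \<longleftrightarrow> b \<notin> L2) \<and> (b \<in> L1 \<longleftrightarrow> c \<in> L2) \<and> (c \<in> L1 \<longleftrightarrow> b \<in> L2)"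
    if K: "K \<in> P" "tri K y b c" for K b c
  proof -
    note L(3)[OF K] L(3)[OF K(1) tri_swap[OF K(2)]] not[OF K(2) L(1)] not[OF K(2) L(2)]
    moreover have "b \<notin> L1 \<or> b \<notin> L2"
    proof (rule ccontr)
      assume *: "\<not> ?thesis"
      from this not[OF K(2) L(1)] not[OF K(2) L(2)] L(3)[OF K(1) tri_swap[OF K(2)]] L(3)[OF K]
      show False by argo
    qed
    ultimately show ?thesis by argo
  qed
  \<comment> \<open>Each triangle is oriented so that its edge on \<open>L1\<close> comes first.\<close>
  define \<tau> where "\<tau> K = (SOME s. \<exists>b c. tri K y b c \<and> b \<in> L1 \<and> s = sgn (wedge (b - y) (c - y)))" for K
  have \<tau>: "\<tau> K = sgn (wedge (b - y) (c - y))" if K: "K \<in> P" "tri K y b c" "b \<in> L1" for K b c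
    unfolding \<tau>_def
  proof (rule some_equality)
    show "\<exists>b' c'. tri K y b' c' \<and> b' \<in> L1 \<and> sgn (wedge (b - y) (c - y)) = sgn (wedge (b' - y) (c' - y))"
      using K by blast
  next
    fix s assume "\<exists>b c. tri K y b c \<and> b \<in> L1 \<and> s = sgn (wedge (b - y) (c - y))"
    then obtain b' c' where b': "tri K y b' c'" "b' \<in> L1" "s = sgn (wedge (b' - y) (c' - y))" by blast
    have "b' = b \<or> b' = c" "c' = b \<or> c' = c" "b' \<noteq> c'"
      using tri_extreme[OF b'(1), of b'] tri_extreme[OF b'(1), of c'] tri_extreme[OF K(2), of b'] tri_extreme[OF K(2), of c']
        tri_distinct[OF b'(1)] by auto
    moreover have "c \<notin> L1" using cross[OF K(1,2)] K(3) by blast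
    ultimately show "s = sgn (wedge (b - y) (c - y))" using b' by auto
  qed
  have "\<tau> K \<in> {-1, 1}" if K: "K \<in> P" "y \<in> K" for K
  proof -
    have "y extreme_point_of K" by (rule vertices_extreme[OF criticalD(1)[OF y] patchD(1)[OF K(1)] K(2)])
    then obtain b c where t: "tri K y b c" by (rule simplex_tri_at[OF simplices[OF patchD(1)[OF K(1)]]])
    show ?thesis
    proof (cases "b \<in> L1")
      case True
      then show ?thesis using \<tau>[OF K(1) t] t by (auto simp: tri_def sgn_real_def)
    next
      case False
      then have "c \<in> L1" using cross[OF K(1) t] by blast
      then show ?thesis using \<tau>[OF K(1) tri_swap[OF t]] tri_swap[OF t] by (auto simp: tri_def sgn_real_def)
    qed
  qed
  moreover have "\<tau> K = - \<tau> K'" if K: "K \<in> P" "K' \<in> P" "K \<noteq> K'" "tri K y b c" "tri K' y b c'" for K K' b c c'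
  proof -
    have "wedge (b - y) (c - y) * wedge (b - y) (c' - y) < 0"
      by (rule opposite_sides[OF patchD(1)[OF K(1)] K(4) patchD(1)[OF K(2)] K(5,3)])
    then have s: "sgn (wedge (b - y) (c - y)) = - sgn (wedge (b - y) (c' - y))"
      by (auto simp: sgn_real_def mult_less_0_iff)
    show ?thesis
    proof (cases "b \<in> L1")
      case True
      then show ?thesis using \<tau>[OF K(1,4)] \<tau>[OF K(2,5)] s by simp
    next
      case False
      then have "c \<in> L1" "c' \<in> L1" using cross[OF K(1,4)] cross[OF K(2,5)] by blast+
      then have "\<tau> K = sgn (wedge (c - y) (b - y))" "\<tau> K' = sgn (wedge (c' - y) (b - y))"
        using \<tau>[OF K(1) tri_swap[OF K(4)]] \<tau>[OF K(2) tri_swap[OF K(5)]] by blast+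
      then show ?thesis using s by (simp add: wedge_swap[of "c - y"] wedge_swap[of "c' - y"] sgn_minus)
    qed
  qed
  ultimately have "local_sign y \<tau>" unfolding local_sign_def by blast
  then show ?thesis by blast
qed

lemma tri_at_vertex:
  assumes "K \<in> P" "y \<in> K" "y \<in> vertices T"
  obtains b c where "tri K y b c"
proof -
  have "y extreme_point_of K" by (rule vertices_extreme[OF assms(3) patchD(1)[OF assms(1)] assms(2)])
  then show ?thesis using simplex_tri_at[OF simplices[OF patchD(1)[OF assms(1)]]] that by blast
qed

lemma critical_piece_polys:
  assumes K: "K \<in> P" and y: "y \<in> vertices T"
  shows "(\<lambda>x. if y \<in> K then \<tau> K / measure lebesgue K * poly (jacobi_poly 0 2 n) (1 - 2 * barycentric K y x) else 0) \<in> polys n"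
proof (cases "y \<in> K")
  case True
  obtain b c where t: "tri K y b c" by (rule tri_at_vertex[OF K True y])
  have "(\<lambda>x. 1 + (-2) * bary y b c x) \<in> polys 1"
    by (intro polys_add polys_const polys_cmult bary_polys)
  then have "(\<lambda>x. poly (jacobi_poly 0 2 n) (1 + (-2) * bary y b c x)) \<in> polys n"
    by (rule polys_poly_compose) (simp add: jacobi_poly_02)
  from polys_cmult[OF this, of "\<tau> K / measure lebesgue K"]
  show ?thesis using True by (simp add: barycentric_eq_bary[OF t])
qed (simp add: polys_const)

lemma critical_function_in_PP: "y \<in> vertices T \<Longrightarrow> critical_function T z \<tau> n y \<in> PP n P"
  unfolding critical_function_def by (rule piecewise_in_PP) (rule critical_piece_polys)

text \<open>
  The area in the denominator of the critical function cancels the area in the reproducing property, so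
  that every triangle at \<open>y\<close> enters with its sign only.
\<close>

lemma critical_pairing:
  assumes v: "pieces p v f g" and y: "y \<in> vertices T"
  shows "integral (\<Union>P) (\<lambda>x. critical_function T z \<tau> (p - 1) y x * div_pw P v x)
    = poly_int ([:1,1:] * jacobi_poly 0 2 (p - 1)) / 2 * (\<Sum>K | K \<in> P \<and> y \<in> K. \<tau> K * (\<Sum>i\<in>UNIV. g K i y $ i))"
proof -
  let ?J = "jacobi_poly 0 2 (p - 1)"
  let ?k = "poly_int ([:1,1:] * ?J) / 2"
  let ?Q = "\<lambda>K x. if y \<in> K then \<tau> K / measure lebesgue K * poly ?J (1 - 2 * barycentric K y x) else 0"
  have "integral (\<Union>P) (\<lambda>x. critical_function T z \<tau> (p - 1) y x * div_pw P v x)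
    = (\<Sum>K\<in>P. integral K (\<lambda>x. ?Q K x * (\<Sum>i\<in>UNIV. g K i x $ i)))"
    by (rule pairing_formula(2)[OF v])
       (auto simp: critical_function_def piecewise_interior intro!: continuous_on_polys[OF critical_piece_polys[OF _ y]])
  also have "\<dots> = (\<Sum>K\<in>P. if y \<in> K then ?k * (\<tau> K * (\<Sum>i\<in>UNIV. g K i y $ i)) else 0)"
  proof (rule sum.cong[OF refl])
    fix K assume K: "K \<in> P"
    show "integral K (\<lambda>x. ?Q K x * (\<Sum>i\<in>UNIV. g K i x $ i)) = (if y \<in> K then ?k * (\<tau> K * (\<Sum>i\<in>UNIV. g K i y $ i)) else 0)"
    proof (cases "y \<in> K")
      case True
      obtain b c where t: "tri K y b c" by (rule tri_at_vertex[OF K True y])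
      have t': "K = convex hull {b, y, c}" "wedge (y - b) (c - b) \<noteq> 0"
        using tri_exchange[OF t] by (auto simp: tri_def)
      have m: "measure lebesgue K = \<bar>wedge (y - b) (c - b)\<bar> / 2" unfolding t'(1) by (rule measure_triangle)
      have D: "(\<lambda>x. \<Sum>i\<in>UNIV. g K i x $ i) \<in> polys (p - 1)"
        by (intro polys_sum piecesD(3)[OF v K])
      have "integral K (\<lambda>x. ?Q K x * (\<Sum>i\<in>UNIV. g K i x $ i))
        = integral K (\<lambda>x. \<tau> K / measure lebesgue K * (poly ?J (1 - 2 * bary y b c x) * (\<Sum>i\<in>UNIV. g K i x $ i)))"
        using True by (simp add: barycentric_eq_bary[OF t] mult.assoc)
      also have "\<dots> = \<tau> K / measure lebesgue K * integral K (\<lambda>x. poly ?J (1 - 2 * bary y b c x) * (\<Sum>i\<in>UNIV. g K i x $ i))"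
        by (rule integral_mult_right)
      also have "integral K (\<lambda>x. poly ?J (1 - 2 * bary y b c x) * (\<Sum>i\<in>UNIV. g K i x $ i))
        = poly_int ([:1,1:] * ?J) / 4 * \<bar>wedge (y - b) (c - b)\<bar> * (\<Sum>i\<in>UNIV. g K i y $ i)"
        unfolding t'(1) by (rule reproducing_property[OF t'(2) D[unfolded t'(1)]])
      also have "\<tau> K / measure lebesgue K * \<dots> = ?k * (\<tau> K * (\<Sum>i\<in>UNIV. g K i y $ i))"
        using t'(2) by (simp add: m)
      finally show ?thesis using True by simp
    qed simp
  qed
  also have "\<dots> = (\<Sum>K | K \<in> P \<and> y \<in> K. ?k * (\<tau> K * (\<Sum>i\<in>UNIV. g K i y $ i)))"
    by (rule sum.inter_filter[OF finite_patch, symmetric])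
  finally show ?thesis by (simp only: sum_distrib_left)
qed

text \<open>
  The quotient is the derivative of the barycentric coordinate for \<open>b\<close> in direction \<open>e\<close>. At a critical
  point \<open>c - y\<close> and \<open>c' - y\<close> are parallel, so both triangles have the same gradient.
\<close>

lemma critical_ratio:
  assumes y: "y \<in> C" and K: "K \<in> P" "tri K y b c" "K' \<in> P" "tri K' y b c'" "K \<noteq> K'"
  shows "wedge e (c' - y) / wedge (b - y) (c' - y) = wedge e (c - y) / wedge (b - y) (c - y)"
proof -
  obtain r where r: "r < 0" "c' - y = r *\<^sub>R (c - y)" by (rule critical_ray[OF y K])
  have "wedge u (r *\<^sub>R w) = r * wedge u w" for u w by (simp add: wedge_def algebra_simps)
  then show ?thesis using r by simp
qed

text \<open>
  The divergence of a conforming field at \<open>y\<close> splits into derivatives along the edges at \<open>y\<close>. Such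
  a derivative vanishes on a boundary edge and is the same on both sides of an inner edge; at a
  critical point so is its coefficient, whence the alternating signs cancel everything.
\<close>

lemma critical_function_in_N_conf:
  assumes y: "y \<in> C" and \<tau>: "local_sign y \<tau>"
  shows "critical_function T z \<tau> (p - 1) y \<in> N_conf p P"
proof -
  have yV: "y \<in> vertices T" by (rule criticalD[OF y])
  have "integral (\<Union>P) (\<lambda>x. critical_function T z \<tau> (p - 1) y x * div_pw P v x) = 0"
    if v: "\<And>i. (\<lambda>x. v x $ i) \<in> S0 p P" for v
  proof -
    obtain f g where fg: "pieces p v f g" "\<And>K i x. K \<in> P \<Longrightarrow> x \<in> K \<Longrightarrow> v x $ i = f K i x"
      using S0_pieces_closed[OF v] by metis
    have inner: "g K i y \<bullet> (b - y) = g K' i y \<bullet> (b - y)"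
      if "K \<in> P" "tri K y b c" "K' \<in> P" "tri K' y b c'" for K K' b c c' i
    proof (rule tangential_derivative_eq[OF piecesD(4)[OF fg(1) that(1)] piecesD(4)[OF fg(1) that(3)]])
      fix x assume x: "x \<in> closed_segment y b"
      show "f K i x = f K' i x"
        using fg(2)[OF that(1) subsetD[OF tri_closed_segments(1)[OF that(2)] x], of i]
          fg(2)[OF that(3) subsetD[OF tri_closed_segments(1)[OF that(4)] x], of i] by simp
    qed
    have outer: "g K i y \<bullet> (c - y) = 0" if "K \<in> P" "tri K z y c" for K c i
    proof -
      have "g K i y \<bullet> (c - y) = 0 \<bullet> (c - y)"
      proof (rule tangential_derivative_eq[OF piecesD(4)[OF fg(1) that(1)], where g = "\<lambda>x. 0"])
        fix x assume x: "x \<in> closed_segment y c"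
        have "v x $ i = 0" using v[of i] subsetD[OF outer_edge_frontier[OF that] x] by (simp add: S0_def)
        then show "f K i x = 0"
          using fg(2)[OF that(1) subsetD[OF tri_closed_segments(3)[OF that(2)] x], of i] by simp
      qed simp
      then show ?thesis by simp
    qed
    have "(\<Sum>K | K \<in> P \<and> y \<in> K. \<tau> K * (\<Sum>i\<in>UNIV. g K i y $ i)) = 0"
    proof (cases "y = z")
      case True
      define F where "F K b = \<tau> K * (\<Sum>i\<in>UNIV. wedge (axis i 1) (third K b - z) / wedge (b - z) (third K b - z) * (g K i z \<bullet> (b - z)))"
        for K b
      have "(\<Sum>K | K \<in> P \<and> y \<in> K. \<tau> K * (\<Sum>i\<in>UNIV. g K i y $ i)) = (\<Sum>K\<in>P. \<Sum>b\<in>outer K. F K b)"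
      proof (rule sum.cong)
        show "{K. K \<in> P \<and> y \<in> K} = P" using patchD(2) True by blast
        fix K assume K: "K \<in> P"
        obtain b c where t: "tri K z b c" using patch_tri[OF K] .
        show "\<tau> K * (\<Sum>i\<in>UNIV. g K i y $ i) = (\<Sum>b\<in>outer K. F K b)"
          unfolding sum_outer[OF t] F_def third_eq[OF t] third_eq[OF tri_swap[OF t]] True
            trace_in_directions[OF t] distrib_left ..
      qed
      also have "\<dots> = 0"
      proof (rule sum_inner_edges)
        fix K K' b c c' assume K: "K \<in> P" "K' \<in> P" "K \<noteq> K'" "tri K z b c" "tri K' z b c'"
        have sign: "\<tau> K = - \<tau> K'" using \<tau> K unfolding local_sign_def True by blast
        show "F K b + F K' b = 0"
          unfolding F_def third_eq[OF K(4)] third_eq[OF K(5)]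
            critical_ratio[OF y[unfolded True] K(1,4,2,5,3)] inner[unfolded True, OF K(1,4,2,5)] sign
          by simp
      qed
      finally show ?thesis .
    next
      case False
      obtain K where K: "K \<in> P" "y \<in> K" using criticalD(2)[OF y] by blast
      obtain K' c c' where K': "K' \<in> P" "K \<noteq> K'" "tri K z y c" "tri K' z y c'" "{J\<in>P. y \<in> J} = {K, K'}"
        by (rule two_triangles_at[OF yV False K])
      have t: "tri K y z c" "tri K' y z c'" using tri_exchange K'(3,4) by blast+
      have "\<tau> K = - \<tau> K'" using \<tau> K(1) K'(1,2) t unfolding local_sign_def by blast
      moreover have "(\<Sum>i\<in>UNIV. g K i y $ i) = (\<Sum>i\<in>UNIV. g K' i y $ i)"
        unfolding trace_in_directions[OF t(1), of "\<lambda>i. g K i y"] trace_in_directions[OF t(2), of "\<lambda>i. g K' i y"]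
          outer[OF K(1) K'(3)] outer[OF K'(1,4)] critical_ratio[OF y K(1) t(1) K'(1) t(2) K'(2)]
          inner[OF K(1) t(1) K'(1) t(2)] by simp
      ultimately show ?thesis using K'(2,5) by simp
    qed
    then show ?thesis unfolding critical_pairing[OF fg(1) yV] by simp
  qed
  then show ?thesis
    using critical_function_in_PP[OF yV] by (simp add: N_conf_def div_annihilator_def)
qed

end

section \<open>The non-conforming test functions\<close>

definition bary_grad :: "real^2 \<Rightarrow> real^2 \<Rightarrow> real^2 \<Rightarrow> real^2" where
  "bary_grad a b c = vec2 ((c - b)$2 / wedge (a - b) (c - b), - (c - b)$1 / wedge (a - b) (c - b))"

lemma bary_grad_inner: "bary_grad a b c \<bullet> e = wedge e (c - b) / wedge (a - b) (c - b)"
proof -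
  have "bary_grad a b c \<bullet> e = (c - b)$2 / wedge (a - b) (c - b) * e$1 + (- (c - b)$1 / wedge (a - b) (c - b)) * e$2"
    by (simp add: bary_grad_def inner_vec_def sum_2)
  also have "\<dots> = ((c - b)$2 * e$1 + (- (c - b)$1) * e$2) / wedge (a - b) (c - b)"
    by (simp only: add_divide_distrib times_divide_eq_left)
  also have "(c - b)$2 * e$1 + (- (c - b)$1) * e$2 = wedge e (c - b)"
    by (simp add: wedge_def algebra_simps)
  finally show ?thesis .
qed

lemma bary_has_derivative: "(bary a b c has_derivative (\<lambda>e. bary_grad a b c \<bullet> e)) (at x)"
proof -
  have "bary a b c y = bary_grad a b c \<bullet> y + bary a b c 0" for y
    using bary_diff[of a b c 0 1 y] by (simp add: bary_grad_inner)
  then have "bary a b c = (\<lambda>y. bary_grad a b c \<bullet> y + bary a b c 0)" by blast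
  moreover have "((\<lambda>y. bary_grad a b c \<bullet> y + bary a b c 0) has_derivative (\<lambda>e. bary_grad a b c \<bullet> e)) (at x)"
    by (auto intro!: derivative_eq_intros)
  ultimately show ?thesis by simp
qed

definition ridge :: "real poly \<Rightarrow> real^2 \<Rightarrow> real^2 \<Rightarrow> real^2 \<Rightarrow> real^2 \<Rightarrow> real" where
  "ridge L a b c x = poly L (1 - 2 * bary a b c x)"

definition dridge :: "real poly \<Rightarrow> real^2 \<Rightarrow> real^2 \<Rightarrow> real^2 \<Rightarrow> real^2 \<Rightarrow> real^2" where
  "dridge L a b c x = (- 2 * poly (pderiv L) (1 - 2 * bary a b c x)) *\<^sub>R bary_grad a b c"

lemma ridge_affine_polys: "(\<lambda>x. 1 - 2 * bary a b c x) \<in> polys 1"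
proof -
  have "(\<lambda>x. 1 + (-2) * bary a b c x) \<in> polys 1"
    by (intro polys_add polys_const polys_cmult bary_polys)
  then show ?thesis by simp
qed

lemma ridge_polys: "degree L \<le> k \<Longrightarrow> ridge L a b c \<in> polys k"
  unfolding ridge_def[abs_def] by (rule polys_poly_compose[OF ridge_affine_polys])

lemma dridge_polys: "degree L \<le> k \<Longrightarrow> (\<lambda>x. dridge L a b c x $ j) \<in> polys (k - 1)"
proof -
  assume "degree L \<le> k"
  then have "(\<lambda>x. poly (pderiv L) (1 - 2 * bary a b c x)) \<in> polys (k - 1)"
    by (intro polys_poly_compose ridge_affine_polys) (simp add: degree_pderiv)
  from polys_cmult[OF this, of "- 2 * bary_grad a b c $ j"] show ?thesis
    by (simp add: dridge_def mult_ac)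
qed

lemma ridge_has_derivative: "(ridge L a b c has_derivative (\<lambda>e. dridge L a b c x \<bullet> e)) (at x)"
proof -
  have "((\<lambda>x. 1 - 2 * bary a b c x) has_derivative (\<lambda>e. - 2 * (bary_grad a b c \<bullet> e))) (at x)"
    by (auto intro!: derivative_eq_intros bary_has_derivative)
  moreover have "(poly L has_derivative (\<lambda>s. poly (pderiv L) (1 - 2 * bary a b c x) * s)) (at (1 - 2 * bary a b c x))"
    using poly_DERIV[of L "1 - 2 * bary a b c x"] by (simp add: has_field_derivative_def)
  ultimately have "((\<lambda>x. poly L (1 - 2 * bary a b c x)) has_derivative
      (\<lambda>e. poly (pderiv L) (1 - 2 * bary a b c x) * (- 2 * (bary_grad a b c \<bullet> e)))) (at x)"
    by (rule has_derivative_compose)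
  then show ?thesis by (simp add: ridge_def[abs_def] dridge_def mult_ac)
qed

text \<open>
  Along an edge that ends in \<open>a\<close>, the coordinate runs linearly between \<open>1\<close> and \<open>0\<close>, so that the
  function restricts to \<open>L\<close> up to reparametrisation.
\<close>

lemma edge_mean_ridge:
  assumes t: "tri K a b c" and e: "e = b \<or> e = c"
    and L: "degree L = p" "0 < p" "\<And>x. poly L (-x) = - poly L x" "\<And>Q. degree Q < p \<Longrightarrow> poly_int (L * Q) = 0"
    and q: "q \<in> polys (p - 1)"
  shows "edge_mean a e (\<lambda>x. ridge L a b c x * q x) = 0" "edge_mean e a (\<lambda>x. ridge L a b c x * q x) = 0"
proof -
  obtain H where H: "degree H \<le> p - 1" "\<And>t. q (linepath a e t) = poly H t" using polys_on_line[OF q] by metis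
  define H' where "H' = H \<circ>\<^sub>p [:1/2,-1/2:]"
  have H': "degree H' < p" "poly H' (1 - 2 * s) = poly H s" for s
    using H(1) L(2) by (simp_all add: H'_def degree_pcompose poly_pcompose diff_divide_distrib)
  have "ridge L a b c (linepath a e s) = - poly L (1 - 2 * s)" for s
  proof -
    have "bary a b c (linepath a e s) = 1 - s"
      unfolding linepath_def bary_affine using bary_vertex[OF t] e by auto
    then have "1 - 2 * bary a b c (linepath a e s) = - (1 - 2 * s)" by simp
    then show ?thesis unfolding ridge_def by (simp only: L(3))
  qed
  then have "edge_mean a e (\<lambda>x. ridge L a b c x * q x) = integral {0..1} (\<lambda>s. poly (smult (-1) (L * H')) (1 - 2 * s))"
    unfolding edge_mean_def by (simp add: H(2) H'(2))
  also have "\<dots> = 0" using L(4)[OF H'(1)] by (simp only: integral_poly_01 poly_int_smult mult_zero_right div_0)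
  finally show 1: "edge_mean a e (\<lambda>x. ridge L a b c x * q x) = 0" .
  have "continuous_on UNIV (\<lambda>x. ridge L a b c x * q x)"
    by (intro continuous_on_mult continuous_on_polys[OF q] continuous_on_polys[OF ridge_polys[OF eq_refl[OF L(1)]]])
  then show "edge_mean e a (\<lambda>x. ridge L a b c x * q x) = 0" using 1 edge_mean_commute by metis
qed

context vertex_star
begin

lemma finite_critical: "finite C"
proof -
  have "finite {y. y extreme_point_of K}" if K: "K \<in> P" for K
  proof -
    obtain b c where t: "tri K z b c" using patch_tri[OF K] .
    have "{y. y extreme_point_of K} \<subseteq> {z, b, c}" using tri_extreme[OF t] by auto
    then show ?thesis by (rule finite_subset) simp
  qed
  then have "finite (\<Union>K\<in>P. {y. y extreme_point_of K})" using finite_patch by blast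
  moreover have "C \<subseteq> (\<Union>K\<in>P. {y. y extreme_point_of K})"
    using criticalD vertices_extreme patchD(1) by fast
  ultimately show ?thesis by (rule finite_subset[rotated])
qed

text \<open>
  The test function of the edge \<open>[z, b]\<close> with adjacent triangles \<open>K\<close> and \<open>K'\<close>. It equals \<open>L(1)\<close> on
  that edge, so it does not jump there, and it is orthogonal to polynomials of lower degree on all
  other edges.
\<close>

definition bubble :: "real poly \<Rightarrow> real^2 \<Rightarrow> (real^2) set \<Rightarrow> real^2 \<Rightarrow> (real^2) set \<Rightarrow> real^2 \<Rightarrow> (real^2) set \<Rightarrow> real^2 \<Rightarrow> real" where
  "bubble L b K c K' c' J = (if J = K then ridge L c z b else if J = K' then ridge L c' z b else (\<lambda>x. 0))"

lemma bubble_CR0: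
  assumes K: "K \<in> P" "tri K z b c" "K' \<in> P" "tri K' z b c'" "K \<noteq> K'"
    and L: "degree L = p" "0 < p" "\<And>x. poly L (-x) = - poly L x" "\<And>Q. degree Q < p \<Longrightarrow> poly_int (L * Q) = 0"
  shows "(\<lambda>x. piecewise P (bubble L b K c K' c') x * s) \<in> CR0 p P"
proof -
  define h where "h J x = bubble L b K c K' c' J x * s" for J x
  define u where "u x = piecewise P (bubble L b K c K' c') x * s" for x
  have hp: "h J \<in> polys p" for J
  proof -
    have "bubble L b K c K' c' J \<in> polys p"
      unfolding bubble_def by (simp add: ridge_polys L(1) polys_const)
    from polys_cmult[OF this, of s] show ?thesis by (simp add: h_def[abs_def] mult.commute)
  qed
  have uh: "u x = h J x" if "J \<in> P" "x \<in> interior J" for J x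
    using piecewise_interior[OF that] by (simp add: u_def h_def)
  have u0: "u x = 0" if "x \<notin> (\<Union>K\<in>P. interior K)" for x
    using piecewise_outside[OF that] by (simp add: u_def)
  have uPP: "u \<in> PP p P" unfolding PP_def using hp uh u0 by blast
  have trace: "side_trace J u x = h J x" if J: "J \<in> P" "x \<in> J" for J x
  proof -
    obtain b c where t: "tri J z b c" using patch_tri[OF J(1)] .
    show ?thesis by (rule side_trace_eq[OF t J(2) uh[OF J(1)] continuous_on_polys[OF hp]])
  qed
  have t: "tri K c z b" "tri K' c' z b"
    using tri_exchange[OF tri_swap[OF K(2)]] tri_exchange[OF tri_swap[OF K(4)]] .
  have bV: "b \<in> vertices T" by (rule tri_vertices_in_T[OF K(2) patchD(1)[OF K(1)]])
  have moment: "edge_mean a a' (\<lambda>x. h J x * q x) = 0"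
    if J: "J \<in> P" and e: "closed_segment a a' edge_of J" "closed_segment a a' \<noteq> closed_segment z b" and q: "q \<in> polys (p - 1)"
    for J a a' q
  proof -
    have ridge: "edge_mean a a' (\<lambda>x. ridge L d z b x * q x) = 0" if d: "tri J d z b" for d
    proof -
      have "closed_segment a a' = closed_segment d z \<or> closed_segment a a' = closed_segment d b"
        using e unfolding tri_edge_iff[OF d] by blast
      then have "{a, a'} = {d, z} \<or> {a, a'} = {d, b}" by (simp add: closed_segment_eq)
      then consider "a = d" "a' = z \<or> a' = b" | "a' = d" "a = z \<or> a = b" by (auto simp: doubleton_eq_iff)
      then show ?thesis
      proof cases
        case 1
        then show ?thesis using edge_mean_ridge(1)[OF d _ L q, of a'] by simp
      next
        case 2
        then show ?thesis using edge_mean_ridge(2)[OF d _ L q, of a] by simp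
      qed
    qed
    have "edge_mean a a' (\<lambda>x. bubble L b K c K' c' J x * q x) = 0"
    proof -
      consider "J = K" | "J \<noteq> K" "J = K'" | "J \<noteq> K" "J \<noteq> K'" by blast
      then show ?thesis
      proof cases
        case 1 then show ?thesis using ridge[of c] t(1) by (simp add: bubble_def)
      next
        case 2 then show ?thesis using ridge[of c'] t(2) by (simp add: bubble_def)
      next
        case 3 then show ?thesis by (simp add: bubble_def edge_mean_def)
      qed
    qed
    moreover have "(\<lambda>x. h J x * q x) = (\<lambda>x. s * (bubble L b K c K' c' J x * q x))"
      by (simp add: h_def fun_eq_iff mult_ac)
    then have "edge_mean a a' (\<lambda>x. h J x * q x) = s * edge_mean a a' (\<lambda>x. bubble L b K c K' c' J x * q x)"
      by (simp only: edge_mean_def integral_mult_right)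
    ultimately show ?thesis by simp
  qed
  have inner: "segment_integral a a' (\<lambda>x. (side_trace J u x - side_trace J' u x) * q x) = 0"
    if J: "J \<in> P" "J' \<in> P" "J \<noteq> J'" and e: "closed_segment a a' edge_of J" "closed_segment a a' edge_of J'"
      and q: "q \<in> polys (p - 1)" for J J' a a' q
  proof -
    have sub: "closed_segment a a' \<subseteq> J" "closed_segment a a' \<subseteq> J'" using e edge_of_imp_subset by blast+
    have "segment_integral a a' (\<lambda>x. (side_trace J u x - side_trace J' u x) * q x)
      = dist a a' * edge_mean a a' (\<lambda>x. (h J x - h J' x) * q x)"
      by (rule segment_integral_eq_mean) (simp add: trace J subsetD[OF sub(1)] subsetD[OF sub(2)])
    also have "\<dots> = 0"
    proof (cases "closed_segment a a' = closed_segment z b")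
      case True
      have "{J\<in>P. b \<in> J} = {K, K'}"
      proof -
        obtain K'' d d' where K'': "K'' \<in> P" "K \<noteq> K''" "tri K z b d" "tri K'' z b d'" "{J\<in>P. b \<in> J} = {K, K''}"
          by (rule two_triangles_at[OF bV tri_distinct(1)[OF K(2), symmetric] K(1) tri_vertices(2)[OF K(2)]])
        have "K'' = K'"
          by (rule shared_edge_two[OF patchD(1)[OF K(1)] K(2) patchD(1)[OF K''(1)] K''(4) patchD(1)[OF K(3)] K(4) K''(2) K(5)])
        with K'' show ?thesis by simp
      qed
      moreover have "b \<in> J" "b \<in> J'" using sub True by auto
      ultimately have JK: "J \<in> {K, K'}" "J' \<in> {K, K'}" using J by blast+
      have hval: "h J x = poly L 1 * s" if "J \<in> {K, K'}" "x \<in> closed_segment z b" for J x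
        using that by (auto simp: h_def bubble_def ridge_def bary_opposite)
      have "edge_mean a a' (\<lambda>x. (h J x - h J' x) * q x) = integral {0..1::real} (\<lambda>t. 0)"
        unfolding edge_mean_def
      proof (rule Henstock_Kurzweil_Integration.integral_cong)
        fix t :: real assume "t \<in> {0..1}"
        then have "linepath a a' t \<in> closed_segment z b"
          unfolding True[symmetric] by (rule linepath_in_path)
        then have "h J (linepath a a' t) = poly L 1 * s" "h J' (linepath a a' t) = poly L 1 * s"
          using hval[OF JK(1)] hval[OF JK(2)] by blast+
        then show "(h J (linepath a a' t) - h J' (linepath a a' t)) * q (linepath a a' t) = 0" by simp
      qed
      then show ?thesis by simp
    next
      case False
      have "edge_mean a a' (\<lambda>x. h J x * q x - h J' x * q x)
          = edge_mean a a' (\<lambda>x. h J x * q x) - edge_mean a a' (\<lambda>x. h J' x * q x)"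
        by (rule edge_mean_diff) (rule polys_mult[OF hp q])+
      also have "\<dots> = 0" using moment[OF J(1) e(1) False q] moment[OF J(2) e(2) False q] by simp
      finally show ?thesis by (simp add: left_diff_distrib)
    qed
    finally show ?thesis .
  qed
  have boundary: "segment_integral a a' (\<lambda>x. side_trace J u x * q x) = 0"
    if fr: "closed_segment a a' \<subseteq> frontier (\<Union>P)" and J: "J \<in> P" and e: "closed_segment a a' edge_of J"
      and q: "q \<in> polys (p - 1)" for J a a' q
  proof -
    have "segment_integral a a' (\<lambda>x. side_trace J u x * q x) = dist a a' * edge_mean a a' (\<lambda>x. h J x * q x)"
      by (rule segment_integral_eq_mean) (simp add: trace[OF J subsetD[OF edge_of_imp_subset[OF e]]])
    moreover have "closed_segment a a' \<noteq> closed_segment z b" using fr inner_edge_not_frontier by metis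
    ultimately show ?thesis using moment[OF J e _ q] by simp
  qed
  have "u \<in> CR0 p P"
    unfolding CR0_def mem_Collect_eq
    by (intro conjI allI impI ballI uPP; (elim conjE)?) (rule inner boundary; assumption)+
  then show ?thesis by (simp add: u_def[abs_def])
qed

definition combination :: "nat \<Rightarrow> (real^2 \<Rightarrow> real) \<Rightarrow> (real^2 \<Rightarrow> (real^2) set \<Rightarrow> real) \<Rightarrow> real^2 \<Rightarrow> real" where
  "combination p \<alpha> \<tau> = (\<Sum>y\<in>C. fun_scale (\<alpha> y) (critical_function T z (\<tau> y) (p - 1) y))"

text \<open>
  The quantity through which \<open>K\<close> enters the pairing of the combination with the divergence of a
  \<open>bubble\<close> field.
\<close>

definition weight :: "(real^2 \<Rightarrow> real) \<Rightarrow> (real^2 \<Rightarrow> (real^2) set \<Rightarrow> real) \<Rightarrow> (real^2) set \<Rightarrow> real" where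
  "weight \<alpha> \<tau> K = (\<Sum>y\<in>{y\<in>C. y \<in> K}. \<alpha> y * \<tau> y K)"

lemma combination_pairing:
  assumes v: "pieces p v f g"
  shows "integral (\<Union>P) (\<lambda>x. combination p \<alpha> \<tau> x * div_pw P v x)
    = poly_int ([:1,1:] * jacobi_poly 0 2 (p - 1)) / 2 *
      (\<Sum>K\<in>P. \<Sum>y\<in>{y\<in>C. y \<in> K}. \<alpha> y * \<tau> y K * (\<Sum>i\<in>UNIV. g K i y $ i))"
proof -
  let ?k = "poly_int ([:1,1:] * jacobi_poly 0 2 (p - 1)) / 2"
  let ?q = "\<lambda>y. critical_function T z (\<tau> y) (p - 1) y"
  have int: "(\<lambda>x. ?q y x * div_pw P v x) integrable_on \<Union>P" if "y \<in> C" for y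
  proof -
    obtain Q where "\<And>K. K \<in> P \<Longrightarrow> Q K \<in> polys (p - 1)" "\<And>K x. K \<in> P \<Longrightarrow> x \<in> interior K \<Longrightarrow> ?q y x = Q K x"
      using PP_pieces[OF critical_function_in_PP[OF criticalD(1)[OF \<open>y \<in> C\<close>]]] by metis
    then show ?thesis by (intro pairing_formula(1)[OF v, where Q = Q] continuous_on_polys[of _ "p - 1"])
  qed
  have "combination p \<alpha> \<tau> x * div_pw P v x = (\<Sum>y\<in>C. \<alpha> y * (?q y x * div_pw P v x))" for x
    by (simp add: combination_def fun_scale_def sum_fun_apply sum_distrib_right mult.assoc)
  then have "integral (\<Union>P) (\<lambda>x. combination p \<alpha> \<tau> x * div_pw P v x)
    = (\<Sum>y\<in>C. \<alpha> y * integral (\<Union>P) (\<lambda>x. ?q y x * div_pw P v x))"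
    using int by (simp add: Henstock_Kurzweil_Integration.integral_sum[OF finite_critical] integrable_on_mult_right)
  also have "\<dots> = (\<Sum>y\<in>C. \<alpha> y * (?k * (\<Sum>K | K \<in> P \<and> y \<in> K. \<tau> y K * (\<Sum>i\<in>UNIV. g K i y $ i))))"
    by (intro sum.cong refl) (simp only: critical_pairing[OF v criticalD(1)])
  also have "\<dots> = ?k * (\<Sum>y\<in>C. \<Sum>K | K \<in> P \<and> y \<in> K. \<alpha> y * \<tau> y K * (\<Sum>i\<in>UNIV. g K i y $ i))"
    by (simp only: sum_distrib_left mult.assoc mult.left_commute)
  also have "(\<Sum>y\<in>C. \<Sum>K | K \<in> P \<and> y \<in> K. \<alpha> y * \<tau> y K * (\<Sum>i\<in>UNIV. g K i y $ i))
    = (\<Sum>K\<in>P. \<Sum>y | y \<in> C \<and> y \<in> K. \<alpha> y * \<tau> y K * (\<Sum>i\<in>UNIV. g K i y $ i))"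
    by (rule sum.swap_restrict[OF finite_critical finite_patch])
  finally show ?thesis by simp
qed

text \<open>
  The test field is the bubble of \<open>[z, b]\<close> times the vector \<open>c - z\<close>. Since \<open>L'\<close> takes the same value at
  \<open>1\<close> and \<open>-1\<close>, all critical vertices of a triangle contribute alike. The gradients on both triangles
  are normal to the edge, in opposite directions, with lengths inversely proportional to the areas.
\<close>

lemma weight_balance:
  assumes p: "odd p" and q: "combination p \<alpha> \<tau> \<in> N_CR p P"
    and K: "K \<in> P" "tri K z b c" "K' \<in> P" "tri K' z b c'" "K \<noteq> K'"
  shows "weight \<alpha> \<tau> K / measure lebesgue K = weight \<alpha> \<tau> K' / measure lebesgue K'"
proof -
  obtain L :: "real poly" where L: "degree L = p" "\<And>x. poly L (-x) = - poly L x"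
    "\<And>Q. degree Q < p \<Longrightarrow> poly_int (L * Q) = 0"
    using odd_legendre_exists[OF p] by metis
  note DL = odd_legendre_deriv[OF p L]
  let ?D = "poly (pderiv L) 1" and ?k = "poly_int ([:1,1:] * jacobi_poly 0 2 (p - 1)) / 2"
  define d where "d = c - z"
  define v where "v x = piecewise P (bubble L b K c K' c') x *\<^sub>R d" for x
  define f where "f J i x = bubble L b K c K' c' J x * d $ i" for J x and i :: 2
  define G where "G J = (if J = K then dridge L c z b else if J = K' then dridge L c' z b else (\<lambda>x. 0))" for J
  define g where "g J i x = d $ i *\<^sub>R G J x" for J x and i :: 2
  have "(\<lambda>x. v x $ i) \<in> CR0 p P" for i
    using bubble_CR0[OF K L(1) odd_pos[OF p] L(2,3), of "d $ i"] by (simp add: v_def)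
  then have zero: "integral (\<Union>P) (\<lambda>x. combination p \<alpha> \<tau> x * div_pw P v x) = 0"
    using q by (simp add: N_CR_def div_annihilator_def)
  have pieces: "pieces p v f g"
    unfolding pieces_def
  proof (intro ballI allI conjI)
    fix J i assume J: "J \<in> P"
    have "bubble L b K c K' c' J \<in> polys p"
      unfolding bubble_def by (simp add: ridge_polys L(1) polys_const)
    from polys_cmult[OF this, of "d $ i"] show "f J i \<in> polys p"
      by (simp add: f_def[abs_def] mult.commute)
    show "v x $ i = f J i x" if "x \<in> interior J" for x
      using piecewise_interior[OF J that] by (simp add: v_def f_def)
    show "(\<lambda>x. g J i x $ j) \<in> polys (p - 1)" for j
    proof -
      have "(\<lambda>x. G J x $ j) \<in> polys (p - 1)"
        unfolding G_def using dridge_polys[of L p] polys_const[of 0] by (simp add: L(1))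
      from polys_cmult[OF this] show ?thesis by (simp add: g_def)
    qed
    show "(f J i has_derivative (\<lambda>e. g J i x \<bullet> e)) (at x)" for x
    proof -
      have "(bubble L b K c K' c' J has_derivative (\<lambda>e. G J x \<bullet> e)) (at x)"
      proof -
        have "((\<lambda>y::real^2. 0::real) has_derivative (\<lambda>e. (0::real^2) \<bullet> e)) (at x)"
          by (rule has_derivative_eq_rhs[OF has_derivative_const]) auto
        then show ?thesis
          unfolding bubble_def G_def
          by (cases "J = K"; cases "J = K'") (simp_all only: if_True if_False ridge_has_derivative simp_thms)
      qed
      from has_derivative_mult_left[OF this, of "d $ i"]
      show ?thesis unfolding f_def g_def by (simp add: mult.commute)
    qed
  qed
  have t: "tri K c z b" "tri K' c' z b"
    using tri_exchange[OF tri_swap[OF K(2)]] tri_exchange[OF tri_swap[OF K(4)]] .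
  have val: "(\<Sum>i\<in>UNIV. dridge L a z b y $ i * d $ i) = - 2 * ?D * (bary_grad a z b \<bullet> d)"
    if a: "tri J a z b" and y: "y \<in> C" "y \<in> J" and J: "J \<in> P" for J a y
  proof -
    have "y = a \<or> y = z \<or> y = b"
      using vertices_extreme[OF criticalD(1)[OF y(1)] patchD(1)[OF J] y(2)] tri_extreme[OF a] by blast
    then have "poly (pderiv L) (1 - 2 * bary a z b y) = ?D"
      using bary_vertex[OF a] DL(1) by auto
    then show ?thesis by (simp add: dridge_def inner_vec_def sum_2 algebra_simps)
  qed
  have div: "(\<Sum>i\<in>UNIV. g J i y $ i) = (\<Sum>i\<in>UNIV. G J y $ i * d $ i)" for J y
    by (simp add: g_def mult.commute)
  define S where "S J = (\<Sum>y\<in>{y\<in>C. y \<in> J}. \<alpha> y * \<tau> y J * (\<Sum>i\<in>UNIV. g J i y $ i))" for J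
  have S: "S J = - 2 * ?D * (bary_grad a z b \<bullet> d) * weight \<alpha> \<tau> J"
    if "tri J a z b" "J \<in> P" "G J = dridge L a z b" for J a
  proof -
    have "S J = (\<Sum>y\<in>{y\<in>C. y \<in> J}. \<alpha> y * \<tau> y J * (- 2 * ?D * (bary_grad a z b \<bullet> d)))"
      unfolding S_def div that(3) by (intro sum.cong refl) (simp add: val[OF that(1) _ _ that(2)])
    then show ?thesis unfolding weight_def by (simp only: sum_distrib_left mult.commute)
  qed
  have "(\<Sum>J\<in>P. S J) = (\<Sum>J\<in>{K, K'}. S J)"
  proof (rule sum.mono_neutral_right[OF finite_patch])
    show "\<forall>J\<in>P - {K, K'}. S J = 0" by (simp add: S_def g_def G_def)
  qed (use K in simp)
  also have "\<dots> = S K + S K'" using K(5) by simp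
  finally have "?k * (S K + S K') = 0"
    using zero combination_pairing[OF pieces, of \<alpha> \<tau>] by (simp add: S_def)
  then have "S K + S K' = 0" using poly_int_jacobi_02_nonzero[of "p - 1"] by simp
  moreover have "S K = - 2 * ?D * (bary_grad c z b \<bullet> d) * weight \<alpha> \<tau> K"
    by (rule S[OF t(1) K(1)]) (simp add: G_def)
  moreover have "S K' = - 2 * ?D * (bary_grad c' z b \<bullet> d) * weight \<alpha> \<tau> K'"
    by (rule S[OF t(2) K(3)]) (use K(5) in \<open>simp add: G_def\<close>)
  ultimately have "- 2 * ?D * ((bary_grad c z b \<bullet> d) * weight \<alpha> \<tau> K + (bary_grad c' z b \<bullet> d) * weight \<alpha> \<tau> K') = 0"
    by (simp only: distrib_left mult.assoc)
  then have eq: "(bary_grad c z b \<bullet> d) * weight \<alpha> \<tau> K + (bary_grad c' z b \<bullet> d) * weight \<alpha> \<tau> K' = 0"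
    using DL(2) by simp
  define w w' where "w = wedge (b - z) (c - z)" and "w' = wedge (b - z) (c' - z)"
  have ww: "w * w' < 0"
    unfolding w_def w'_def by (rule opposite_sides[OF patchD(1)[OF K(1)] K(2) patchD(1)[OF K(3)] K(4,5)])
  have "bary_grad c z b \<bullet> d = 1" "bary_grad c' z b \<bullet> d = w / w'"
    using ww by (auto simp: bary_grad_inner d_def wedge_swap[of "c - z"] wedge_swap[of "c' - z"] w_def w'_def)
  with eq have eq': "weight \<alpha> \<tau> K + w / w' * weight \<alpha> \<tau> K' = 0" by simp
  have m: "measure lebesgue K = \<bar>w\<bar> / 2" "measure lebesgue K' = \<bar>w'\<bar> / 2"
    using K(2,4) by (auto simp: tri_def measure_triangle w_def w'_def)
  have "w \<noteq> 0" "w' \<noteq> 0" "\<bar>w\<bar> / \<bar>w'\<bar> = - (w / w')" using ww by (auto simp: abs_real_def mult_less_0_iff)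
  then have "weight \<alpha> \<tau> K = \<bar>w\<bar> / \<bar>w'\<bar> * weight \<alpha> \<tau> K'" using eq' by simp
  then show ?thesis using \<open>w \<noteq> 0\<close> \<open>w' \<noteq> 0\<close> by (simp add: m)
qed

end

section \<open>Independence of the critical functions\<close>

text \<open>
  The squared distance from \<open>z\<close> is strictly convex along a line, and \<open>y\<close> lies strictly between \<open>c\<close>
  and \<open>c'\<close>.
\<close>

lemma one_end_farther:
  fixes y c c' z :: "real^2"
  assumes "c' - y = r *\<^sub>R (c - y)" "r < 0" "c \<noteq> y"
  shows "dist z y < dist z c \<or> dist z y < dist z c'"
proof -
  define u s where "u = c - y" and "s = y - z"
  have sq: "(dist z y)\<^sup>2 = s \<bullet> s" "(dist z c)\<^sup>2 = s \<bullet> s + 2 * (s \<bullet> u) + u \<bullet> u"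
    "(dist z c')\<^sup>2 = s \<bullet> s + 2 * (r * (s \<bullet> u)) + r\<^sup>2 * (u \<bullet> u)"
  proof -
    have e: "c - z = s + u" "c' - z = s + r *\<^sub>R u" using assms(1) by (simp_all add: u_def s_def algebra_simps)
    have d: "(dist z x)\<^sup>2 = (x - z) \<bullet> (x - z)" for x
      unfolding dist_norm norm_minus_commute[of z x] power2_norm_eq_inner ..
    show "(dist z y)\<^sup>2 = s \<bullet> s" by (simp add: d s_def)
    show "(dist z c)\<^sup>2 = s \<bullet> s + 2 * (s \<bullet> u) + u \<bullet> u"
      by (simp add: d e inner_add_left inner_add_right inner_commute)
    show "(dist z c')\<^sup>2 = s \<bullet> s + 2 * (r * (s \<bullet> u)) + r\<^sup>2 * (u \<bullet> u)"
      unfolding d e by (simp add: inner_add_left inner_add_right inner_commute power2_eq_square)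
  qed
  have u: "0 < u \<bullet> u" using assms(3) by (simp add: u_def)
  show ?thesis
  proof (cases "0 \<le> s \<bullet> u")
    case True
    then have "(dist z y)\<^sup>2 < (dist z c)\<^sup>2" using sq u by linarith
    then show ?thesis using power_less_imp_less_base by (metis zero_le_dist)
  next
    case False
    then have "0 < r * (s \<bullet> u)" using assms(2) by (simp add: mult_neg_neg)
    moreover have "0 < r\<^sup>2 * (u \<bullet> u)" using u assms(2) by simp
    ultimately have "(dist z y)\<^sup>2 < (dist z c')\<^sup>2" using sq by linarith
    then show ?thesis using power_less_imp_less_base by (metis zero_le_dist)
  qed
qed

context vertex_star
begin

lemma patch_nonempty: "P \<noteq> {}"
  using z_interior_patch interior_subset by fastforce

lemma measure_pos: "K \<in> P \<Longrightarrow> 0 < measure lebesgue K"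
proof -
  assume "K \<in> P"
  then obtain b c where "tri K z b c" using patch_tri by blast
  then show ?thesis by (simp add: tri_def measure_triangle)
qed

text \<open>
  If the centre and an outer vertex \<open>y\<close> were both critical, the third vertices of the two triangles
  at \<open>[z, y]\<close> would be collinear with \<open>z\<close> and with \<open>y\<close>, so the triangles would be degenerate.
\<close>

lemma centre_critical_unique:
  assumes z: "z \<in> C" and y: "y \<in> C"
  shows "y = z"
proof (rule ccontr)
  assume ne: "y \<noteq> z"
  obtain K where K: "K \<in> P" "y \<in> K" using criticalD(2)[OF y] by blast
  obtain K' c c' where K': "K' \<in> P" "K \<noteq> K'" "tri K z y c" "tri K' z y c'" "{J\<in>P. y \<in> J} = {K, K'}"
    by (rule two_triangles_at[OF criticalD(1)[OF y] ne K])
  obtain r where r: "r < 0" "c' - z = r *\<^sub>R (c - z)" by (rule critical_ray[OF z K(1) K'(3,1,4,2)])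
  obtain s where s: "s < 0" "c' - y = s *\<^sub>R (c - y)"
    by (rule critical_ray[OF y K(1) tri_exchange[OF K'(3)] K'(1) tri_exchange[OF K'(4)] K'(2)])
  have eq: "r *\<^sub>R (c - z) = (1 - s) *\<^sub>R (y - z) + s *\<^sub>R (c - z)"
  proof -
    have "r *\<^sub>R (c - z) = (c' - y) + (y - z)" using r(2) by simp
    then show ?thesis unfolding s(2) by (simp add: algebra_simps)
  qed
  have "wedge (y - z) (r *\<^sub>R (c - z)) = wedge (y - z) (s *\<^sub>R (c - z))"
    unfolding eq by (simp add: wedge_def algebra_simps)
  then have "r * wedge (y - z) (c - z) = s * wedge (y - z) (c - z)"
    by (simp add: wedge_def algebra_simps)
  then have "r = s" using K'(3) by (simp add: tri_def)
  with eq have "(1 - s) *\<^sub>R (y - z) = 0" by simp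
  then show False using ne s(1) by simp
qed

lemma outer_critical_subset:
  assumes "z \<notin> C" "tri K z y c" "y \<in> C" "K \<in> P"
  shows "{x\<in>C. x \<in> K} = insert y ({c} \<inter> C)"
proof -
  have "x = y \<or> x = c" if "x \<in> C" "x \<in> K" for x
    using vertices_extreme[OF criticalD(1)[OF that(1)] patchD(1)[OF assms(4)] that(2)]
      tri_extreme[OF assms(2), of x] that assms(1) by auto
  then show ?thesis using assms(3) tri_vertices[OF assms(2)] by auto
qed

text \<open>
  All triangles with weight ratio \<open>k\<close> and outer edge on a fixed line are considered together. A
  critical outer vertex lies in two such triangles or in none, and it contributes with opposite
  signs to them, so the weights add up to zero; but they also add up to \<open>k\<close> times a positive area.
  If the centre itself is critical, it suffices to compare two neighbours.
\<close>

lemma weight_zero: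
  assumes p: "odd p" and q: "combination p \<alpha> \<tau> \<in> N_CR p P"
    and \<tau>: "\<forall>y\<in>C. local_sign y (\<tau> y)" and K0: "K0 \<in> P"
  shows "weight \<alpha> \<tau> K0 = 0"
proof (cases "z \<in> C")
  case True
  have w: "weight \<alpha> \<tau> K = \<alpha> z * \<tau> z K" if "K \<in> P" for K
  proof -
    have "{y\<in>C. y \<in> K} = {z}" using centre_critical_unique[OF True] True patchD(2)[OF that] by blast
    then show ?thesis by (simp add: weight_def)
  qed
  obtain b c where t: "tri K0 z b c" using patch_tri[OF K0] .
  obtain K' c' where K': "K' \<in> P" "K' \<noteq> K0" "tri K' z b c'" by (rule neighbour_exists[OF K0 t])
  have "\<tau> z K0 = - \<tau> z K'"
    using bspec[OF \<tau> True] K0 K' t unfolding local_sign_def by metis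
  then have "weight \<alpha> \<tau> K' = - weight \<alpha> \<tau> K0" using w K0 K'(1) by simp
  moreover have "weight \<alpha> \<tau> K0 / measure lebesgue K0 = weight \<alpha> \<tau> K' / measure lebesgue K'"
    by (rule weight_balance[OF p q K0 t K'(1,3) K'(2)[symmetric]])
  ultimately have "weight \<alpha> \<tau> K0 * (1 / measure lebesgue K0 + 1 / measure lebesgue K') = 0"
    by (simp add: distrib_left)
  moreover have "0 < 1 / measure lebesgue K0 + 1 / measure lebesgue K'"
    using measure_pos[OF K0] measure_pos[OF K'(1)] by (intro add_pos_pos) auto
  ultimately show ?thesis by simp
next
  case False
  obtain b0 c0 where t0: "tri K0 z b0 c0" using patch_tri[OF K0] .
  define k where "k = weight \<alpha> \<tau> K0 / measure lebesgue K0"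
  define l where "l y = wedge (c0 - b0) (y - b0)" for y
  \<comment> \<open>Fixing the ratio \<open>k\<close> makes \<open>M\<close> closed under passing to the neighbour across an edge at a critical point.\<close>
  define M where "M = {K\<in>P. weight \<alpha> \<tau> K / measure lebesgue K = k \<and> (\<forall>y\<in>outer K. l y = 0)}"
  have finM: "finite M" using finite_patch by (simp add: M_def)
  have K0M: "K0 \<in> M" using K0 by (simp add: M_def k_def outer_eq[OF t0] l_def wedge_def)
  have MP: "K \<in> P" if "K \<in> M" for K using that by (simp add: M_def)
  have "(\<Sum>K\<in>M. weight \<alpha> \<tau> K) = (\<Sum>K\<in>M. k * measure lebesgue K)"
  proof (rule sum.cong[OF refl])
    fix K assume "K \<in> M"
    then show "weight \<alpha> \<tau> K = k * measure lebesgue K"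
      using measure_pos[OF MP[OF \<open>K \<in> M\<close>]] by (auto simp: M_def)
  qed
  also have "\<dots> = k * (\<Sum>K\<in>M. measure lebesgue K)" by (simp add: sum_distrib_left)
  finally have 1: "(\<Sum>K\<in>M. weight \<alpha> \<tau> K) = k * (\<Sum>K\<in>M. measure lebesgue K)" .
  have "(\<Sum>K\<in>M. weight \<alpha> \<tau> K) = (\<Sum>y\<in>C. \<Sum>K | K \<in> M \<and> y \<in> K. \<alpha> y * \<tau> y K)"
    unfolding weight_def by (rule sum.swap_restrict[OF finM finite_critical])
  also have "\<dots> = 0"
  proof (rule sum.neutral, rule ballI)
    fix y assume y: "y \<in> C"
    show "(\<Sum>K | K \<in> M \<and> y \<in> K. \<alpha> y * \<tau> y K) = 0"
    proof (cases "{K. K \<in> M \<and> y \<in> K} = {}")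
      case True
      then show ?thesis by (simp only: sum.empty)
    next
      case nonempty: False
      then obtain K where K: "K \<in> M" "y \<in> K" by blast
      have ne: "y \<noteq> z" using y False by blast
      obtain K' c c' where K': "K' \<in> P" "K \<noteq> K'" "tri K z y c" "tri K' z y c'" "{J\<in>P. y \<in> J} = {K, K'}"
        by (rule two_triangles_at[OF criticalD(1)[OF y] ne MP[OF K(1)] K(2)])
      obtain r where r: "r < 0" "c' - y = r *\<^sub>R (c - y)"
        by (rule critical_ray[OF y MP[OF K(1)] tri_exchange[OF K'(3)] K'(1) tri_exchange[OF K'(4)] K'(2)])
      have "l y = 0" "l c = 0" using K(1) by (simp_all add: M_def outer_eq[OF K'(3)])
      moreover have "l c' = (1 - r) * l y + r * l c"
      proof -
        have e: "c' - b0 = (1 - r) *\<^sub>R (y - b0) + r *\<^sub>R (c - b0)"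
          using r(2) by (simp add: algebra_simps)
        show ?thesis unfolding l_def e by (simp add: wedge_def algebra_simps)
      qed
      moreover have "weight \<alpha> \<tau> K' / measure lebesgue K' = k"
        using weight_balance[OF p q MP[OF K(1)] K'(3,1,4,2)] K(1) by (simp add: M_def)
      ultimately have "K' \<in> M" using K'(1) by (simp add: M_def outer_eq[OF K'(4)])
      moreover have "y \<in> K'" by (rule tri_vertices(2)[OF K'(4)])
      ultimately have "{K. K \<in> M \<and> y \<in> K} = {K, K'}" using K K'(5) MP by blast
      moreover have "\<tau> y K = - \<tau> y K'"
        using bspec[OF \<tau> y] MP[OF K(1)] K'(1,2) tri_exchange[OF K'(3)] tri_exchange[OF K'(4)]
        unfolding local_sign_def by metis
      ultimately show ?thesis using K'(2) by simp
    qed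
  qed
  finally have "k * (\<Sum>K\<in>M. measure lebesgue K) = 0" using 1 by simp
  moreover have "0 < (\<Sum>K\<in>M. measure lebesgue K)"
    using K0M measure_pos[OF MP] by (intro sum_pos[OF finM]) auto
  ultimately have "k = 0" by simp
  then show ?thesis using measure_pos[OF K0] by (simp add: k_def)
qed

text \<open>
  Once all weights vanish, the two outer vertices of a triangle carry coefficients of equal modulus.
  A critical outer vertex lies strictly between its neighbours, one of which is farther from \<open>z\<close>;
  so a farthest vertex with nonzero coefficient cannot exist.
\<close>

lemma combination_in_N_CR_imp_zero:
  assumes p: "odd p" and q: "combination p \<alpha> \<tau> \<in> N_CR p P"
    and \<tau>: "\<forall>y\<in>C. local_sign y (\<tau> y)" and y: "y \<in> C"
  shows "\<alpha> y = 0"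
proof -
  note w0 = weight_zero[OF p q \<tau>]
  have sgn: "\<tau> y K \<noteq> 0" if "y \<in> C" "K \<in> P" "y \<in> K" for y K
    using bspec[OF \<tau> that(1)] that(2,3) by (auto simp: local_sign_def)
  show ?thesis
  proof (cases "z \<in> C")
    case True
    obtain K where K: "K \<in> P" using patch_nonempty by blast
    have "{y\<in>C. y \<in> K} = {z}" using centre_critical_unique[OF True] True patchD(2)[OF K] by blast
    then have "\<alpha> z * \<tau> z K = 0" using w0[OF K] by (simp add: weight_def)
    then show ?thesis using sgn[OF True K patchD(2)[OF K]] centre_critical_unique[OF True y] by simp
  next
    case False
    show ?thesis
    proof (rule ccontr)
      assume "\<alpha> y \<noteq> 0"
      define S where "S = {y\<in>C. \<alpha> y \<noteq> 0}"
      have "finite S" "S \<noteq> {}" using finite_critical y \<open>\<alpha> y \<noteq> 0\<close> by (auto simp: S_def)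
      then have "Max (dist z ` S) \<in> dist z ` S" by (intro Max_in) auto
      then obtain x where "x \<in> S" "Max (dist z ` S) = dist z x" by blast
      then have x: "x \<in> S" "\<And>x'. x' \<in> S \<Longrightarrow> dist z x' \<le> dist z x"
        using \<open>finite S\<close> by (auto simp flip: \<open>Max (dist z ` S) = dist z x\<close>)
      then have xC: "x \<in> C" "\<alpha> x \<noteq> 0" by (auto simp: S_def)
      have ne: "x \<noteq> z" using xC False by blast
      obtain K where K: "K \<in> P" "x \<in> K" using criticalD(2)[OF xC(1)] by blast
      obtain K' c c' where K': "K' \<in> P" "K \<noteq> K'" "tri K z x c" "tri K' z x c'" "{J\<in>P. x \<in> J} = {K, K'}"
        by (rule two_triangles_at[OF criticalD(1)[OF xC(1)] ne K])
      obtain r where r: "r < 0" "c' - x = r *\<^sub>R (c - x)"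
        by (rule critical_ray[OF xC(1) K(1) tri_exchange[OF K'(3)] K'(1) tri_exchange[OF K'(4)] K'(2)])
      have far: "dist z d \<le> dist z x" if J: "J \<in> P" "tri J z x d" for J d
      proof (rule x(2))
        \<comment> \<open>Only \<open>x\<close> and \<open>d\<close> can contribute to the weight of \<open>J\<close>, which is zero.\<close>
        have "d \<in> C \<and> \<alpha> d \<noteq> 0"
        proof (rule ccontr)
          assume no: "\<not> (d \<in> C \<and> \<alpha> d \<noteq> 0)"
          have "weight \<alpha> \<tau> J = \<alpha> x * \<tau> x J"
          proof (cases "d \<in> C")
            case True
            then show ?thesis
              using no tri_distinct(3)[OF J(2)] by (simp add: weight_def outer_critical_subset[OF False J(2) xC(1) J(1)])
          next
            case notin: False
            then show ?thesis by (simp add: weight_def outer_critical_subset[OF False J(2) xC(1) J(1)])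
          qed
          then show False using w0[OF J(1)] xC sgn[OF xC(1) J(1) tri_vertices(2)[OF J(2)]] by simp
        qed
        then show "d \<in> S" by (simp add: S_def)
      qed
      show False
        using one_end_farther[OF r(2,1) tri_distinct(3)[OF K'(3), symmetric], of z]
          far[OF K(1) K'(3)] far[OF K'(1,4)] by linarith
    qed
  qed
qed

abbreviation "crit p \<tau> y \<equiv> critical_function T z (\<tau> y) (p - 1) y"

lemma combination_add: "combination p (\<lambda>y. \<alpha> y + \<beta> y) \<tau> = combination p \<alpha> \<tau> + combination p \<beta> \<tau>"
  unfolding combination_def by (simp only: fun_space.scale_left_distrib sum.distrib)

lemma combination_scale: "combination p (\<lambda>y. a * \<alpha> y) \<tau> = fun_scale a (combination p \<alpha> \<tau>)"
  unfolding combination_def by (simp add: fun_space.scale_sum_right)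

lemma span_critical:
  assumes "f \<in> fun_space.span (crit p \<tau> ` C)"
  shows "\<exists>\<alpha>. f = combination p \<alpha> \<tau>"
proof -
  have "f \<in> range (\<lambda>\<alpha>. combination p \<alpha> \<tau>)"
    using assms
  proof (rule fun_space.span_induct)
    show "fun_space.subspace {f. f \<in> range (\<lambda>\<alpha>. combination p \<alpha> \<tau>)}"
      unfolding fun_space.subspace_def
    proof (intro conjI ballI allI)
      have "combination p (\<lambda>y. 0) \<tau> = 0" by (simp add: combination_def)
      then show "0 \<in> {f. f \<in> range (\<lambda>\<alpha>. combination p \<alpha> \<tau>)}" by (metis mem_Collect_eq rangeI)
    next
      fix f g assume "f \<in> {f. f \<in> range (\<lambda>\<alpha>. combination p \<alpha> \<tau>)}" "g \<in> {f. f \<in> range (\<lambda>\<alpha>. combination p \<alpha> \<tau>)}"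
      then obtain \<alpha> \<beta> where "f = combination p \<alpha> \<tau>" "g = combination p \<beta> \<tau>" by auto
      then have "f + g = combination p (\<lambda>y. \<alpha> y + \<beta> y) \<tau>" by (simp only: combination_add)
      then show "f + g \<in> {f. f \<in> range (\<lambda>\<alpha>. combination p \<alpha> \<tau>)}" by blast
    next
      fix a f assume "f \<in> {f. f \<in> range (\<lambda>\<alpha>. combination p \<alpha> \<tau>)}"
      then obtain \<alpha> where "f = combination p \<alpha> \<tau>" by auto
      then have "fun_scale a f = combination p (\<lambda>y. a * \<alpha> y) \<tau>" by (simp only: combination_scale)
      then show "fun_scale a f \<in> {f. f \<in> range (\<lambda>\<alpha>. combination p \<alpha> \<tau>)}" by blast
    qed
  next
    fix f assume "f \<in> crit p \<tau> ` C"
    then obtain y where y: "y \<in> C" "f = crit p \<tau> y" by blast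
    have "combination p (\<lambda>x. if x = y then 1 else 0) \<tau> = (\<Sum>x\<in>C. if x = y then crit p \<tau> y else 0)"
      unfolding combination_def by (intro sum.cong) auto
    also have "\<dots> = f" using y finite_critical by simp
    finally show "f \<in> range (\<lambda>\<alpha>. combination p \<alpha> \<tau>)" by (metis rangeI)
  qed
  then show ?thesis by blast
qed

lemma one_on_nonzero: "one_on P \<noteq> 0"
proof -
  obtain K where K: "K \<in> P" using patch_nonempty by blast
  obtain b c where t: "tri K z b c" using patch_tri[OF K] .
  then obtain x where "x \<in> interior K" using tri_topology(4) by blast
  then have "one_on P x = 1" using piecewise_interior[OF K] by (simp add: one_on_def)
  then show ?thesis by (metis zero_fun_apply zero_neq_one)
qed

lemma one_on_plus_combination:
  assumes p: "odd p" and \<tau>: "\<forall>y\<in>C. local_sign y (\<tau> y)"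
    and f: "fun_scale k (one_on P) + combination p \<alpha> \<tau> \<in> N_CR p P" and y: "y \<in> C"
  shows "\<alpha> y = 0"
proof -
  have "fun_scale k (one_on P) \<in> N_CR p P"
    by (rule fun_space.subspace_scale[OF subspace_N_CR one_on_in_N_CR])
  from fun_space.subspace_diff[OF subspace_N_CR f this]
  have "combination p \<alpha> \<tau> \<in> N_CR p P" by simp
  then show ?thesis by (rule combination_in_N_CR_imp_zero[OF p _ \<tau> y])
qed

lemma combination_zero: "(\<And>y. y \<in> C \<Longrightarrow> \<alpha> y = 0) \<Longrightarrow> combination p \<alpha> \<tau> = 0"
  unfolding combination_def by (intro sum.neutral) auto

lemma N_CR_span_critical:
  assumes p: "odd p" and \<tau>: "\<forall>y\<in>C. local_sign y (\<tau> y)"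
    and f: "f \<in> N_CR p P" "f - fun_scale k (one_on P) \<in> fun_space.span (crit p \<tau> ` C)"
  shows "f \<in> fun_space.span {one_on P}"
proof -
  obtain \<alpha> where \<alpha>: "f - fun_scale k (one_on P) = combination p \<alpha> \<tau>" using span_critical[OF f(2)] by blast
  then have eq: "f = fun_scale k (one_on P) + combination p \<alpha> \<tau>" by (metis add.commute diff_add_cancel)
  then have "\<alpha> y = 0" if "y \<in> C" for y
    using one_on_plus_combination[OF p \<tau> _ that] f(1) by metis
  then have "f = fun_scale k (one_on P)" using eq combination_zero by (metis add.right_neutral)
  then show ?thesis by (simp add: fun_space.span_scale fun_space.span_base)
qed

lemma span_one_on_subset_N_CR: "fun_space.span {one_on P} \<subseteq> N_CR p P"
  by (intro fun_space.span_minimal subspace_N_CR) (simp add: one_on_in_N_CR)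

text \<open>
  A linear relation expresses the zero function, which lies in the annihilator, so all its coefficients
  at critical functions vanish.
\<close>

lemma critical_basis:
  assumes p: "odd p" and \<tau>: "\<forall>y\<in>C. local_sign y (\<tau> y)"
  shows "fun_space.independent (insert (one_on P) (crit p \<tau> ` C))"
    "card (insert (one_on P) (crit p \<tau> ` C)) = 1 + card C"
proof -
  have key: "k = 0 \<and> (\<forall>y\<in>C. \<alpha> y = 0)" if "fun_scale k (one_on P) + combination p \<alpha> \<tau> = 0" for k \<alpha>
  proof -
    have "fun_scale k (one_on P) + combination p \<alpha> \<tau> \<in> N_CR p P"
      unfolding that by (rule fun_space.subspace_0[OF subspace_N_CR])
    then have a: "\<alpha> y = 0" if "y \<in> C" for y by (rule one_on_plus_combination[OF p \<tau> _ that])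
    then have "fun_scale k (one_on P) = 0" using that combination_zero[of \<alpha> p \<tau>] by simp
    then show ?thesis using a one_on_nonzero by (simp add: fun_space.scale_eq_0_iff)
  qed
  have single: "combination p (\<lambda>x. if x = y then a else 0) \<tau> = fun_scale a (crit p \<tau> y)" if "y \<in> C" for y a
  proof -
    have "combination p (\<lambda>x. if x = y then a else 0) \<tau> = (\<Sum>x\<in>C. if x = y then fun_scale a (crit p \<tau> y) else 0)"
      unfolding combination_def by (intro sum.cong) auto
    then show ?thesis using that finite_critical by simp
  qed
  have inj: "inj_on (crit p \<tau>) C"
  proof (rule inj_onI, rule ccontr)
    fix x y assume xy: "x \<in> C" "y \<in> C" "crit p \<tau> x = crit p \<tau> y" "x \<noteq> y"
    let ?\<alpha> = "\<lambda>w. (if w = x then 1 else 0) + (if w = y then -1 else 0) :: real"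
    have "combination p ?\<alpha> \<tau> = fun_scale 1 (crit p \<tau> x) + fun_scale (-1) (crit p \<tau> y)"
      unfolding combination_add single[OF xy(1)] single[OF xy(2)] ..
    then have "fun_scale 0 (one_on P) + combination p ?\<alpha> \<tau> = 0" using xy(3) by simp
    from bspec[OF conjunct2[OF key[OF this]] xy(1)] have "?\<alpha> x = 0" .
    then show False using xy(4) by simp
  qed
  have notin: "one_on P \<notin> crit p \<tau> ` C"
  proof
    assume "one_on P \<in> crit p \<tau> ` C"
    then obtain y where y: "y \<in> C" "one_on P = crit p \<tau> y" by blast
    have "fun_scale (-1) (one_on P) + combination p (\<lambda>x. if x = y then 1 else 0) \<tau> = 0"
      unfolding single[OF y(1)] using y(2) by simp
    from conjunct1[OF key[OF this]] have "(-1::real) = 0" .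
    then show False by simp
  qed
  show "card (insert (one_on P) (crit p \<tau> ` C)) = 1 + card C"
    using notin finite_critical card_image[OF inj] by simp
  let ?B = "insert (one_on P) (crit p \<tau> ` C)"
  have "u w = 0" if sum: "(\<Sum>w\<in>?B. fun_scale (u w) w) = 0" and w: "w \<in> ?B" for u w
  proof -
    have "(\<Sum>w\<in>?B. fun_scale (u w) w) = fun_scale (u (one_on P)) (one_on P) + (\<Sum>y\<in>C. fun_scale (u (crit p \<tau> y)) (crit p \<tau> y))"
      using notin finite_critical sum.reindex[OF inj, of "\<lambda>w. fun_scale (u w) w"] by simp
    then have "fun_scale (u (one_on P)) (one_on P) + combination p (\<lambda>y. u (crit p \<tau> y)) \<tau> = 0"
      using sum by (simp add: combination_def)
    from key[OF this] show ?thesis using w by blast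
  qed
  then show "fun_space.independent ?B"
    using finite_critical by (subst fun_space.dependent_finite) auto
qed

text \<open>
  Otherwise \<open>B\<close> could be extended by a further vector to an independent set larger than a basis. As the
  dimension is positive, it is the cardinality of a finite basis.
\<close>

lemma independent_card_eq_dim_spans:
  assumes B: "fun_space.independent B" "B \<subseteq> V" "finite B" "card B = fun_space.dim V" "0 < fun_space.dim V"
  shows "V \<subseteq> fun_space.span B"
proof
  fix x assume x: "x \<in> V"
  obtain D where D: "D \<subseteq> V" "fun_space.independent D" "V \<subseteq> fun_space.span D" "card D = fun_space.dim V"
    using fun_space.basis_exists by blast
  have finD: "finite D" using D(4) B(5) by (metis card.infinite less_numeral_extra(3))
  show "x \<in> fun_space.span B"
  proof (rule ccontr)
    assume no: "x \<notin> fun_space.span B"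
    then have xB: "x \<notin> B" using fun_space.span_base by blast
    have "fun_space.independent (insert x B)"
      using no B(1) xB by (simp add: fun_space.independent_insert)
    moreover have "insert x B \<subseteq> fun_space.span D" using x B(2) D(3) by blast
    ultimately have "card (insert x B) \<le> card D"
      using fun_space.independent_span_bound[OF finD] by blast
    then show False using xB B(3,4) D(4) by simp
  qed
qed

text \<open>
  The conforming annihilator has a basis consisting of \<open>1\<close> and critical functions, for which the signs
  are chosen at each critical point separately.
\<close>

lemma dim_N_CR:
  assumes p: "odd p" and dim: "fun_space.dim (N_conf p P) = 1 + card C"
  shows "fun_space.dim (N_CR p P) = 1"
proof -
  obtain \<tau> where \<tau>: "\<forall>y\<in>C. local_sign y (\<tau> y)"
    using bchoice[of C local_sign] local_sign_exists by blast
  let ?B = "insert (one_on P) (crit p \<tau> ` C)"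
  have "?B \<subseteq> N_conf p P"
    using one_on_in_N_CR N_CR_subset_N_conf critical_function_in_N_conf \<tau> by blast
  then have "N_conf p P \<subseteq> fun_space.span ?B"
    using critical_basis[OF p \<tau>] dim finite_critical by (intro independent_card_eq_dim_spans) auto
  then have "N_CR p P \<subseteq> fun_space.span ?B" using N_CR_subset_N_conf by blast
  then have "f \<in> fun_space.span {one_on P}" if "f \<in> N_CR p P" for f
    using that N_CR_span_critical[OF p \<tau> that] by (auto simp: fun_space.span_insert)
  then have "N_CR p P = fun_space.span {one_on P}" using span_one_on_subset_N_CR by blast
  moreover have "fun_space.independent {one_on P}"
    using one_on_nonzero by (simp add: fun_space.dependent_single)
  ultimately show ?thesis using fun_space.dim_eq_card_independent by (simp add: fun_space.dim_span)
qed

lemma span_critical_Int_N_CR: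
  assumes p: "odd p" and \<sigma>: "sign_function T z \<sigma>"
  shows "(fun_space.span {one_on P} + fun_space.span (critical_function T z \<sigma> (p - 1) ` C)) \<inter> N_CR p P
    = fun_space.span {one_on P}" (is "(?A + ?S) \<inter> _ = _")
proof
  show "(?A + ?S) \<inter> N_CR p P \<subseteq> ?A"
  proof
    fix f assume f: "f \<in> (?A + ?S) \<inter> N_CR p P"
    then obtain a s where as: "f = a + s" "a \<in> ?A" "s \<in> ?S" by (auto elim: set_plus_elim)
    obtain k where "a = fun_scale k (one_on P)" using as(2) by (auto simp: fun_space.span_singleton)
    then have "f - fun_scale k (one_on P) \<in> fun_space.span (crit p (\<lambda>_. \<sigma>) ` C)" using as by simp
    then show "f \<in> ?A"
      using N_CR_span_critical[of p "\<lambda>_. \<sigma>" f k] p sign_function_local[OF \<sigma>] f by blast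
  qed
  show "?A \<subseteq> (?A + ?S) \<inter> N_CR p P"
  proof
    fix f assume f: "f \<in> ?A"
    have "f + 0 \<in> ?A + ?S" by (intro set_plus_intro f fun_space.span_zero)
    then show "f \<in> (?A + ?S) \<inter> N_CR p P" using f span_one_on_subset_N_CR by auto
  qed
qed

end

section \<open>The intersection of the critical span with the Crouzeix-Raviart annihilator\<close>

text \<open>
  A triangle is the closure of its interior, so \<open>z\<close> lies in the closure of \<open>\<Omega>\<close>; not being on the
  frontier, it is an inner point.
\<close>

lemma vertex_star_inner_vertex:
  assumes T: "regular_triangulation T \<Omega>" and z: "z \<in> inner_vertices T \<Omega>"
  shows "vertex_star T z"
proof
  show "finite T" "\<And>K. K \<in> T \<Longrightarrow> 2 simplex K"
    using T by (auto simp: regular_triangulation_def)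
  show "K \<inter> K' = {} \<or> (K \<inter> K' edge_of K \<and> K \<inter> K' edge_of K') \<or>
        (\<exists>x. x extreme_point_of K \<and> x extreme_point_of K' \<and> K \<inter> K' = {x})"
    if "K \<in> T" "K' \<in> T" "K \<noteq> K'" for K K'
    using T that unfolding regular_triangulation_def by blast
  show zV: "z \<in> vertices T" using z by (simp add: inner_vertices_def)
  then obtain K where K: "K \<in> T" "z extreme_point_of K" by (auto simp: vertices_def)
  have \<Omega>: "\<Omega> = interior (\<Union>T)" using T by (simp add: regular_triangulation_def)
  obtain a b c where t: "tri K a b c" using simplex_tri T K(1) by (metis regular_triangulation_def)
  have "z \<in> closure (interior K)" using tri_topology(5)[OF t] K(2) by (simp add: extreme_point_of_def)
  moreover have "interior K \<subseteq> \<Omega>" unfolding \<Omega> using K(1) by (intro interior_mono) auto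
  ultimately have "z \<in> closure \<Omega>" using closure_mono by blast
  moreover have "z \<notin> frontier \<Omega>" using z by (simp add: inner_vertices_def)
  ultimately have "z \<in> interior \<Omega>" by (simp add: frontier_def)
  then show "z \<in> interior (\<Union>T)" by (simp add: \<Omega>)
qed

theorem lemma3p14:
  fixes \<Omega> :: "(real^2) set" and T :: "(real^2) set set" and z :: "real^2" and p :: nat
  assumes "p \<ge> 3" and "odd p"
    and "polygonal_domain \<Omega>" and "bounded \<Omega>"
    and "regular_triangulation T \<Omega>"
    and "\<forall>K\<in>T. \<exists>x\<in>inner_vertices T \<Omega>. x extreme_point_of K"
    and "z \<in> inner_vertices T \<Omega>"
  shows "(\<forall>\<sigma>. sign_function T z \<sigma> \<longrightarrow>
            (fun_space.span {one_on (patch T z)}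
               + fun_space.span (critical_function T z \<sigma> (p - 1) ` critical_points T z))
              \<inter> N_CR p (patch T z)
            = fun_space.span {one_on (patch T z)})
       \<and> (fun_space.dim (N_conf p (patch T z)) = 1 + card (critical_points T z) \<longrightarrow>
            fun_space.dim (N_CR p (patch T z)) = 1)"
proof -
  interpret vertex_star T z using assms(5,7) by (rule vertex_star_inner_vertex)
  show ?thesis using span_critical_Int_N_CR dim_N_CR assms(2) by blast
qed

end
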